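(* Let $\mathcal{C}$ be a class of graphs closed under taking subgraphs. Then the following three statements are equivalent: 1. First-order logic (FO) and monadic second-order logic (MSO) have the same expressive power on $\mathcal{C}$. 2. First-order logic (FO) and guarded second-order logic (GSO) have the same expressive power on $\mathcal{C}$. 3. $\mathcal{C}$ has bounded tree depth.
   Context: Graphs are undirected and simple, viewed as logical structures over the vocabulary $\{E\}$ with $E$ binary (the symmetric, irreflexive edge relation), whose universe is the vertex set. A subgraph is obtained by arbitrarily deleting vertices and edges. **Tree depth.** Let $G=(V,E)$ be a graph with connected components $(G_i)_{i\in I}$; $G[U]$ denotes the subgraph induced on $U\subseteq V$. The tree depth $\mathrm{td}(G)$ is defined recursively by $$\mathrm{td}(G)=\begin{cases}1 & \text{if } |V|=1,\\ 1+\min_{x\in V}\mathrm{td}(G[V\setminus\{x\}]) & \text{if } |V|>1 \text{ and } |I|=1,\\ \max_{i\in I}\mathrm{td}(G_i) & \text{otherwise.}\end{cases}$$ A class $\mathcal{C}$ of graphs has bounded tree depth if there is $d\in\mathbb{N}$ such that $\mathrm{td}(G)\le d$ for every $G\in\mathcal{C}$. **Logics.** FO is first-order logic with equality. MSO is the fragment of second-order logic in which all second-order variables are monadic (arity 1, i.e. range over sets of vertices). GSO has the same syntax as full second-order logic (relation variables of arbitrary arity), but its semantics allows only guarded relations as values of second-order variables: the Gaifman graph of a relation $R\subseteq S^r$ on a set $S$ is the undirected graph with vertex set $S$ in which two distinct $u,v$ are adjacent iff both occur in a common tuple of $R$; the Gaifman graph of a structure is the union of the Gaifman graphs of its relations;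 and $R$ is guarded in a structure with universe $S$ if the Gaifman graph of $R$ is a subgraph of the Gaifman graph of the structure. **Expressive power.** For logics $L_1,L_2$ and a class $\mathcal{C}$ of structures, $L_1\leqq_{\mathcal{C}}L_2$ means that for every $L_1$-sentence $\varphi_1$ there is an $L_2$-sentence $\varphi_2$ such that exactly the same members of $\mathcal{C}$ satisfy $\varphi_1$ and $\varphi_2$. $L_1$ and $L_2$ have the same expressive power on $\mathcal{C}$ if $L_1\leqq_{\mathcal{C}}L_2$ and $L_2\leqq_{\mathcal{C}}L_1$. *)

theory Defs
  imports "Graph_Theory.Graph_Theory" "HOL-Library.Extended_Nat"
begin

section \<open>Graphs\<close>

text \<open>
  An undirected simple graph, viewed as a structure over one binary relation symbol, is a vertex
  set with a symmetric irreflexive relation on it. In \<open>Graph_Theory\<close> this is the locale predicate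
  \<open>pair_bidirected_digraph\<close>, which unlike \<open>pair_graph\<close> does not demand finiteness. As usual for
  logical structures, the universe is non-empty; it may be infinite.
\<close>

definition undirected_graph :: "'a pair_pre_digraph \<Rightarrow> bool" where
  "undirected_graph G \<longleftrightarrow> pair_bidirected_digraph G \<and> pverts G \<noteq> {}"

definition graph_class :: "'a pair_pre_digraph set \<Rightarrow> bool" where
  "graph_class C \<longleftrightarrow> (\<forall>G\<in>C. undirected_graph G)"

definition closed_under_subgraphs :: "'a pair_pre_digraph set \<Rightarrow> bool" where
  "closed_under_subgraphs C \<longleftrightarrow>
     (\<forall>G\<in>C. \<forall>H. undirected_graph H \<and> subgraph (with_proj H) (with_proj G) \<longrightarrow> H \<in> C)"

section \<open>Tree depth\<close>

text \<open>
  In a symmetric digraph the strongly connected components are the connected components of the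
  underlying undirected graph, so \<open>sccs_verts\<close> is the family of their vertex sets. On infinite
  graphs the recursion need not bottom out, and the maximum over the components need not exist;
  taking the least fixed point in \<open>enat\<close> assigns \<open>\<infinity>\<close> in these cases. By \<open>td_unique\<close> below, the recursion equation has no other solution
  on (well-formed) graphs.
\<close>

definition td_step ::
  "(('a, 'b) pre_digraph \<Rightarrow> enat) \<Rightarrow> ('a, 'b) pre_digraph \<Rightarrow> enat" where
  "td_step f G =
    (if card (verts G) = 1 then 1
     else if card (pre_digraph.sccs_verts G) = 1
       then 1 + (INF x\<in>verts G. f (G \<restriction> (verts G - {x})))
     else (SUP S\<in>pre_digraph.sccs_verts G. f (G \<restriction> S)))"

definition td :: "('a, 'b) pre_digraph \<Rightarrow> enat" where
  "td = lfp td_step"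

lemma mono_td_step: "mono td_step"
proof (rule monoI, rule le_funI)
  fix f g :: "('a, 'b) pre_digraph \<Rightarrow> enat" and G
  assume "f \<le> g"
  then have le: "\<And>H. f H \<le> g H" by (simp add: le_fun_def)
  have "(INF x\<in>verts G. f (G \<restriction> (verts G - {x})))
      \<le> (INF x\<in>verts G. g (G \<restriction> (verts G - {x})))"
    by (rule INF_mono) (use le in blast)
  moreover have "(SUP S\<in>pre_digraph.sccs_verts G. f (G \<restriction> S))
      \<le> (SUP S\<in>pre_digraph.sccs_verts G. g (G \<restriction> S))"
    by (rule SUP_mono) (use le in blast)
  ultimately show "td_step f G \<le> td_step g G"
    by (simp add: td_step_def add_left_mono)
qed

lemma td_unfold:
  "td G =
    (if card (verts G) = 1 then 1
     else if card (pre_digraph.sccs_verts G) = 1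
       then 1 + (INF x\<in>verts G. td (G \<restriction> (verts G - {x})))
     else (SUP S\<in>pre_digraph.sccs_verts G. td (G \<restriction> S)))"
proof -
  have "td = td_step td"
    unfolding td_def by (rule lfp_unfold[OF mono_td_step])
  then have "td G = td_step td G" by (rule fun_cong)
  then show ?thesis by (simp only: td_step_def)
qed

lemma wf_digraph_restrict:
  assumes "wf_digraph G"
  shows "wf_digraph (G \<restriction> U)"
  using assms by (rule wf_digraph.wellformed_induce_subgraph)

lemma sccs_verts_restrict_scc:
  assumes wf: "wf_digraph G" and S: "S \<in> pre_digraph.sccs_verts G"
  shows "pre_digraph.sccs_verts (G \<restriction> S) = {S}"
proof -
  interpret wf_digraph G by (rule wf)
  interpret M: max_reachable_set G S by unfold_locales (rule S)
  have ne: "S \<noteq> {}" by (rule M.not_empty)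
  have reach: "u \<rightarrow>\<^sup>*\<^bsub>G \<restriction> S\<^esub> v" if "u \<in> S" "v \<in> S" for u v
    using M.reachable_induced[OF that M.reach_in[OF that]] .
  have mem: "u \<in> S" "v \<in> S" if "u \<rightarrow>\<^sup>*\<^bsub>G \<restriction> S\<^esub> v" for u v
    using reachable_in_vertsE[OF that] unfolding induce_subgraph_verts by blast+
  show ?thesis
  proof (intro equalityI subsetI)
    fix T assume "T \<in> pre_digraph.sccs_verts (G \<restriction> S)"
    then have T: "T \<noteq> {}" "\<And>u v. u \<in> T \<Longrightarrow> v \<in> T \<Longrightarrow> u \<rightarrow>\<^sup>*\<^bsub>G \<restriction> S\<^esub> v"
      "\<And>u v. u \<in> T \<Longrightarrow> v \<notin> T \<Longrightarrow> \<not> u \<rightarrow>\<^sup>*\<^bsub>G \<restriction> S\<^esub> v \<or> \<not> v \<rightarrow>\<^sup>*\<^bsub>G \<restriction> S\<^esub> u"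
      unfolding pre_digraph.sccs_verts_def by blast+
    have "T \<subseteq> S" using T(2) mem(1) by blast
    moreover have "S \<subseteq> T" using T(1,3) reach \<open>T \<subseteq> S\<close> by blast
    ultimately show "T \<in> {S}" by blast
  next
    fix T assume "T \<in> {S}"
    then show "T \<in> pre_digraph.sccs_verts (G \<restriction> S)"
      using reach mem ne unfolding pre_digraph.sccs_verts_def by blast
  qed
qed

lemma td_step_le:
  fixes f g :: "('a, 'b) pre_digraph \<Rightarrow> enat"
  assumes f: "\<And>G. wf_digraph G \<Longrightarrow> f G = td_step f G"
    and g: "\<And>G. wf_digraph G \<Longrightarrow> g G = td_step g G"
    and wf: "wf_digraph G"
  shows "g G \<le> f G"
proof -
  have "g G \<le> enat n" if "wf_digraph G" "f G \<le> enat n" for n and G :: "('a, 'b) pre_digraph"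
    using that
  proof (induction n arbitrary: G rule: less_induct)
    case (less n)
    have conn: "g H \<le> enat n"
      if H: "wf_digraph H" "f H \<le> enat n"
        and c: "card (verts H) = 1 \<or> card (pre_digraph.sccs_verts H) = 1" for H
    proof (cases "card (verts H) = 1")
      case True
      then have "g H = f H"
        using f[OF H(1)] g[OF H(1)] unfolding td_step_def by (simp only: refl if_True)
      with H(2) show ?thesis by simp
    next
      case False
      let ?F = "\<lambda>f x. f (H \<restriction> (verts H - {x})) :: enat"
      from c False have c1: "card (pre_digraph.sccs_verts H) = 1" by simp
      have fH: "f H = 1 + (INF x\<in>verts H. ?F f x)"
        and gH: "g H = 1 + (INF x\<in>verts H. ?F g x)"
        using f[OF H(1)] g[OF H(1)] False c1 unfolding td_step_def by (simp_all only: refl if_False if_True)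
      have ne: "?F f ` verts H \<noteq> {}"
      proof
        assume "?F f ` verts H = {}"
        then have "f H = \<infinity>" using fH by (simp add: top_enat_def)
        with H(2) show False by simp
      qed
      then have "Inf (?F f ` verts H) \<in> ?F f ` verts H"
        by (auto simp: Inf_enat_def intro: LeastI)
      then obtain x where x: "x \<in> verts H" "(INF x\<in>verts H. ?F f x) = ?F f x"
        by auto
      with fH H(2) have le: "1 + ?F f x \<le> enat n" by simp
      then obtain m where m: "?F f x = enat m" by (cases "?F f x") auto
      with le have "m < n" by (simp add: one_enat_def)
      then have "?F g x \<le> enat m"
        using less.IH m wf_digraph_restrict[OF H(1)] by simp
      with INF_lower[OF x(1), of "?F g"] have "(INF x\<in>verts H. ?F g x) \<le> enat m"
        by (rule order_trans)
      then have "g H \<le> 1 + enat m"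
        unfolding gH by (rule add_left_mono)
      also have "\<dots> \<le> enat n" using le m by simp
      finally show ?thesis .
    qed
    show ?case
    proof (cases "card (verts G) = 1 \<or> card (pre_digraph.sccs_verts G) = 1")
      case True
      with less.prems show ?thesis by (intro conn)
    next
      case False
      then have fG: "f G = (SUP S\<in>pre_digraph.sccs_verts G. f (G \<restriction> S))"
        and gG: "g G = (SUP S\<in>pre_digraph.sccs_verts G. g (G \<restriction> S))"
        using f[OF less.prems(1)] g[OF less.prems(1)] unfolding td_step_def
        by (simp_all only: de_Morgan_disj if_False)
      show ?thesis unfolding gG
      proof (rule SUP_least)
        fix S assume S: "S \<in> pre_digraph.sccs_verts G"
        have "f (G \<restriction> S) \<le> enat n"
          using SUP_upper[OF S, of "\<lambda>S. f (G \<restriction> S)"] less.prems(2) unfolding fG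
          by (rule order_trans)
        then show "g (G \<restriction> S) \<le> enat n"
          by (intro conn wf_digraph_restrict less.prems(1))
            (simp_all add: sccs_verts_restrict_scc[OF less.prems(1) S])
      qed
    qed
  qed
  with wf show ?thesis by (cases "f G") auto
qed

lemma td_unique:
  assumes f: "\<And>G. wf_digraph G \<Longrightarrow> f G = td_step f G" and wf: "wf_digraph G"
  shows "f G = td G"
proof (rule antisym)
  have td: "td H = td_step td H" if "wf_digraph H" for H :: "('a, 'b) pre_digraph"
    unfolding td_step_def by (rule td_unfold)
  show "f G \<le> td G" by (rule td_step_le[OF td f wf])
  show "td G \<le> f G" by (rule td_step_le[OF f td wf])
qed

definition bounded_tree_depth :: "'a pair_pre_digraph set \<Rightarrow> bool" where
  "bounded_tree_depth C \<longleftrightarrow> (\<exists>d::nat. \<forall>G\<in>C. td (with_proj G) \<le> enat d)"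

section \<open>Second-order logic over graphs\<close>

text \<open>
  A relation variable is a pair of an index and an arity. The atom \<open>Rel i xs\<close> applies the variable
  \<open>(i, length xs)\<close>, and \<open>ExRel i r\<close> binds the variable \<open>(i, r)\<close>, so every formula is well-typed.
\<close>

datatype so_formula =
    Equal nat nat
  | Edge nat nat
  | Rel nat "nat list"
  | Neg so_formula
  | Conj so_formula so_formula
  | Ex nat so_formula
  | ExRel nat nat so_formula

primrec free_vars :: "so_formula \<Rightarrow> nat set" where
  "free_vars (Equal x y) = {x, y}"
| "free_vars (Edge x y) = {x, y}"
| "free_vars (Rel i xs) = set xs"
| "free_vars (Neg \<phi>) = free_vars \<phi>"
| "free_vars (Conj \<phi> \<psi>) = free_vars \<phi> \<union> free_vars \<psi>"
| "free_vars (Ex x \<phi>) = free_vars \<phi> - {x}"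
| "free_vars (ExRel i r \<phi>) = free_vars \<phi>"

primrec free_rel_vars :: "so_formula \<Rightarrow> (nat \<times> nat) set" where
  "free_rel_vars (Equal x y) = {}"
| "free_rel_vars (Edge x y) = {}"
| "free_rel_vars (Rel i xs) = {(i, length xs)}"
| "free_rel_vars (Neg \<phi>) = free_rel_vars \<phi>"
| "free_rel_vars (Conj \<phi> \<psi>) = free_rel_vars \<phi> \<union> free_rel_vars \<psi>"
| "free_rel_vars (Ex x \<phi>) = free_rel_vars \<phi>"
| "free_rel_vars (ExRel i r \<phi>) = free_rel_vars \<phi> - {(i, r)}"

definition sentence :: "so_formula \<Rightarrow> bool" where
  "sentence \<phi> \<longleftrightarrow> free_vars \<phi> = {} \<and> free_rel_vars \<phi> = {}"

primrec first_order :: "so_formula \<Rightarrow> bool" where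
  "first_order (Equal x y) \<longleftrightarrow> True"
| "first_order (Edge x y) \<longleftrightarrow> True"
| "first_order (Rel i xs) \<longleftrightarrow> False"
| "first_order (Neg \<phi>) \<longleftrightarrow> first_order \<phi>"
| "first_order (Conj \<phi> \<psi>) \<longleftrightarrow> first_order \<phi> \<and> first_order \<psi>"
| "first_order (Ex x \<phi>) \<longleftrightarrow> first_order \<phi>"
| "first_order (ExRel i r \<phi>) \<longleftrightarrow> False"

primrec monadic :: "so_formula \<Rightarrow> bool" where
  "monadic (Equal x y) \<longleftrightarrow> True"
| "monadic (Edge x y) \<longleftrightarrow> True"
| "monadic (Rel i xs) \<longleftrightarrow> length xs = 1"
| "monadic (Neg \<phi>) \<longleftrightarrow> monadic \<phi>"
| "monadic (Conj \<phi> \<psi>) \<longleftrightarrow> monadic \<phi> \<and> monadic \<psi>"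
| "monadic (Ex x \<phi>) \<longleftrightarrow> monadic \<phi>"
| "monadic (ExRel i r \<phi>) \<longleftrightarrow> r = 1 \<and> monadic \<phi>"

definition tuples :: "nat \<Rightarrow> 'a set \<Rightarrow> 'a list set" where
  "tuples r S = {t. length t = r \<and> set t \<subseteq> S}"

text \<open>
  The parameter \<open>adm\<close> selects the relations admitted as values of the second-order variables:
  all of them for standard semantics, the guarded ones for guarded semantics.
\<close>

primrec sat ::
  "('a list set \<Rightarrow> bool) \<Rightarrow> 'a pair_pre_digraph \<Rightarrow> (nat \<Rightarrow> 'a) \<Rightarrow> (nat \<times> nat \<Rightarrow> 'a list set) \<Rightarrow>
    so_formula \<Rightarrow> bool" where
  "sat adm G \<sigma> \<rho> (Equal x y) \<longleftrightarrow> \<sigma> x = \<sigma> y"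
| "sat adm G \<sigma> \<rho> (Edge x y) \<longleftrightarrow> (\<sigma> x, \<sigma> y) \<in> parcs G"
| "sat adm G \<sigma> \<rho> (Rel i xs) \<longleftrightarrow> map \<sigma> xs \<in> \<rho> (i, length xs)"
| "sat adm G \<sigma> \<rho> (Neg \<phi>) \<longleftrightarrow> \<not> sat adm G \<sigma> \<rho> \<phi>"
| "sat adm G \<sigma> \<rho> (Conj \<phi> \<psi>) \<longleftrightarrow> sat adm G \<sigma> \<rho> \<phi> \<and> sat adm G \<sigma> \<rho> \<psi>"
| "sat adm G \<sigma> \<rho> (Ex x \<phi>) \<longleftrightarrow> (\<exists>v\<in>pverts G. sat adm G (\<sigma>(x := v)) \<rho> \<phi>)"
| "sat adm G \<sigma> \<rho> (ExRel i r \<phi>) \<longleftrightarrow>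
     (\<exists>R. R \<subseteq> tuples r (pverts G) \<and> adm R \<and> sat adm G \<sigma> (\<rho>((i, r) := R)) \<phi>)"

lemma sat_cong:
  assumes "\<And>x. x \<in> free_vars \<phi> \<Longrightarrow> \<sigma> x = \<sigma>' x"
    and "\<And>X. X \<in> free_rel_vars \<phi> \<Longrightarrow> \<rho> X = \<rho>' X"
  shows "sat adm G \<sigma> \<rho> \<phi> \<longleftrightarrow> sat adm G \<sigma>' \<rho>' \<phi>"
  using assms
proof (induction \<phi> arbitrary: \<sigma> \<sigma>' \<rho> \<rho>')
  case (Rel i xs)
  then have "map \<sigma> xs = map \<sigma>' xs" by (auto intro: map_cong)
  with Rel show ?case by (auto simp del: map_eq_conv)
next
  case (Neg \<phi>)
  have "sat adm G \<sigma> \<rho> \<phi> \<longleftrightarrow> sat adm G \<sigma>' \<rho>' \<phi>"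
    by (rule Neg.IH) (use Neg.prems in auto)
  then show ?case by simp
next
  case (Conj \<phi> \<psi>)
  have "sat adm G \<sigma> \<rho> \<phi> \<longleftrightarrow> sat adm G \<sigma>' \<rho>' \<phi>"
    by (rule Conj.IH(1)) (use Conj.prems in auto)
  moreover have "sat adm G \<sigma> \<rho> \<psi> \<longleftrightarrow> sat adm G \<sigma>' \<rho>' \<psi>"
    by (rule Conj.IH(2)) (use Conj.prems in auto)
  ultimately show ?case by simp
next
  case (Ex x \<phi>)
  have "sat adm G (\<sigma>(x := v)) \<rho> \<phi> \<longleftrightarrow> sat adm G (\<sigma>'(x := v)) \<rho>' \<phi>" for v
    by (rule Ex.IH) (use Ex.prems in auto)
  then show ?case by simp
next
  case (ExRel i r \<phi>)
  have "sat adm G \<sigma> (\<rho>((i, r) := R)) \<phi> \<longleftrightarrow> sat adm G \<sigma>' (\<rho>'((i, r) := R)) \<phi>" for R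
    by (rule ExRel.IH) (use ExRel.prems in auto)
  then show ?case by simp
qed auto

text \<open>
  Satisfaction is only used for sentences, for which the assignments chosen here are immaterial
  by \<open>sat_cong\<close>.
\<close>

definition sat_sentence ::
  "('a list set \<Rightarrow> bool) \<Rightarrow> 'a pair_pre_digraph \<Rightarrow> so_formula \<Rightarrow> bool" where
  "sat_sentence adm G \<phi> \<longleftrightarrow> sat adm G (\<lambda>_. undefined) (\<lambda>_. {}) \<phi>"

section \<open>Guarded relations\<close>

definition gaifman_graph :: "'a set \<Rightarrow> 'a list set \<Rightarrow> 'a pair_pre_digraph" where
  "gaifman_graph S R =
     \<lparr> pverts = S, parcs = {(u, v). u \<noteq> v \<and> (\<exists>t\<in>R. u \<in> set t \<and> v \<in> set t)} \<rparr>"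

text \<open>
  The only relation of the structure \<open>G\<close> is its edge relation, here written as a set of tuples of
  length two.
\<close>

definition structure_gaifman_graph :: "'a pair_pre_digraph \<Rightarrow> 'a pair_pre_digraph" where
  "structure_gaifman_graph G = gaifman_graph (pverts G) {[u, v] | u v. (u, v) \<in> parcs G}"

definition guarded :: "'a pair_pre_digraph \<Rightarrow> 'a list set \<Rightarrow> bool" where
  "guarded G R \<longleftrightarrow>
     subgraph (with_proj (gaifman_graph (pverts G) R)) (with_proj (structure_gaifman_graph G))"

section \<open>Logics and expressive power\<close>

record 'a logic =
  sentences :: "so_formula set"
  models :: "'a pair_pre_digraph \<Rightarrow> so_formula \<Rightarrow> bool"

definition FO :: "'a logic" where
  "FO = \<lparr> sentences = {\<phi>. sentence \<phi> \<and> first_order \<phi>}, models = sat_sentence (\<lambda>_. True) \<rparr>"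

definition MSO :: "'a logic" where
  "MSO = \<lparr> sentences = {\<phi>. sentence \<phi> \<and> monadic \<phi>}, models = sat_sentence (\<lambda>_. True) \<rparr>"

definition GSO :: "'a logic" where
  "GSO = \<lparr> sentences = {\<phi>. sentence \<phi>}, models = (\<lambda>G. sat_sentence (guarded G) G) \<rparr>"

definition at_most_as_expressive :: "'a pair_pre_digraph set \<Rightarrow> 'a logic \<Rightarrow> 'a logic \<Rightarrow> bool" where
  "at_most_as_expressive C L1 L2 \<longleftrightarrow>
     (\<forall>\<phi>1\<in>sentences L1. \<exists>\<phi>2\<in>sentences L2. \<forall>G\<in>C. models L1 G \<phi>1 \<longleftrightarrow> models L2 G \<phi>2)"

definition same_expressive_power :: "'a pair_pre_digraph set \<Rightarrow> 'a logic \<Rightarrow> 'a logic \<Rightarrow> bool" where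
  "same_expressive_power C L1 L2 \<longleftrightarrow>
     at_most_as_expressive C L1 L2 \<and> at_most_as_expressive C L2 L1"

end

theory Submission
  imports Defs "HOL-Library.Countable" "HOL-Library.Nat_Bijection"
begin

text \<open>
  If the tree depth is unbounded, depth-first search finds arbitrarily long paths, so the class
  contains all long paths. These become indistinguishable for first-order logic, by an
  Ehrenfeucht-Fraisse argument, while MSO defines the parity of their number of vertices.

  For tree depth at most \<open>d\<close>, delete a vertex from every component of the graph, as prescribed by the
  definition of tree depth, and recurse. The GSO type of a graph with deleted vertices \<open>as\<close> is
  determined by the numbers, up to a threshold, of the components \<open>C\<close> for which \<open>C \<union> as\<close> has a
  given type, since a guarded tuple lies inside \<open>C \<union> as\<close> for some \<open>C\<close>. First-order logic can count
  up to a threshold, and it can quantify over the vertices of a component because bounded tree depth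
  bounds the distances in all induced subgraphs. So it defines the GSO types, by induction on the
  tree depth of the component.
\<close>

section \<open>Components and elimination depth\<close>

text \<open>Bounded tree depth bounds neither the number nor the size of the components, and graphs
  may be infinite, so component counts can only be compared up to a threshold. The threshold must
  survive the moves of a game: a move splits the pieces of one type according to their types after
  the move. If \<open>t\<close> is enough for rank \<open>q\<close> and there are at most
  \<open>M\<close> types of rank \<open>q\<close>, then \<open>t * M\<close> is enough for rank
  \<open>q + 1\<close>, because among \<open>t * M\<close> pieces of one type some outcome occurs
  \<open>t\<close> times and can absorb all surplus pieces. The pieces overlap in the deleted
  vertices, so the relations answered in the single pieces must agree there before they can be
  glued; for this the types record which tuples of deleted vertices lie in a relation. The vertex to
  delete need not be definable. It is quantified existentially, and the type that results no longer
  names it, so every admissible choice gives the same type. No formula for a type is written down: a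
  predicate that is determined by finitely many definable predicates is definable.\<close>

definition component :: "('a \<times> 'a) set \<Rightarrow> 'a set \<Rightarrow> 'a \<Rightarrow> 'a set" where
  "component E U v = {u. (v, u) \<in> (E \<inter> U \<times> U)\<^sup>*}"

text \<open>Reflexivity of the closure gives this for \<open>v\<close> outside \<open>U\<close> too,
  where the component is just \<open>{v}\<close>. The default spares side conditions, but
  \<open>component_in\<close> needs \<open>v \<in> U\<close>.\<close>

lemma component_self [simp]: "v \<in> component E U v"
  by (simp add: component_def)

lemma component_step:
  "u \<in> component E U v \<Longrightarrow> (u, x) \<in> E \<Longrightarrow> u \<in> U \<Longrightarrow> x \<in> U \<Longrightarrow> x \<in> component E U v"
  unfolding component_def by (auto intro: rtrancl_into_rtrancl)

lemma component_least:
  assumes "v \<in> S" "\<And>x y. x \<in> S \<Longrightarrow> x \<in> U \<Longrightarrow> y \<in> U \<Longrightarrow> (x, y) \<in> E \<Longrightarrow> y \<in> S"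
  shows "component E U v \<subseteq> S"
proof
  fix u assume "u \<in> component E U v"
  then have "(v, u) \<in> (E \<inter> U \<times> U)\<^sup>*" by (simp add: component_def)
  then show "u \<in> S" by induction (use assms in auto)
qed

lemma component_subset: "v \<in> U \<Longrightarrow> component E U v \<subseteq> U"
  by (rule component_least) auto

lemma component_in: "u \<in> component E U v \<Longrightarrow> v \<in> U \<Longrightarrow> u \<in> U"
  by (rule subsetD[OF component_subset])

lemma component_mono: "U \<subseteq> U' \<Longrightarrow> component E U v \<subseteq> component E U' v"
proof -
  assume "U \<subseteq> U'"
  then have "(E \<inter> U \<times> U)\<^sup>* \<subseteq> (E \<inter> U' \<times> U')\<^sup>*" by (intro rtrancl_mono) blast
  then show ?thesis unfolding component_def by blast
qed

lemma component_eq: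
  assumes "sym E" "u \<in> component E U v"
  shows "component E U u = component E U v"
proof -
  have "sym ((E \<inter> U \<times> U)\<^sup>*)"
    using assms(1) by (intro sym_rtrancl) (auto simp: sym_def)
  then show ?thesis
    using assms(2) unfolding component_def by (auto dest: symD intro: rtrancl_trans)
qed

lemma component_disjoint:
  assumes "sym E" "component E U u \<noteq> component E U v"
  shows "component E U u \<inter> component E U v = {}"
  using assms component_eq by (metis disjoint_iff)

lemma component_closed_subset:
  assumes "v \<in> S" "S \<subseteq> U" "\<And>x y. x \<in> S \<Longrightarrow> y \<in> U \<Longrightarrow> (x, y) \<in> E \<Longrightarrow> y \<in> S"
  shows "component E S v = component E U v"
proof
  show "component E S v \<subseteq> component E U v" by (rule component_mono) fact
  have "component E U v \<subseteq> component E S v \<inter> S"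
    by (rule component_least) (use assms in \<open>auto intro: component_step\<close>)
  then show "component E U v \<subseteq> component E S v" by blast
qed

text \<open>The set \<open>component E U v - B\<close> is closed under the edges of
  \<open>U - B\<close>. Hence deleting vertices inside one component and deleting them in all of
  \<open>U\<close> leave the same components there, and the recursion of tree depth can be described
  by lists of vertices deleted from the whole graph.\<close>

lemma component_component_diff:
  assumes "v \<in> U" "u \<in> component E U v - B"
  shows "component E (component E U v - B) u = component E (U - B) u"
  using assms component_subset[OF assms(1), of E]
  by (intro component_closed_subset) (auto intro: component_step)

lemma component_component:
  assumes "v \<in> U" "u \<in> component E U v"
  shows "component E (component E U v) u = component E U u"
  using component_component_diff[of v U u E "{}"] assms by simp

definition components :: "('a \<times> 'a) set \<Rightarrow> 'a set \<Rightarrow> 'a set set" where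
  "components E U = component E U ` U"

lemma components_component:
  assumes "sym E" "v \<in> U"
  shows "components E (component E U v) = {component E U v}"
proof -
  have "component E (component E U v) u = component E U v" if "u \<in> component E U v" for u
    using component_component[OF assms(2) that] component_eq[OF assms(1) that] by simp
  then show ?thesis unfolding components_def using component_self[of v E U] by blast
qed

lemma components_singletonD:
  assumes "card (components E U) = 1" "v \<in> U"
  shows "component E U v = U"
proof -
  obtain S where S: "components E U = {S}" using assms(1) by (auto simp: card_1_singleton_iff)
  then have "component E U u = S" if "u \<in> U" for u using that by (auto simp: components_def)
  then show ?thesis using assms(2) component_self component_in by (metis subsetI subset_antisym)
qed

text \<open>Upper bounds for tree depth as a predicate on the vertex sets of a fixed graph. The
  connected and the disconnected case are merged by treating all components at once, and a single
  vertex is covered by depth 0 of the empty set.\<close>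

fun elim_depth :: "('a \<times> 'a) set \<Rightarrow> nat \<Rightarrow> 'a set \<Rightarrow> bool" where
  "elim_depth E 0 U \<longleftrightarrow> U = {}"
| "elim_depth E (Suc e) U \<longleftrightarrow>
     (\<forall>v\<in>U. \<exists>w\<in>component E U v. elim_depth E e (component E U v - {w}))"

lemma elim_depth_empty [simp]: "elim_depth E e {}"
  by (cases e) auto

lemma elim_depth_mono:
  "elim_depth E e U \<Longrightarrow> U' \<subseteq> U \<Longrightarrow> elim_depth E e U'"
proof (induction e arbitrary: U U')
  case (Suc e)
  show ?case unfolding elim_depth.simps
  proof
    fix v assume v: "v \<in> U'"
    have sub: "component E U' v \<subseteq> component E U v" by (rule component_mono) fact
    from v Suc.prems obtain w
      where w: "w \<in> component E U v" "elim_depth E e (component E U v - {w})" by auto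
    show "\<exists>w\<in>component E U' v. elim_depth E e (component E U' v - {w})"
    proof (cases "w \<in> component E U' v")
      case True
      then show ?thesis using Suc.IH[OF w(2), of "component E U' v - {w}"] sub by blast
    next
      case False
      \<comment> \<open>The vertex \<open>w\<close> is already missing from the smaller component,
        so any vertex, here \<open>v\<close>, may be deleted in its place.\<close>
      then show ?thesis using Suc.IH[OF w(2), of "component E U' v - {v}"] sub component_self[of v E U'] by blast
    qed
  qed
qed simp

text \<open>A component is its own only component, so both sides impose the same condition. In this
  form the depth of \<open>U\<close> becomes a statement about every vertex of \<open>U\<close>,
  which is how formulas express it later.\<close>

lemma elim_depth_components:
  assumes "sym E"
  shows "elim_depth E e U \<longleftrightarrow> (\<forall>u\<in>U. elim_depth E e (component E U u))"
proof
  assume "elim_depth E e U"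
  then show "\<forall>u\<in>U. elim_depth E e (component E U u)"
    using elim_depth_mono component_subset by metis
next
  assume R: "\<forall>u\<in>U. elim_depth E e (component E U u)"
  show "elim_depth E e U"
  proof (cases e)
    case 0
    have "u \<notin> U" for u using R component_self[of u E U] unfolding 0 elim_depth.simps by blast
    then show ?thesis by (auto simp: 0)
  next
    case (Suc n)
    show ?thesis unfolding Suc elim_depth.simps
    proof
      fix v assume v: "v \<in> U"
      with R Suc have "elim_depth E (Suc n) (component E U v)" by blast
      then obtain w where "w \<in> component E (component E U v) v"
        "elim_depth E n (component E (component E U v) v - {w})"
        using component_self by (meson elim_depth.simps(2))
      then show "\<exists>w\<in>component E U v. elim_depth E n (component E U v - {w})"
        using component_component[OF v, of v E] by auto
    qed
  qed
qed

subsection \<open>Bounded walks\<close>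

text \<open>Bounded length makes reachability expressible in first-order logic. As for
  \<open>component\<close>, the trivial walk does not require \<open>v\<close> to lie in
  \<open>U\<close>.\<close>

fun walk_within :: "('a \<times> 'a) set \<Rightarrow> 'a set \<Rightarrow> nat \<Rightarrow> 'a \<Rightarrow> 'a \<Rightarrow> bool" where
  "walk_within E U 0 v u \<longleftrightarrow> v = u"
| "walk_within E U (Suc n) v u \<longleftrightarrow> v = u \<or>
     (\<exists>x. walk_within E U n v x \<and> x \<in> U \<and> u \<in> U \<and> (x, u) \<in> E)"

lemma walk_within_component: "walk_within E U n v u \<Longrightarrow> u \<in> component E U v"
  by (induction n arbitrary: u) (auto intro: component_step)

lemma walk_within_mono: "walk_within E U n v u \<Longrightarrow> n \<le> m \<Longrightarrow> U \<subseteq> U' \<Longrightarrow> walk_within E U' m v u"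
proof (induction n arbitrary: u m)
  case 0 then show ?case by (cases m) auto
next
  case (Suc n)
  then obtain k where k: "m = Suc k" "n \<le> k" by (cases m) auto
  show ?case
  proof (cases "v = u")
    case False
    with Suc.prems(1) obtain x where "walk_within E U n v x" "x \<in> U" "u \<in> U" "(x, u) \<in> E"
      by auto
    then show ?thesis using Suc.IH[of x k] Suc.prems(3) k by auto
  qed (simp add: k)
qed

lemma walk_within_trans:
  "walk_within E U m x u \<Longrightarrow> walk_within E U n v x \<Longrightarrow> walk_within E U (n + m) v u"
proof (induction m arbitrary: u)
  case (Suc m)
  show ?case
  proof (cases "x = u")
    case True
    then show ?thesis using Suc.prems walk_within_mono by (metis le_add1 order_refl)
  next
    case False
    then show ?thesis using Suc by auto
  qed
qed simp

lemma walk_within_sym: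
  assumes "sym E"
  shows "walk_within E U n v u \<Longrightarrow> walk_within E U n u v"
proof (induction n arbitrary: u)
  case (Suc n)
  show ?case
  proof (cases "v = u")
    case False
    then obtain x where x: "walk_within E U n v x" "x \<in> U" "u \<in> U" "(x, u) \<in> E"
      using Suc.prems by auto
    have "walk_within E U (Suc 0) u x" using x assms by (auto dest: symD)
    from walk_within_trans[OF Suc.IH[OF x(1)] this] show ?thesis by simp
  qed simp
qed simp

text \<open>Let \<open>w\<close> be the vertex to delete. Every other vertex of the component lies
  in a part of the rest that has an edge to \<open>w\<close>, so it reaches \<open>w\<close> within
  \<open>4 ^ e + 1\<close> steps. Two such walks have length at most \<open>2 * 4 ^ e + 2\<close>,
  which is at most \<open>4 ^ Suc e\<close>; the base 4 is chosen for this.\<close>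

lemma walk_within_bound:
  assumes "sym E"
  shows "elim_depth E e U \<Longrightarrow> v \<in> U \<Longrightarrow> u \<in> component E U v \<Longrightarrow> walk_within E U (4 ^ e) v u"
proof (induction e arbitrary: U u v)
  case (Suc e)
  define C where "C = component E U v"
  have CU: "C \<subseteq> U" unfolding C_def by (rule component_subset) fact
  from Suc.prems obtain w where w: "w \<in> C" "elim_depth E e (C - {w})"
    unfolding C_def by auto
  have IH: "walk_within E U (4 ^ e) a b" if "a \<in> C - {w}" "b \<in> component E (C - {w}) a" for a b
    using walk_within_mono[OF Suc.IH[OF w(2) that] order_refl] CU by blast
  have to_w: "walk_within E U (4 ^ e + 1) a w" if a: "a \<in> C" for a
  proof (cases "a = w")
    case False
    let ?D = "component E (C - {w}) a"
    have "\<exists>b\<in>?D. (b, w) \<in> E"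
    proof (rule ccontr)
      assume no: "\<not> ?thesis"
      have D: "?D \<subseteq> C - {w}" using a False by (intro component_subset) auto
      \<comment> \<open>Without an edge to \<open>w\<close> the part \<open>?D\<close> is closed
        under the edges of \<open>U\<close>, so it is the whole component of \<open>a\<close>, which
        contains \<open>w\<close>.\<close>
      have "component E U a \<subseteq> ?D"
      proof (rule component_least)
        fix x y assume xy: "x \<in> ?D" "x \<in> U" "y \<in> U" "(x, y) \<in> E"
        then have "x \<in> C" using D by blast
        then have "y \<in> C" unfolding C_def by (rule component_step) fact+
        have "y \<noteq> w" using no xy by blast
        show "y \<in> ?D"
          by (rule component_step[OF xy(1,4)]) (use \<open>y \<in> C\<close> \<open>y \<noteq> w\<close> D xy(1) in blast)+
      qed simp
      moreover have "component E U a = C" using a assms unfolding C_def by (intro component_eq) auto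
      ultimately show False using w(1) D by blast
    qed
    then obtain b where b: "b \<in> ?D" "(b, w) \<in> E" by blast
    have "b \<in> U" using b(1) a False CU component_in[of b E "C - {w}" a] by blast
    then show ?thesis using IH[OF _ b(1)] a False b(2) w(1) CU by auto
  qed (simp)
  have "walk_within E U (4 ^ e + 1) w u"
    using to_w[of u] walk_within_sym[OF assms] Suc.prems(3) C_def by blast
  from walk_within_trans[OF this to_w[of v]]
  have "walk_within E U (4 ^ e + 1 + (4 ^ e + 1)) v u" unfolding C_def by simp
  moreover have "(4::nat) ^ e + 1 + (4 ^ e + 1) \<le> 4 ^ Suc e"
    using one_le_power[of "4::nat" e] by simp
  ultimately show ?case by (rule walk_within_mono) simp
qed simp

section \<open>Tree depth and long paths\<close>

lemma undirected_graphD: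
  assumes "undirected_graph G"
  shows "sym (parcs G)" "pverts G \<noteq> {}" "wf_digraph (with_proj G)"
    "(u, v) \<in> parcs G \<Longrightarrow> u \<in> pverts G" "(u, v) \<in> parcs G \<Longrightarrow> v \<in> pverts G"
    "(u, v) \<in> parcs G \<Longrightarrow> u \<noteq> v"
proof -
  interpret pair_bidirected_digraph G using assms by (simp add: undirected_graph_def)
  show "sym (parcs G)" using pair_sym_arcs by (simp add: symmetric_def)
  show "pverts G \<noteq> {}" using assms by (simp add: undirected_graph_def)
  show "wf_digraph (with_proj G)" by (rule wf_digraph)
  show "u \<in> pverts G" "v \<in> pverts G" "u \<noteq> v" if "(u, v) \<in> parcs G"
    using that in_arcsD1 in_arcsD2 pair_no_loops by fastforce+
qed

lemma undirected_graphI: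
  assumes "V \<noteq> {}" "sym E" "\<And>u v. (u, v) \<in> E \<Longrightarrow> u \<in> V \<and> u \<noteq> v"
  shows "undirected_graph \<lparr>pverts = V, parcs = E\<rparr>"
proof -
  have "v \<in> V" if "(u, v) \<in> E" for u v using that assms(2,3) by (auto dest: symD)
  then have "pair_bidirected_digraph \<lparr>pverts = V, parcs = E\<rparr>"
    using assms by unfold_locales (auto simp: symmetric_def)
  then show ?thesis using assms(1) by (simp add: undirected_graph_def)
qed

text \<open>Reachability in a digraph is reflexive only on its vertices, hence the conjunct
  \<open>u \<in> U\<close>.\<close>

lemma reachable_restrict_iff:
  "u \<rightarrow>\<^sup>*\<^bsub>with_proj G \<restriction> U\<^esub> v \<longleftrightarrow> u \<in> U \<and> v \<in> component (parcs G) U u"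
proof -
  have arcs: "arcs_ends (with_proj G \<restriction> U) = parcs G \<inter> U \<times> U"
    by (auto simp: arcs_ends_def arc_to_ends_def)
  have "(u, v) \<in> rtrancl_on U (parcs G \<inter> U \<times> U) \<longleftrightarrow> u \<in> U \<and> (u, v) \<in> (parcs G \<inter> U \<times> U)\<^sup>*"
  proof
    assume "(u, v) \<in> rtrancl_on U (parcs G \<inter> U \<times> U)"
    then show "u \<in> U \<and> (u, v) \<in> (parcs G \<inter> U \<times> U)\<^sup>*"
      by induction (auto intro: converse_rtrancl_into_rtrancl rtrancl_into_rtrancl)
  next
    assume R: "u \<in> U \<and> (u, v) \<in> (parcs G \<inter> U \<times> U)\<^sup>*"
    then have "(u, v) \<in> (parcs G \<inter> U \<times> U)\<^sup>*" by simp
    then show "(u, v) \<in> rtrancl_on U (parcs G \<inter> U \<times> U)"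
      by induction (use R in \<open>auto intro: rtrancl_on_into_rtrancl_on\<close>)
  qed
  then show ?thesis unfolding reachable_def arcs component_def by simp
qed

lemma sccs_verts_restrict:
  assumes "sym (parcs G)"
  shows "pre_digraph.sccs_verts (with_proj G \<restriction> U) = components (parcs G) U"
proof (intro equalityI subsetI)
  fix S assume "S \<in> pre_digraph.sccs_verts (with_proj G \<restriction> U)"
  then have S: "S \<noteq> {}" "\<And>u v. u \<in> S \<Longrightarrow> v \<in> S \<Longrightarrow> u \<in> U \<and> v \<in> component (parcs G) U u"
    "\<And>u v. u \<in> S \<Longrightarrow> v \<notin> S \<Longrightarrow> \<not> (u \<in> U \<and> v \<in> component (parcs G) U u) \<or>
      \<not> (v \<in> U \<and> u \<in> component (parcs G) U v)"
    unfolding pre_digraph.sccs_verts_def reachable_restrict_iff by blast+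
  from S(1) obtain u where u: "u \<in> S" by blast
  have "v \<in> S" if "v \<in> component (parcs G) U u" for v
    using S(2)[OF u u] S(3)[OF u, of v] that component_eq[OF assms that]
      component_in[OF that] component_self by metis
  then have "S = component (parcs G) U u" using S(2)[OF u] by blast
  then show "S \<in> components (parcs G) U" using S(2)[OF u u] by (auto simp: components_def)
next
  fix S assume "S \<in> components (parcs G) U"
  then obtain w where w: "w \<in> U" "S = component (parcs G) U w" by (auto simp: components_def)
  have "u \<in> U \<and> component (parcs G) U u = S" if "u \<in> S" for u
    using that w component_eq[OF assms] component_in by metis
  then show "S \<in> pre_digraph.sccs_verts (with_proj G \<restriction> U)"
    unfolding pre_digraph.sccs_verts_def reachable_restrict_iff
    using component_self[of w] w by blast
qed

lemma restrict_restrict: "S \<subseteq> U \<Longrightarrow> (H \<restriction> U) \<restriction> S = H \<restriction> S"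
  by (auto simp: induce_subgraph_def)

lemma restrict_verts: "wf_digraph H \<Longrightarrow> H \<restriction> verts H = H"
  by (cases H) (auto simp: induce_subgraph_def wf_digraph_def)

text \<open>The recursion for tree depth, kept within the induced subgraphs of one graph
  \<open>G\<close>, so that later inductions range over vertex sets instead of graphs.\<close>

lemma td_restrict:
  assumes "sym (parcs G)"
  shows "td (with_proj G \<restriction> U) =
    (if card U = 1 then 1
     else if card (components (parcs G) U) = 1
       then 1 + (INF x\<in>U. td (with_proj G \<restriction> (U - {x})))
     else (SUP S\<in>components (parcs G) U. td (with_proj G \<restriction> S)))"
proof -
  have "S \<subseteq> U" if "S \<in> components (parcs G) U" for S
    using that component_subset unfolding components_def by (metis imageE)
  then show ?thesis
    by (subst td_unfold) (simp add: sccs_verts_restrict[OF assms] restrict_restrict)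
qed

lemma td_component_le:
  assumes "sym (parcs G)" "v \<in> U"
  shows "td (with_proj G \<restriction> component (parcs G) U v) \<le> td (with_proj G \<restriction> U)"
proof (cases "card U = 1 \<or> card (components (parcs G) U) = 1")
  case True
  have "component (parcs G) U v = U" if "card U = 1"
  proof -
    from that assms(2) have "U = {v}" by (auto simp: card_1_singleton_iff)
    then show ?thesis using component_subset[OF assms(2), of "parcs G"] component_self[of v "parcs G" U] by blast
  qed
  with True components_singletonD[OF _ assms(2)] show ?thesis by auto
next
  case False
  then show ?thesis using assms
    by (subst (2) td_restrict) (auto intro!: SUP_upper simp: components_def)
qed

lemma td_le_if_components:
  assumes "sym (parcs G)" "\<And>v. v \<in> U \<Longrightarrow> td (with_proj G \<restriction> component (parcs G) U v) \<le> n"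
  shows "td (with_proj G \<restriction> U) \<le> n"
proof (cases "card U = 1 \<or> card (components (parcs G) U) = 1")
  case True
  then obtain v where v: "v \<in> U"
    by (metis card_1_singletonE components_def empty_is_image insertI1 insert_not_empty is_singletonI'
        is_singleton_def)
  have "component (parcs G) U v = U" if "card U = 1"
  proof -
    from that v have "U = {v}" by (auto simp: card_1_singleton_iff)
    then show ?thesis using component_subset[OF v, of "parcs G"] component_self[of v "parcs G" U] by blast
  qed
  with True components_singletonD[OF _ v] assms(2)[OF v] show ?thesis by auto
next
  case False
  then show ?thesis using assms
    by (subst td_restrict) (auto intro!: SUP_least simp: components_def)
qed

lemma td_connected:
  assumes "sym (parcs G)" "v \<in> U" "S = component (parcs G) U v"
  shows "td (with_proj G \<restriction> S) =
    (if card S = 1 then 1 else 1 + (INF x\<in>S. td (with_proj G \<restriction> (S - {x}))))"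
  by (subst td_restrict[OF assms(1)]) (simp add: components_component assms)

lemma elim_depth_if_td:
  assumes "sym (parcs G)"
  shows "td (with_proj G \<restriction> U) \<le> enat e \<Longrightarrow> elim_depth (parcs G) e U"
proof (induction e arbitrary: U)
  case 0
  show ?case
  proof (rule ccontr)
    assume "\<not> elim_depth (parcs G) 0 U"
    then obtain v where v: "v \<in> U" by auto
    have "td (with_proj G \<restriction> component (parcs G) U v) \<le> 0"
      using td_component_le[OF assms v] 0 by (simp add: zero_enat_def)
    then show False by (subst (asm) td_connected[OF assms v refl]) (auto split: if_splits)
  qed
next
  case (Suc e)
  show ?case unfolding elim_depth.simps
  proof
    fix v assume v: "v \<in> U"
    let ?S = "component (parcs G) U v"
    have le: "td (with_proj G \<restriction> ?S) \<le> enat (Suc e)"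
      using td_component_le[OF assms v] Suc.prems by (rule order_trans)
    show "\<exists>w\<in>?S. elim_depth (parcs G) e (?S - {w})"
    proof (cases "card ?S = 1")
      case True
      then have "?S = {v}" by (metis card_1_singletonE component_self singletonD)
      then show ?thesis by (intro bexI[of _ v]) auto
    next
      case False
      let ?F = "(\<lambda>x. td (with_proj G \<restriction> (?S - {x}))) ` ?S"
      have "1 + Inf ?F \<le> enat (Suc e)"
        using le False by (subst (asm) td_connected[OF assms v refl]) simp
      then have inf: "Inf ?F \<le> enat e" by (cases "Inf ?F") (auto simp: one_enat_def)
      have "?F \<noteq> {}" using component_self[of v "parcs G" U] by blast
      \<comment> \<open>A non-empty set of extended natural numbers attains its infimum; this
        supplies the vertex to delete.\<close>
      then have "Inf ?F \<in> ?F" by (auto simp: Inf_enat_def intro: LeastI)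
      then obtain w where "w \<in> ?S" "td (with_proj G \<restriction> (?S - {w})) \<le> enat e"
        using inf by force
      then show ?thesis using Suc.IH by blast
    qed
  qed
qed

section \<open>Long paths in graphs of large tree depth\<close>

fun is_path :: "('a \<times> 'a) set \<Rightarrow> 'a list \<Rightarrow> bool" where
  "is_path E [] \<longleftrightarrow> True"
| "is_path E [x] \<longleftrightarrow> True"
| "is_path E (x # y # p) \<longleftrightarrow> (x, y) \<in> E \<and> x \<notin> set (y # p) \<and> is_path E (y # p)"

lemma path_distinct: "is_path E p \<Longrightarrow> distinct p"
  by (induction E p rule: is_path.induct) auto

lemma path_nth: "is_path E p \<Longrightarrow> Suc i < length p \<Longrightarrow> (p ! i, p ! Suc i) \<in> E"
  by (induction E p arbitrary: i rule: is_path.induct) (auto simp: nth_Cons split: nat.splits)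

text \<open>Delete the start \<open>v\<close> of the search. As \<open>U\<close> is connected, every
  component of \<open>U - {v}\<close> contains a neighbour \<open>u\<close> of \<open>v\<close>, and
  putting \<open>v\<close> in front of a path from \<open>u\<close> lengthens it by one. So the
  search restarts at \<open>u\<close> with the bound reduced by one.\<close>

lemma td_le_if_no_long_path:
  assumes "sym (parcs G)"
  shows "v \<in> U \<Longrightarrow> component (parcs G) U v = U \<Longrightarrow>
    (\<And>p. is_path (parcs G) (v # p) \<Longrightarrow> set p \<subseteq> U \<Longrightarrow> length p < n) \<Longrightarrow>
    td (with_proj G \<restriction> U) \<le> enat n"
proof (induction n arbitrary: U v)
  case 0
  then show ?case using "0.prems"(3)[of "[]"] by simp
next
  case (Suc n)
  let ?E = "parcs G"
  have "td (with_proj G \<restriction> (U - {v})) \<le> enat n"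
  proof (rule td_le_if_components[OF assms])
    fix x assume x: "x \<in> U - {v}"
    let ?S = "component ?E (U - {v}) x"
    have S: "?S \<subseteq> U - {v}" using component_subset[OF x] .
    have "\<exists>u\<in>?S. (v, u) \<in> ?E"
    proof (rule ccontr)
      assume no: "\<not> ?thesis"
      have "component ?E U x \<subseteq> ?S"
      proof (rule component_least)
        fix a b assume ab: "a \<in> ?S" "a \<in> U" "b \<in> U" "(a, b) \<in> ?E"
        with no assms have "b \<noteq> v" by (meson symD)
        then have "a \<in> U - {v}" "b \<in> U - {v}" using ab S by blast+
        then show "b \<in> ?S" by (rule component_step[OF ab(1,4)])
      qed simp
      moreover have "component ?E U x = U"
        using component_eq[OF assms, of x U v] x Suc.prems(2) by simp
      ultimately show False using S Suc.prems(1) by blast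
    qed
    then obtain u where u: "u \<in> ?S" "(v, u) \<in> ?E" by blast
    have Su: "component ?E (U - {v}) u = ?S" using component_eq[OF assms u(1)] .
    show "td (with_proj G \<restriction> ?S) \<le> enat n"
    proof (rule Suc.IH[OF u(1)])
      show "component ?E ?S u = ?S" using component_component[OF x u(1)] Su by simp
    next
      fix p assume p: "is_path ?E (u # p)" "set p \<subseteq> ?S"
      then have "is_path ?E (v # u # p)" "set (u # p) \<subseteq> U" using u S by auto
      from Suc.prems(3)[OF this] show "length p < n" by simp
    qed
  qed
  then have "(INF x\<in>U. td (with_proj G \<restriction> (U - {x}))) \<le> enat n"
    using Suc.prems(1) by (meson INF_lower2)
  then have "1 + (INF x\<in>U. td (with_proj G \<restriction> (U - {x}))) \<le> 1 + enat n"
    by (rule add_left_mono)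
  also have "\<dots> = enat (Suc n)" by (simp add: one_enat_def)
  finally show ?case
    by (subst td_connected[OF assms Suc.prems(1) Suc.prems(2)[symmetric]]) (simp add: one_enat_def)
qed

lemma long_path_if_td:
  assumes "undirected_graph G" "\<not> td (with_proj G) \<le> enat n"
  obtains p where "is_path (parcs G) p" "set p \<subseteq> pverts G" "length p = Suc n"
proof -
  note G = undirected_graphD[OF assms(1)]
  \<comment> \<open>The search only yields a path with at least \<open>Suc n\<close> vertices;
    prefixes cut it to the exact length.\<close>
  have sp: "is_path (parcs G) (take k p)" if "is_path (parcs G) p" for k p
    using that
  proof (induction "parcs G" p arbitrary: k rule: is_path.induct)
    case (2 x) then show ?case by (cases k) auto
  next
    case (3 x y p)
    show ?case
    proof (cases k)
      case (Suc j)
      have "is_path (parcs G) (take j (y # p))" using 3 by simp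
      with 3 Suc show ?thesis by (cases j) (auto dest: in_set_takeD)
    qed simp
  qed simp
  have "\<exists>v p. v \<in> pverts G \<and> is_path (parcs G) (v # p) \<and> set p \<subseteq> pverts G \<and> n \<le> length p"
  proof (rule ccontr)
    assume no: "\<not> ?thesis"
    have "td (with_proj G \<restriction> pverts G) \<le> enat n"
    proof (rule td_le_if_components[OF G(1)])
      fix v assume v: "v \<in> pverts G"
      let ?S = "component (parcs G) (pverts G) v"
      show "td (with_proj G \<restriction> ?S) \<le> enat n"
        using no v component_subset[OF v, of "parcs G"] component_component[OF v component_self]
        by (intro td_le_if_no_long_path[OF G(1) component_self]) (auto simp: not_le)
    qed
    with assms(2) show False using restrict_verts[OF G(3)] by simp
  qed
  then obtain v p where "v \<in> pverts G" "is_path (parcs G) (v # p)" "set p \<subseteq> pverts G" "n \<le> length p"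
    by blast
  then show thesis
    using sp[of "v # p" "Suc n"] by (intro that[of "take (Suc n) (v # p)"]) (auto dest: in_set_takeD)
qed

section \<open>Comparing the logics syntactically\<close>

definition clique_tuple :: "('a \<times> 'a) set \<Rightarrow> 'a list \<Rightarrow> bool" where
  "clique_tuple E t \<longleftrightarrow> (\<forall>u\<in>set t. \<forall>v\<in>set t. u \<noteq> v \<longrightarrow> (u, v) \<in> E)"

text \<open>Two distinct entries of one tuple form an edge of the Gaifman graph of \<open>R\<close>,
  and the Gaifman graph of \<open>G\<close> is \<open>G\<close> itself, by symmetry and the absence
  of loops.\<close>

lemma guarded_iff:
  assumes G: "undirected_graph G" and R: "R \<subseteq> tuples r (pverts G)"
  shows "guarded G R \<longleftrightarrow> (\<forall>t\<in>R. clique_tuple (parcs G) t)"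
proof -
  note D = undirected_graphD[OF G]
  have parcs: "parcs (structure_gaifman_graph G) = parcs G"
  proof -
    have "(\<exists>t\<in>{[a, b] | a b. (a, b) \<in> parcs G}. u \<in> set t \<and> v \<in> set t) \<longleftrightarrow> (u, v) \<in> parcs G"
      if "u \<noteq> v" for u v
    proof
      assume "(u, v) \<in> parcs G"
      then show "\<exists>t\<in>{[a, b] | a b. (a, b) \<in> parcs G}. u \<in> set t \<and> v \<in> set t"
        by (intro bexI[of _ "[u, v]"]) auto
    qed (use that symD[OF D(1)] in auto)
    then show ?thesis using D(6) symD[OF D(1)]
      by (auto simp: structure_gaifman_graph_def gaifman_graph_def)
  qed
  have verts: "pverts (structure_gaifman_graph G) = pverts G"
    by (simp add: structure_gaifman_graph_def gaifman_graph_def)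
  have RV: "u \<in> pverts G" if "t \<in> R" "u \<in> set t" for t u
    using R that by (auto simp: tuples_def)
  have wf: "wf_digraph (with_proj (structure_gaifman_graph G))"
    "wf_digraph (with_proj (gaifman_graph (pverts G) R))"
    using D(4,5) RV by (unfold_locales, auto simp: parcs verts gaifman_graph_def)
  show ?thesis
    unfolding guarded_def subgraph_def compatible_def clique_tuple_def using wf
    by (auto simp: parcs verts) (auto simp: gaifman_graph_def)
qed

lemma sat_first_order_cong:
  "first_order \<phi> \<Longrightarrow> sat adm G \<sigma> \<rho> \<phi> \<longleftrightarrow> sat adm' G \<sigma> \<rho>' \<phi>"
  by (induction \<phi> arbitrary: \<sigma>) auto

text \<open>A tuple of length one has no two distinct entries, so every unary relation is
  guarded.\<close>

lemma sat_guarded_monadic: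
  assumes "undirected_graph G"
  shows "monadic \<phi> \<Longrightarrow> sat (guarded G) G \<sigma> \<rho> \<phi> \<longleftrightarrow> sat (\<lambda>_. True) G \<sigma> \<rho> \<phi>"
proof (induction \<phi> arbitrary: \<sigma> \<rho>)
  case (ExRel i r \<phi>)
  have "guarded G R" if R: "R \<subseteq> tuples 1 (pverts G)" for R
    using R by (subst guarded_iff[OF assms R]) (auto simp: tuples_def clique_tuple_def length_Suc_conv)
  then show ?case using ExRel by auto
qed auto

lemma first_order_imp_monadic: "first_order \<phi> \<Longrightarrow> monadic \<phi>"
  by (induction \<phi>) auto

lemma at_most_FO_MSO: "at_most_as_expressive C FO MSO"
  unfolding at_most_as_expressive_def FO_def MSO_def using first_order_imp_monadic by auto

lemma at_most_FO_GSO: "at_most_as_expressive C FO GSO"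
  unfolding at_most_as_expressive_def FO_def GSO_def sat_sentence_def
  using sat_first_order_cong by fastforce

lemma at_most_MSO_if_GSO:
  fixes C :: "'a pair_pre_digraph set"
  assumes "graph_class C" "at_most_as_expressive C GSO FO"
  shows "at_most_as_expressive C MSO FO"
  unfolding at_most_as_expressive_def
proof
  fix \<phi> assume "\<phi> \<in> sentences (MSO :: 'a logic)"
  then have \<phi>: "\<phi> \<in> sentences (GSO :: 'a logic)" "monadic \<phi>" by (auto simp: MSO_def GSO_def)
  have "\<exists>\<psi>\<in>sentences (FO :: 'a logic). \<forall>G\<in>C. models GSO G \<phi> \<longleftrightarrow> models FO G \<psi>"
    using assms(2) \<phi>(1) unfolding at_most_as_expressive_def by (rule bspec)
  then obtain \<psi> where \<psi>: "\<psi> \<in> sentences (FO :: 'a logic)" "\<forall>G\<in>C. models GSO G \<phi> \<longleftrightarrow> models FO G \<psi>"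
    by blast
  have "models GSO G \<phi> \<longleftrightarrow> models MSO G \<phi>" if "G \<in> C" for G
    using assms(1) that sat_guarded_monadic[OF _ \<phi>(2)]
    by (auto simp: graph_class_def GSO_def MSO_def sat_sentence_def)
  with \<psi> show "\<exists>\<psi>\<in>sentences (FO :: 'a logic). \<forall>G\<in>C. models MSO G \<phi> \<longleftrightarrow> models FO G \<psi>" by auto
qed

section \<open>First-order logic on long paths\<close>

definition path_graph :: "'a list \<Rightarrow> 'a pair_pre_digraph" where
  "path_graph p = \<lparr>pverts = set p,
     parcs = {(p ! i, p ! j) | i j. i < length p \<and> j < length p \<and> (j = Suc i \<or> i = Suc j)}\<rparr>"

lemma path_graph_edge_iff:
  assumes "distinct p" "i < length p" "j < length p"
  shows "(p ! i, p ! j) \<in> parcs (path_graph p) \<longleftrightarrow> j = Suc i \<or> i = Suc j"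
  using assms by (auto simp: path_graph_def nth_eq_iff_index_eq)

lemma undirected_path_graph:
  assumes "distinct p" "p \<noteq> []"
  shows "undirected_graph (path_graph p)"
  unfolding path_graph_def
  by (rule undirected_graphI) (use assms in \<open>auto simp: sym_def nth_eq_iff_index_eq\<close>)

lemma subgraph_path_graph:
  assumes "undirected_graph G" "is_path (parcs G) p" "set p \<subseteq> pverts G" "p \<noteq> []"
  shows "subgraph (with_proj (path_graph p)) (with_proj G)"
proof -
  have "parcs (path_graph p) \<subseteq> parcs G"
    using path_nth[OF assms(2)] undirected_graphD(1)[OF assms(1)]
    by (auto simp: path_graph_def sym_def)
  then show ?thesis
    using undirected_graphD(3)[OF assms(1)] assms
      undirected_graphD(3)[OF undirected_path_graph[OF path_distinct[OF assms(2)] assms(4)]]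
    by (auto simp: subgraph_def compatible_def path_graph_def)
qed

section \<open>Positions on two paths, compared up to a distance threshold\<close>

definition agree :: "int \<Rightarrow> int \<Rightarrow> int \<Rightarrow> bool" where
  "agree K a b \<longleftrightarrow> a = b \<or> (K \<le> a \<and> K \<le> b) \<or> (a \<le> - K \<and> b \<le> - K)"

text \<open>A position in the Ehrenfeucht-Fraisse game on two paths: \<open>Z\<close> pairs the
  chosen indices, and signed differences must agree once they are cut off at \<open>K\<close>.
  Integers are used so that -1 can stand for the place before the first vertex.\<close>

definition similar :: "int \<Rightarrow> (int \<times> int) set \<Rightarrow> bool" where
  "similar K Z \<longleftrightarrow> 
    (\<forall>a a' b b'. (a, a') \<in> Z \<longrightarrow> (b, b') \<in> Z \<longrightarrow> agree K (b - a) (b' - a'))"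

lemma similar_mono: "similar K Z \<Longrightarrow> K' \<le> K \<Longrightarrow> similar K' Z"
  unfolding similar_def agree_def by (meson minus_le_iff order_trans neg_le_iff_le)

lemma similar_converse: "similar K (Z\<inverse>) \<longleftrightarrow> similar K Z"
proof -
  have "agree K a b \<longleftrightarrow> agree K b a" for a b by (auto simp: agree_def)
  then show ?thesis unfolding similar_def converse_iff by blast
qed

lemma similar_insert:
  assumes "similar K Z" "0 \<le> K" "\<And>a a'. (a, a') \<in> Z \<Longrightarrow> agree K (c - a) (c' - a')"
  shows "similar K (insert (c, c') Z)"
proof -
  have "agree K (a - c) (a' - c')" if "(a, a') \<in> Z" for a a'
    using assms(3)[OF that] by (auto simp: agree_def)
  then show ?thesis using assms unfolding similar_def by (auto simp: agree_def[of K 0 0])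
qed

text \<open>If \<open>c\<close> is at distance less than \<open>K\<close> from some \<open>a\<close>, it is copied with its offset from \<open>a\<close>;
  otherwise it is put at distance \<open>K\<close> above the image of its predecessor in \<open>Z\<close>.\<close>

lemma similar_extend:
  assumes Z: "similar (2 * K) Z" "finite Z" "1 \<le> K" and bot: "(b, b') \<in> Z" "b \<le> c"
  shows "\<exists>c'. similar K (insert (c, c') Z)"
proof -
  have K: "similar K Z" using Z by (auto intro: similar_mono)
  have ag: "agree (2 * K) (y - x) (y' - x')" if "(x, x') \<in> Z" "(y, y') \<in> Z" for x x' y y'
    using Z(1) that unfolding similar_def by blast
  show ?thesis
  proof (cases "\<exists>(a, a')\<in>Z. \<bar>c - a\<bar> < K")
    case True
    then obtain a a' where a: "(a, a') \<in> Z" "\<bar>c - a\<bar> < K" by blast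
    have "similar K (insert (c, a' + (c - a)) Z)"
    proof (rule similar_insert[OF K])
      fix x x' assume "(x, x') \<in> Z"
      from ag[OF this a(1)] show "agree K (c - x) (a' + (c - a) - x')"
        using a(2) unfolding agree_def by linarith
    qed (use Z in simp)
    then show ?thesis ..
  next
    case False
    define L where "L = {x \<in> Z. fst x \<le> c}"
    have "finite (fst ` L)" "fst ` L \<noteq> {}" using Z bot unfolding L_def by force+
    then have "Max (fst ` L) \<in> fst ` L" and mx: "\<And>x. x \<in> L \<Longrightarrow> fst x \<le> Max (fst ` L)"
      using Max_in by auto
    then obtain a a' where a: "(a, a') \<in> L" "a = Max (fst ` L)" by auto
    then have aZ: "(a, a') \<in> Z" "a \<le> c" by (auto simp: L_def)
    have "similar K (insert (c, a' + K) Z)"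
    proof (rule similar_insert[OF K])
      fix x x' assume x: "(x, x') \<in> Z"
      have far: "K \<le> \<bar>c - x\<bar>" "K \<le> c - a" using False x aZ by force+
      show "agree K (c - x) (a' + K - x')"
      proof (cases "x \<le> c")
        case True
        then have "x \<le> a" using mx[of "(x, x')"] x a(2) by (simp add: L_def)
        then show ?thesis using ag[OF x aZ(1)] far True Z(3) unfolding agree_def by linarith
      next
        case False
        then show ?thesis using ag[OF x aZ(1)] far Z(3) unfolding agree_def by linarith
      qed
    qed (use Z in simp)
    then show ?thesis ..
  qed
qed

text \<open>The pair of -1 with itself and the pair of the two lengths mark the places just outside
  the paths. Since \<open>i\<close> lies strictly between the marks and \<open>1 \<le> K\<close>,
  the answer also lies strictly between them, hence is a valid index.\<close>

lemma similar_extend_path: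
  assumes Z: "similar (2 * K) Z" "finite Z" "1 \<le> K" "(-1, -1) \<in> Z" "(int n, int m) \<in> Z"
    and i: "i < n"
  shows "\<exists>j<m. similar K (insert (int i, int j) Z)"
proof -
  obtain c' where c': "similar K (insert (int i, c') Z)"
    using similar_extend[OF Z(1-4), of "int i"] by auto
  then have "agree K (int i - (-1)) (c' - (-1))" "agree K (int n - int i) (int m - c')"
    using Z(4,5) unfolding similar_def by blast+
  then have "0 \<le> c'" "c' < int m" using Z(3) i unfolding agree_def by linarith+
  then show ?thesis using c' by (intro exI[of _ "nat c'"]) auto
qed

primrec quantifier_rank :: "so_formula \<Rightarrow> nat" where
  "quantifier_rank (Equal x y) = 0"
| "quantifier_rank (Edge x y) = 0"
| "quantifier_rank (Rel i xs) = 0"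
| "quantifier_rank (Neg \<phi>) = quantifier_rank \<phi>"
| "quantifier_rank (Conj \<phi> \<psi>) = max (quantifier_rank \<phi>) (quantifier_rank \<psi>)"
| "quantifier_rank (Ex x \<phi>) = Suc (quantifier_rank \<phi>)"
| "quantifier_rank (ExRel i r \<phi>) = Suc (quantifier_rank \<phi>)"

text \<open>Each quantifier halves the threshold. At rank 0 it is 2, the least value that tells the
  differences 0, 1 and -1 from all others, so equality and adjacency of the chosen vertices
  agree.\<close>

lemma path_graphs_equivalent:
  assumes "distinct p" "distinct p'"
  shows "first_order \<phi> \<Longrightarrow> similar (2 ^ Suc (quantifier_rank \<phi>)) Z \<Longrightarrow> finite Z \<Longrightarrow>
    (-1, -1) \<in> Z \<Longrightarrow> (int (length p), int (length p')) \<in> Z \<Longrightarrow>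
    (\<And>x. x \<in> free_vars \<phi> \<Longrightarrow> (int (s x), int (s' x)) \<in> Z \<and> s x < length p \<and> s' x < length p' \<and>
       \<sigma> x = p ! s x \<and> \<sigma>' x = p' ! s' x) \<Longrightarrow>
    sat adm (path_graph p) \<sigma> \<rho> \<phi> \<longleftrightarrow> sat adm' (path_graph p') \<sigma>' \<rho>' \<phi>"
proof (induction \<phi> arbitrary: Z s s' \<sigma> \<sigma>')
  case (Equal x y)
  have "agree 2 (int (s y) - int (s x)) (int (s' y) - int (s' x))"
    using Equal.prems(2) Equal.prems(6)[of x] Equal.prems(6)[of y] unfolding similar_def by force
  then have "s x = s y \<longleftrightarrow> s' x = s' y" unfolding agree_def by linarith
  then show ?case
    using Equal.prems(6)[of x] Equal.prems(6)[of y] assms by (simp add: nth_eq_iff_index_eq)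
next
  case (Edge x y)
  have "agree 2 (int (s y) - int (s x)) (int (s' y) - int (s' x))"
    using Edge.prems(2) Edge.prems(6)[of x] Edge.prems(6)[of y] unfolding similar_def by force
  then have "(s y = Suc (s x) \<or> s x = Suc (s y)) \<longleftrightarrow> (s' y = Suc (s' x) \<or> s' x = Suc (s' y))"
    unfolding agree_def by linarith
  then show ?case
    using Edge.prems(6)[of x] Edge.prems(6)[of y] assms by (simp add: path_graph_edge_iff)
next
  case (Neg \<phi>)
  have "sat adm (path_graph p) \<sigma> \<rho> \<phi> \<longleftrightarrow> sat adm' (path_graph p') \<sigma>' \<rho>' \<phi>"
    by (rule Neg.IH[where Z = Z and s = s and s' = s']) (use Neg.prems in auto)
  then show ?case by simp
next
  case (Conj \<phi> \<psi>)
  have mono: "similar (2 ^ Suc n) Z" if "n \<le> max (quantifier_rank \<phi>) (quantifier_rank \<psi>)" for n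
    using Conj.prems(2) that by (auto intro!: similar_mono[OF Conj.prems(2)] power_increasing)
  have "sat adm (path_graph p) \<sigma> \<rho> \<phi> \<longleftrightarrow> sat adm' (path_graph p') \<sigma>' \<rho>' \<phi>"
    by (rule Conj.IH(1)[where Z = Z and s = s and s' = s']) (use Conj.prems mono in auto)
  moreover have "sat adm (path_graph p) \<sigma> \<rho> \<psi> \<longleftrightarrow> sat adm' (path_graph p') \<sigma>' \<rho>' \<psi>"
    by (rule Conj.IH(2)[where Z = Z and s = s and s' = s']) (use Conj.prems mono in auto)
  ultimately show ?case by simp
next
  case (Ex x \<phi>)
  let ?K = "2 ^ Suc (quantifier_rank \<phi>) :: int"
  have Z: "similar (2 * ?K) Z" using Ex.prems(2) by simp
  have K1: "1 \<le> ?K" by (rule one_le_power) simp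
  have IH: "sat adm (path_graph p) (\<sigma>(x := p ! i)) \<rho> \<phi> \<longleftrightarrow>
      sat adm' (path_graph p') (\<sigma>'(x := p' ! j)) \<rho>' \<phi>"
    if "similar ?K (insert (int i, int j) Z)" "i < length p" "j < length p'" for i j
    by (rule Ex.IH[where Z = "insert (int i, int j) Z" and s = "s(x := i)" and s' = "s'(x := j)"])
      (use Ex.prems that in auto)
  have verts: "pverts (path_graph q) = set q" for q :: "'x list" by (simp add: path_graph_def)
  show ?case
  proof
    assume "sat adm (path_graph p) \<sigma> \<rho> (Ex x \<phi>)"
    then obtain i where i: "i < length p" "sat adm (path_graph p) (\<sigma>(x := p ! i)) \<rho> \<phi>"
      by (auto simp: path_graph_def in_set_conv_nth)
    obtain j where "j < length p'" "similar ?K (insert (int i, int j) Z)"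
      using similar_extend_path[OF Z Ex.prems(3) K1 Ex.prems(4,5) i(1)] by blast
    with IH i show "sat adm' (path_graph p') \<sigma>' \<rho>' (Ex x \<phi>)"
      by (auto simp: verts intro!: bexI[of _ "p' ! j"])
  next
    assume "sat adm' (path_graph p') \<sigma>' \<rho>' (Ex x \<phi>)"
    then obtain j where j: "j < length p'" "sat adm' (path_graph p') (\<sigma>'(x := p' ! j)) \<rho>' \<phi>"
      by (auto simp: path_graph_def in_set_conv_nth)
    have "\<exists>i<length p. similar ?K (insert (int j, int i) (Z\<inverse>))"
      by (rule similar_extend_path[OF _ _ _ _ _ j(1)])
        (use Z K1 Ex.prems in \<open>auto simp: similar_converse\<close>)
    moreover have "insert (int j, int i) (Z\<inverse>) = (insert (int i, int j) Z)\<inverse>" for i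
      by auto
    ultimately obtain i where "i < length p" "similar ?K ((insert (int i, int j) Z)\<inverse>)"
      by auto
    with IH j show "sat adm (path_graph p) \<sigma> \<rho> (Ex x \<phi>)"
      unfolding similar_converse by (auto simp: verts intro!: bexI[of _ "p ! i"])
  qed
qed auto

text \<open>A path has an odd number of vertices iff its two-colouring can be chosen to contain
  all vertices of degree at most one.\<close>

definition odd_path :: so_formula where
  "odd_path = ExRel 0 1 (Conj
     (Neg (Ex 0 (Ex 1 (Conj (Edge 0 1)
       (Neg (Conj (Neg (Conj (Rel 0 [0]) (Rel 0 [1])))
                  (Neg (Conj (Neg (Rel 0 [0])) (Neg (Rel 0 [1]))))))))))
     (Neg (Ex 0 (Conj (Neg (Rel 0 [0]))
       (Neg (Ex 1 (Ex 2 (Conj (Neg (Equal 1 2)) (Conj (Edge 0 1) (Edge 0 2))))))))))"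

lemma odd_path_MSO: "odd_path \<in> sentences MSO"
  by (auto simp: odd_path_def MSO_def sentence_def)

lemma sat_odd_path:
  assumes p: "distinct p" "p \<noteq> []"
  shows "sat_sentence (\<lambda>_. True) (path_graph p) odd_path \<longleftrightarrow> odd (length p)"
proof -
  let ?n = "length p" and ?E = "parcs (path_graph p)"
  have verts: "pverts (path_graph p) = set p" by (simp add: path_graph_def)
  have "sat_sentence (\<lambda>_. True) (path_graph p) odd_path \<longleftrightarrow>
    (\<exists>R\<subseteq>tuples 1 (set p). (\<forall>u\<in>set p. \<forall>v\<in>set p. (u, v) \<in> ?E \<longrightarrow> ([u] \<in> R) \<noteq> ([v] \<in> R)) \<and>
      (\<forall>u\<in>set p. [u] \<notin> R \<longrightarrow> (\<exists>v\<in>set p. \<exists>w\<in>set p. v \<noteq> w \<and> (u, v) \<in> ?E \<and> (u, w) \<in> ?E)))"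
    unfolding sat_sentence_def odd_path_def by (simp add: verts) (intro ex_cong1 conj_cong ball_cong refl; blast)
  also have "\<dots> \<longleftrightarrow> odd ?n" (is "(\<exists>R\<subseteq>_. ?alt R \<and> ?deg R) \<longleftrightarrow> _")
  proof
    assume "\<exists>R\<subseteq>tuples 1 (set p). ?alt R \<and> ?deg R"
    then obtain R where R: "?alt R" "?deg R" by blast
    \<comment> \<open>An end of the path has at most one neighbour, so it must lie in the set.
      Alternation started at index 0 puts exactly the even indices into it, and the last index
      \<open>?n - 1\<close> is then even.\<close>
    have deg: "[p ! i] \<in> R" if "i < ?n" "i = 0 \<or> i = ?n - 1" for i
    proof (rule ccontr)
      assume "[p ! i] \<notin> R"
      with R(2) that(1) obtain v w where "v \<in> set p" "w \<in> set p" "v \<noteq> w"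
        "(p ! i, v) \<in> ?E" "(p ! i, w) \<in> ?E" by (meson nth_mem)
      then obtain j k where "j < ?n" "k < ?n" "j \<noteq> k" "(p ! i, p ! j) \<in> ?E" "(p ! i, p ! k) \<in> ?E"
        by (metis in_set_conv_nth)
      then show False using that by (auto simp: path_graph_edge_iff[OF p(1)])
    qed
    have "[p ! i] \<in> R \<longleftrightarrow> even i" if "i < ?n" for i
      using that
    proof (induction i)
      case 0 then show ?case using deg by simp
    next
      case (Suc i)
      then have "(p ! i, p ! Suc i) \<in> ?E" by (simp add: path_graph_edge_iff[OF p(1)])
      then have "([p ! i] \<in> R) \<noteq> ([p ! Suc i] \<in> R)" using R(1) Suc.prems by simp
      then show ?case using Suc by simp
    qed
    then show "odd ?n" using deg[of "?n - 1"] p(2) by (cases ?n) auto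
  next
    assume odd: "odd ?n"
    define R where "R = {[p ! i] | i. i < ?n \<and> even i}"
    have R: "[p ! i] \<in> R \<longleftrightarrow> even i" if "i < ?n" for i
      using that p(1) by (auto simp: R_def nth_eq_iff_index_eq)
    have "?alt R"
    proof (intro ballI impI)
      fix u v assume "u \<in> set p" "v \<in> set p" "(u, v) \<in> ?E"
      then obtain i j where "u = p ! i" "v = p ! j" "i < ?n" "j < ?n" "j = Suc i \<or> i = Suc j"
        by (auto simp: path_graph_def)
      then show "([u] \<in> R) \<noteq> ([v] \<in> R)" using R by auto
    qed
    moreover have "?deg R"
    proof (intro ballI impI)
      fix u assume "u \<in> set p" "[u] \<notin> R"
      then obtain i where i: "i < ?n" "u = p ! i" "odd i" using R by (auto simp: in_set_conv_nth)
      then obtain j where j: "i = Suc j" by (cases i) auto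
      have "Suc i < ?n" using odd i by (metis Suc_lessI even_Suc)
      then show "\<exists>v\<in>set p. \<exists>w\<in>set p. v \<noteq> w \<and> (u, v) \<in> ?E \<and> (u, w) \<in> ?E"
        using i j p(1)
        by (intro bexI[of _ "p ! j"] bexI[of _ "p ! Suc i"])
          (auto simp: path_graph_edge_iff nth_eq_iff_index_eq)
    qed
    moreover have "R \<subseteq> tuples 1 (set p)" by (auto simp: R_def tuples_def)
    ultimately show "\<exists>R\<subseteq>tuples 1 (set p). ?alt R \<and> ?deg R" by blast
  qed
  finally show ?thesis .
qed

lemma bounded_tree_depth_if_MSO_FO:
  fixes C :: "'a pair_pre_digraph set"
  assumes C: "graph_class C" "closed_under_subgraphs C" and MF: "at_most_as_expressive C MSO FO"
  shows "bounded_tree_depth C"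
proof (rule ccontr)
  assume unb: "\<not> bounded_tree_depth C"
  have paths: "\<exists>p. distinct p \<and> length p = Suc n \<and> path_graph p \<in> C" for n
  proof -
    obtain G where G: "G \<in> C" "\<not> td (with_proj G) \<le> enat n"
      using unb unfolding bounded_tree_depth_def by blast
    then have U: "undirected_graph G" using C(1) by (simp add: graph_class_def)
    obtain p where p: "is_path (parcs G) p" "set p \<subseteq> pverts G" "length p = Suc n"
      using long_path_if_td[OF U G(2)] .
    then have "p \<noteq> []" by auto
    then have "path_graph p \<in> C"
      using C(2) G(1) subgraph_path_graph[OF U p(1,2)] undirected_path_graph[OF path_distinct[OF p(1)]]
      unfolding closed_under_subgraphs_def by blast
    then show ?thesis using p path_distinct by blast
  qed
  obtain \<phi> where \<phi>: "\<phi> \<in> sentences (FO :: 'a logic)" "\<And>G. G \<in> C \<Longrightarrow> models MSO G odd_path \<longleftrightarrow> models FO G \<phi>"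
    using MF odd_path_MSO unfolding at_most_as_expressive_def by blast
  \<comment> \<open>Two consecutive lengths have different parity, and they are large enough for the
    difference of the end marks to be cut off at the threshold. So the two paths look alike at the
    start of the game.\<close>
  let ?n = "2 ^ Suc (quantifier_rank \<phi>) :: nat"
  obtain p p' where p: "distinct p" "length p = Suc ?n" "path_graph p \<in> C"
    and p': "distinct p'" "length p' = Suc (Suc ?n)" "path_graph p' \<in> C"
    using paths by meson
  have "sat adm (path_graph p) \<sigma> \<rho> \<phi> \<longleftrightarrow> sat adm (path_graph p') \<sigma> \<rho> \<phi>" for adm \<sigma> \<rho>
  proof (rule path_graphs_equivalent[OF p(1) p'(1), of _ "{(-1, -1), (int (length p), int (length p'))}"])
    show "similar (2 ^ Suc (quantifier_rank \<phi>)) {(-1, -1), (int (length p), int (length p'))}"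
      unfolding p(2) p'(2) similar_def agree_def by simp
  qed (use \<phi>(1) in \<open>auto simp: FO_def sentence_def\<close>)
  then have "models FO (path_graph p) \<phi> \<longleftrightarrow> models FO (path_graph p') \<phi>"
    by (simp add: FO_def sat_sentence_def)
  moreover have "models MSO (path_graph q) odd_path \<longleftrightarrow> odd (length q)" if "distinct q" "q \<noteq> []" for q
    using sat_odd_path[OF that] by (simp add: MSO_def)
  ultimately have "odd (length p) \<longleftrightarrow> odd (length p')"
    using \<phi>(2) p p' by (metis list.size(3) nat.distinct(1))
  then show False using p(2) p'(2) by simp
qed

section \<open>Definable predicates\<close>

text \<open>First-order formulas up to equivalence on \<open>K\<close>, with free variables numbered as de Bruijn
  levels: a quantifier binds the entry appended to the tuple.\<close>

inductive definable ::
  "'a pair_pre_digraph set \<Rightarrow> nat \<Rightarrow> ('a pair_pre_digraph \<Rightarrow> 'a list \<Rightarrow> bool) \<Rightarrow> bool"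
  for K :: "'a pair_pre_digraph set" where
  definable_True: "definable K n (\<lambda>G as. True)"
| definable_eq: "i < n \<Longrightarrow> j < n \<Longrightarrow> definable K n (\<lambda>G as. as ! i = as ! j)"
| definable_edge: "i < n \<Longrightarrow> j < n \<Longrightarrow> definable K n (\<lambda>G as. (as ! i, as ! j) \<in> parcs G)"
| definable_Not: "definable K n P \<Longrightarrow> definable K n (\<lambda>G as. \<not> P G as)"
| definable_conj: "definable K n P \<Longrightarrow> definable K n Q \<Longrightarrow> definable K n (\<lambda>G as. P G as \<and> Q G as)"
| definable_Ex: "definable K (Suc n) P \<Longrightarrow> definable K n (\<lambda>G as. \<exists>v\<in>pverts G. P G (as @ [v]))"
| definable_cong: "definable K n P \<Longrightarrow>
    (\<And>G as. G \<in> K \<Longrightarrow> as \<in> tuples n (pverts G) \<Longrightarrow> P G as \<longleftrightarrow> Q G as) \<Longrightarrow> definable K n Q"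

lemma definable_imp_formula:
  assumes "definable K n P"
  shows "\<exists>\<phi>. first_order \<phi> \<and> free_vars \<phi> \<subseteq> {..<n} \<and>
    (\<forall>G\<in>K. \<forall>as\<in>tuples n (pverts G). \<forall>adm \<sigma> \<rho>. (\<forall>i<n. \<sigma> i = as ! i) \<longrightarrow>
       (P G as \<longleftrightarrow> sat adm G \<sigma> \<rho> \<phi>))"
  using assms
proof induction
  case (definable_True n)
  \<comment> \<open>No variable is free in this formula, so it also serves for
    \<open>n = 0\<close>.\<close>
  show ?case by (rule exI[of _ "Neg (Ex 0 (Neg (Equal 0 0)))"]) auto
next
  case (definable_eq i n j)
  then show ?case by (intro exI[of _ "Equal i j"]) auto
next
  case (definable_edge i n j)
  then show ?case by (intro exI[of _ "Edge i j"]) auto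
next
  case (definable_Not n P)
  then obtain \<phi> where "first_order \<phi>" "free_vars \<phi> \<subseteq> {..<n}"
    "\<forall>G\<in>K. \<forall>as\<in>tuples n (pverts G). \<forall>adm \<sigma> \<rho>. (\<forall>i<n. \<sigma> i = as ! i) \<longrightarrow>
       (P G as \<longleftrightarrow> sat adm G \<sigma> \<rho> \<phi>)" by blast
  then show ?case by (intro exI[of _ "Neg \<phi>"]) auto
next
  case (definable_conj n P Q)
  then obtain \<phi> \<psi> where "first_order \<phi>" "free_vars \<phi> \<subseteq> {..<n}" "first_order \<psi>" "free_vars \<psi> \<subseteq> {..<n}"
    "\<forall>G\<in>K. \<forall>as\<in>tuples n (pverts G). \<forall>adm \<sigma> \<rho>. (\<forall>i<n. \<sigma> i = as ! i) \<longrightarrow>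
       (P G as \<longleftrightarrow> sat adm G \<sigma> \<rho> \<phi>)"
    "\<forall>G\<in>K. \<forall>as\<in>tuples n (pverts G). \<forall>adm \<sigma> \<rho>. (\<forall>i<n. \<sigma> i = as ! i) \<longrightarrow>
       (Q G as \<longleftrightarrow> sat adm G \<sigma> \<rho> \<psi>)" by blast
  then show ?case by (intro exI[of _ "Conj \<phi> \<psi>"]) auto
next
  case (definable_Ex n P)
  then obtain \<phi> where \<phi>: "first_order \<phi>" "free_vars \<phi> \<subseteq> {..<Suc n}"
    "\<And>G as adm \<sigma> \<rho>. G \<in> K \<Longrightarrow> as \<in> tuples (Suc n) (pverts G) \<Longrightarrow> (\<forall>i<Suc n. \<sigma> i = as ! i) \<Longrightarrow>
       P G as \<longleftrightarrow> sat adm G \<sigma> \<rho> \<phi>" by blast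
  have "P G (as @ [v]) \<longleftrightarrow> sat adm G (\<sigma>(n := v)) \<rho> \<phi>"
    if "G \<in> K" "as \<in> tuples n (pverts G)" "\<forall>i<n. \<sigma> i = as ! i" "v \<in> pverts G" for G as v adm \<sigma> \<rho>
    by (rule \<phi>(3)) (use that in \<open>auto simp: tuples_def nth_append less_Suc_eq\<close>)
  then show ?case using \<phi>(1,2) by (intro exI[of _ "Ex n \<phi>"]) (auto simp: less_Suc_eq)
next
  case (definable_cong n P Q)
  then show ?case by metis
qed

text \<open>Substitution moves a bound entry from level \<open>n\<close> to level \<open>m\<close>;
  therefore \<open>m\<close> is appended to the list \<open>is\<close> when the induction passes
  below a quantifier.\<close>

lemma definable_subst:
  assumes "definable K n P" "length is = n" "set is \<subseteq> {..<m}"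
  shows "definable K m (\<lambda>G as. P G (map (nth as) is))"
  using assms
proof (induction arbitrary: "is" m)
  case (definable_True n)
  show ?case by (rule definable.definable_True)
next
  case (definable_eq i n j)
  then have "is ! i < m" "is ! j < m" by (auto simp: subset_iff)
  from definable.definable_eq[OF this, of K] definable_eq show ?case by simp
next
  case (definable_edge i n j)
  then have "is ! i < m" "is ! j < m" by (auto simp: subset_iff)
  from definable.definable_edge[OF this, of K] definable_edge show ?case by simp
next
  case (definable_Not n P)
  then show ?case by (intro definable.definable_Not) auto
next
  case (definable_conj n P Q)
  then show ?case by (intro definable.definable_conj) auto
next
  case (definable_Ex n P)
  have "definable K (Suc m) (\<lambda>G as. P G (map (nth as) (is @ [m])))"
    by (rule definable_Ex.IH) (use definable_Ex.prems in auto)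
  from definable.definable_Ex[OF this]
  show ?case
  proof (rule definable.definable_cong)
    fix G :: "'a pair_pre_digraph" and as assume as: "as \<in> tuples m (pverts G)"
    have "map (nth (as @ [v])) (is @ [m]) = map (nth as) is @ [v]" for v
      using as definable_Ex.prems by (auto simp: tuples_def nth_append)
    then show "(\<exists>v\<in>pverts G. P G (map (nth (as @ [v])) (is @ [m]))) \<longleftrightarrow>
      (\<exists>v\<in>pverts G. P G (map (nth as) is @ [v]))"
      by (simp only:)
  qed
next
  case (definable_cong n P Q)
  have "definable K m (\<lambda>G as. P G (map (nth as) is))"
    using definable_cong by blast
  then show ?case
  proof (rule definable.definable_cong)
    fix G as assume "G \<in> K" "as \<in> tuples m (pverts G)"
    then show "P G (map (nth as) is) \<longleftrightarrow> Q G (map (nth as) is)"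
      using definable_cong.prems by (intro definable_cong.hyps(2)) (auto simp: tuples_def subset_iff)
  qed
qed

lemma definable_False: "definable K n (\<lambda>G as. False)"
  using definable_Not[OF definable_True] by simp

lemma definable_disj:
  assumes "definable K n P" "definable K n Q"
  shows "definable K n (\<lambda>G as. P G as \<or> Q G as)"
  using definable_Not[OF definable_conj[OF definable_Not[OF assms(1)] definable_Not[OF assms(2)]]]
  by simp

lemma definable_imp:
  assumes "definable K n P" "definable K n Q"
  shows "definable K n (\<lambda>G as. P G as \<longrightarrow> Q G as)"
  using definable_Not[OF definable_conj[OF assms(1) definable_Not[OF assms(2)]]] by simp

lemma definable_All:
  assumes "definable K (Suc n) P"
  shows "definable K n (\<lambda>G as. \<forall>v\<in>pverts G. P G (as @ [v]))"
  using definable_Not[OF definable_Ex[OF definable_Not[OF assms]]] by simp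

lemma definable_Ball:
  assumes "finite I" "\<And>i. i \<in> I \<Longrightarrow> definable K n (P i)"
  shows "definable K n (\<lambda>G as. \<forall>i\<in>I. P i G as)"
  using assms
  by (induction I) (simp_all add: definable_True definable_conj)

lemma definable_Bex:
  assumes "finite I" "\<And>i. i \<in> I \<Longrightarrow> definable K n (P i)"
  shows "definable K n (\<lambda>G as. \<exists>i\<in>I. P i G as)"
  using assms
  by (induction I) (simp_all add: definable_False definable_disj)

text \<open>If \<open>P\<close> depends only on the truth values of finitely many definable
  predicates, it is the disjunction of the patterns \<open>S\<close> of truth values that occur at
  some tuple satisfying \<open>P\<close>. The index set \<open>J\<close> is chosen semantically, so
  no formula has to be computed.\<close>

lemma definable_determined:
  assumes I: "finite I" and B: "\<And>i. i \<in> I \<Longrightarrow> definable K n (B i)"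
    and det: "\<And>G as G' as'. G \<in> K \<Longrightarrow> as \<in> tuples n (pverts G) \<Longrightarrow>
      G' \<in> K \<Longrightarrow> as' \<in> tuples n (pverts G') \<Longrightarrow> (\<And>i. i \<in> I \<Longrightarrow> B i G as \<longleftrightarrow> B i G' as') \<Longrightarrow>
      P G as \<Longrightarrow> P G' as'"
  shows "definable K n P"
proof -
  define J where "J = {S \<in> Pow I. \<exists>G\<in>K. \<exists>as\<in>tuples n (pverts G). P G as \<and> S = {i \<in> I. B i G as}}"
  have "finite J" unfolding J_def using I by simp
  moreover have "definable K n (\<lambda>G as. (\<forall>i\<in>S. B i G as) \<and> (\<forall>i\<in>I - S. \<not> B i G as))" if "S \<in> J" for S
    using that I B unfolding J_def
    by (intro definable_conj definable_Ball definable_Not) (auto intro: finite_subset)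
  ultimately have "definable K n (\<lambda>G as. \<exists>S\<in>J. (\<forall>i\<in>S. B i G as) \<and> (\<forall>i\<in>I - S. \<not> B i G as))"
    by (rule definable_Bex)
  then show ?thesis
  proof (rule definable_cong)
    fix G as assume G: "G \<in> K" "as \<in> tuples n (pverts G)"
    show "(\<exists>S\<in>J. (\<forall>i\<in>S. B i G as) \<and> (\<forall>i\<in>I - S. \<not> B i G as)) \<longleftrightarrow> P G as"
    proof
      assume "\<exists>S\<in>J. (\<forall>i\<in>S. B i G as) \<and> (\<forall>i\<in>I - S. \<not> B i G as)"
      then obtain S G' as' where S: "\<forall>i\<in>S. B i G as" "\<forall>i\<in>I - S. \<not> B i G as"
        "G' \<in> K" "as' \<in> tuples n (pverts G')" "P G' as'" "S = {i \<in> I. B i G' as'}"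
        unfolding J_def by blast
      show "P G as" by (rule det[OF S(3,4) G _ S(5)]) (use S in blast)
    next
      assume "P G as"
      then have "{i \<in> I. B i G as} \<in> J" unfolding J_def
        by (intro CollectI conjI bexI[OF _ G(1)] bexI[OF _ G(2)]) auto
      then show "\<exists>S\<in>J. (\<forall>i\<in>S. B i G as) \<and> (\<forall>i\<in>I - S. \<not> B i G as)"
        by (rule bexI[rotated]) simp
    qed
  qed
qed

lemma definable_Ex_tuple:
  "definable K (m + n) P \<Longrightarrow> definable K m (\<lambda>G as. \<exists>us\<in>tuples n (pverts G). P G (as @ us))"
proof (induction n arbitrary: P)
  case 0
  then show ?case by (rule definable_cong[OF definable_subst[of _ _ _ "[0..<m]"]])
    (auto simp: tuples_def map_nth)
next
  case (Suc n)
  have "definable K (m + n) (\<lambda>G as. \<exists>v\<in>pverts G. P G (as @ [v]))"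
    using Suc.prems by (intro definable_Ex) simp
  from Suc.IH[OF this]
  show ?case
  proof (rule definable_cong)
    fix G :: "'a pair_pre_digraph" and as
    show "(\<exists>us\<in>tuples n (pverts G). \<exists>v\<in>pverts G. P G ((as @ us) @ [v])) \<longleftrightarrow>
      (\<exists>us\<in>tuples (Suc n) (pverts G). P G (as @ us))"
    proof
      assume "\<exists>us\<in>tuples n (pverts G). \<exists>v\<in>pverts G. P G ((as @ us) @ [v])"
      then obtain us v where "us \<in> tuples n (pverts G)" "v \<in> pverts G" "P G (as @ (us @ [v]))" by auto
      then show "\<exists>us\<in>tuples (Suc n) (pverts G). P G (as @ us)"
        by (intro bexI[of _ "us @ [v]"]) (auto simp: tuples_def)
    next
      assume "\<exists>us\<in>tuples (Suc n) (pverts G). P G (as @ us)"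
      then obtain us where us: "length us = Suc n" "set us \<subseteq> pverts G" "P G (as @ us)"
        by (auto simp: tuples_def)
      then obtain vs v where "us = vs @ [v]" by (metis append_butlast_last_id list.size(3) nat.distinct(1))
      with us show "\<exists>us\<in>tuples n (pverts G). \<exists>v\<in>pverts G. P G ((as @ us) @ [v])"
        by (intro bexI[of _ vs] bexI[of _ v]) (auto simp: tuples_def)
    qed
  qed
qed

section \<open>Counting up to a threshold\<close>

text \<open>The guard lets an infinite set exceed every bound, although its \<open>card\<close> is
  0.\<close>

definition at_least :: "nat \<Rightarrow> 'a set \<Rightarrow> bool" where
  "at_least n S \<longleftrightarrow> (finite S \<longrightarrow> n \<le> card S)"

definition eqcount :: "nat \<Rightarrow> 'a set \<Rightarrow> 'b set \<Rightarrow> bool" where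
  "eqcount t S S' \<longleftrightarrow> (\<forall>n\<le>t. at_least n S \<longleftrightarrow> at_least n S')"

lemma at_least_iff_subset: "at_least n S \<longleftrightarrow> (\<exists>X\<subseteq>S. finite X \<and> card X = n)"
proof
  assume "at_least n S"
  then show "\<exists>X\<subseteq>S. finite X \<and> card X = n"
    unfolding at_least_def
    by (metis infinite_arbitrarily_large obtain_subset_with_card_n)
next
  assume "\<exists>X\<subseteq>S. finite X \<and> card X = n"
  then show "at_least n S" unfolding at_least_def using card_mono by metis
qed

text \<open>Elements of the image are counted through representatives in \<open>X\<close>. With
  \<open>component\<close> in the place of \<open>f\<close>, components are counted by quantifying
  over vertices.\<close>

lemma at_least_image_iff:
  "at_least n (f ` X) \<longleftrightarrow> (\<exists>us. length us = n \<and> set us \<subseteq> X \<and> distinct (map f us))"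
proof
  assume "at_least n (f ` X)"
  then obtain Y where Y: "Y \<subseteq> f ` X" "finite Y" "card Y = n" by (auto simp: at_least_iff_subset)
  obtain ys where ys: "set ys = Y" "distinct ys" using finite_distinct_list[OF Y(2)] by blast
  define us where "us = map (inv_into X f) ys"
  have "map f us = ys"
    unfolding us_def using Y(1) ys(1) by (auto intro!: map_idI simp: f_inv_into_f subset_iff)
  moreover have "set us \<subseteq> X"
    unfolding us_def using Y(1) ys(1) by (auto intro!: inv_into_into)
  moreover have "length us = n" using ys Y(3) distinct_card[of ys] by (simp add: us_def)
  ultimately show "\<exists>us. length us = n \<and> set us \<subseteq> X \<and> distinct (map f us)"
    using ys by blast
next
  assume "\<exists>us. length us = n \<and> set us \<subseteq> X \<and> distinct (map f us)"
  then obtain us where us: "length us = n" "set us \<subseteq> X" "distinct (map f us)" by blast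
  then show "at_least n (f ` X)" unfolding at_least_iff_subset
    using distinct_card[OF us(3)] by (intro exI[of _ "f ` set us"]) auto
qed

lemma eqcount_bij: "bij_betw g S S' \<Longrightarrow> eqcount t S S'"
  unfolding eqcount_def at_least_def using bij_betw_finite bij_betw_same_card by metis

lemma eqcount_sym: "eqcount t S S' \<Longrightarrow> eqcount t S' S"
  unfolding eqcount_def by simp

text \<open>If a class is larger than the threshold, some value of \<open>r\<close> occurs at least \<open>t\<close> times in it,
  and this value absorbs the surplus elements of \<open>A'\<close>.\<close>

lemma eqcount_refine:
  fixes A :: "'i set" and A' :: "'j set" and r :: "'i \<Rightarrow> nat"
  assumes eq: "eqcount (t * M) A A'" and r: "\<And>i. i \<in> A \<Longrightarrow> r i < M" and t: "1 \<le> t" "1 \<le> M"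
  shows "\<exists>f. (\<forall>j\<in>A'. f j \<in> A) \<and> (\<forall>w. eqcount t {i \<in> A. r i = w} {j \<in> A'. r (f j) = w})"
proof (cases "at_least (t * M) A")
  case False
  then have fin: "finite A" "card A < t * M" by (auto simp: at_least_def)
  have "at_least (card A) A" "\<not> at_least (Suc (card A)) A" using fin by (auto simp: at_least_def)
  then have "at_least (card A) A'" "\<not> at_least (Suc (card A)) A'"
    using eq fin(2) unfolding eqcount_def by (meson less_imp_le_nat, meson Suc_leI)
  then have "finite A'" "card A' = card A" by (auto simp: at_least_def)
  then obtain f where f: "bij_betw f A' A" using fin(1) finite_same_card_bij by blast
  have "bij_betw f {j \<in> A'. r (f j) = w} {i \<in> A. r i = w}" for w
    using f unfolding bij_betw_def inj_on_def by auto
  from eqcount_sym[OF eqcount_bij[OF this]] show ?thesis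
    using bij_betwE[OF f] by (intro exI[of _ f]) blast
next
  case True
  define cl where "cl w = {i \<in> A. r i = w}" for w
  \<comment> \<open>Each class is cut down to at most \<open>t\<close> elements. The union
    \<open>U\<close> of these parts has at most \<open>t * M\<close> elements, so it can be matched
    with a subset of \<open>A'\<close>.\<close>
  have "\<exists>N. N \<subseteq> cl w \<and> finite N \<and> card N \<le> t \<and> (N = cl w \<or> card N = t)" for w
  proof (cases "at_least t (cl w)")
    case True
    then show ?thesis unfolding at_least_iff_subset by auto
  next
    case False
    then show ?thesis unfolding at_least_def by (intro exI[of _ "cl w"]) auto
  qed
  then obtain N where N: "\<And>w. N w \<subseteq> cl w" "\<And>w. finite (N w)" "\<And>w. card (N w) \<le> t"
    "\<And>w. N w = cl w \<or> card (N w) = t" by metis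
  define U where "U = (\<Union>w<M. N w)"
  have UA: "U \<subseteq> A" using N(1) by (auto simp: U_def cl_def)
  have cardU: "card U = (\<Sum>w<M. card (N w))" unfolding U_def
  proof (rule card_UN_disjoint)
    show "\<forall>v\<in>{..<M}. \<forall>w\<in>{..<M}. v \<noteq> w \<longrightarrow> N v \<inter> N w = {}"
    proof (intro ballI impI)
      fix v w assume "v \<in> {..<M}" "w \<in> {..<M}" "v \<noteq> w"
      then show "N v \<inter> N w = {}" using N(1)[of v] N(1)[of w] by (auto simp: cl_def)
    qed
  qed (use N(2) in auto)
  have "\<exists>w0<M. card (N w0) = t"
  proof (rule ccontr)
    assume no: "\<not> ?thesis"
    then have "N w = cl w" "card (N w) < t" if "w < M" for w using N(3,4)[of w] that by force+
    then have "A = U" using r UA by (auto simp: U_def cl_def)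
    moreover have "card U < (\<Sum>w<M. t)" unfolding cardU
      using \<open>\<And>w. w < M \<Longrightarrow> card (N w) < t\<close> t by (intro sum_strict_mono) (auto simp: lessThan_empty_iff)
    moreover have "finite U" unfolding U_def using N(2) by auto
    ultimately show False using True by (simp add: at_least_def mult.commute)
  qed
  then obtain w0 where w0: "w0 < M" "card (N w0) = t" by blast
  then obtain i0 where i0: "i0 \<in> N w0" using t by (metis card.empty equals0I not_one_le_zero)
  have "card U \<le> (\<Sum>w<M. t)" unfolding cardU by (rule sum_mono) (rule N(3))
  then have "card U \<le> t * M" by (simp add: mult.commute)
  moreover have "at_least (t * M) A'" using True eq unfolding eqcount_def by blast
  ultimately have "at_least (card U) A'" unfolding at_least_def by (meson order_trans)
  then obtain U' where U': "U' \<subseteq> A'" "finite U'" "card U' = card U" unfolding at_least_iff_subset by blast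
  have "finite U" unfolding U_def using N(2) by auto
  then obtain h where h: "bij_betw h U' U" using finite_same_card_bij U' by blast
  define f where "f j = (if j \<in> U' then h j else i0)" for j
  have bij: "bij_betw f {j \<in> U'. r (h j) = w} (N w)" if "w < M" for w
  proof -
    have "N w = {i \<in> U. r i = w}" using N(1) that by (auto simp: U_def cl_def subset_iff)
    then show ?thesis using h unfolding bij_betw_def inj_on_def f_def by auto
  qed
  have ri0: "r i0 = w0" "i0 \<in> A" using i0 N(1) by (auto simp: cl_def subset_iff)
  have "eqcount t (cl w) {j \<in> A'. r (f j) = w}" for w
  proof (cases "w < M")
    case False
    have "h j \<in> A" if "j \<in> U'" for j using that h UA bij_betwE by blast
    then have "{j \<in> A'. r (f j) = w} = {}" using False r ri0 w0 by (force simp: f_def)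
    moreover have "cl w = {}" using False r by (auto simp: cl_def)
    ultimately show ?thesis by (simp only: eqcount_def at_least_def card.empty finite.emptyI simp_thms)
  next
    case True
    show ?thesis
    proof (cases "card (N w) = t")
      case True
      have "at_least t {j \<in> A'. r (f j) = w}" unfolding at_least_iff_subset
        using bij_betw_same_card[OF bij[OF \<open>w < M\<close>]] True U'
        by (intro exI[of _ "{j \<in> U'. r (h j) = w}"]) (auto simp: f_def)
      moreover have "at_least t (cl w)" unfolding at_least_iff_subset using True N(1,2) by blast
      ultimately show ?thesis unfolding eqcount_def at_least_def by (meson order_trans)
    next
      case False
      then have "N w = cl w" "w \<noteq> w0" using N(4) w0 by auto
      then have "{j \<in> A'. r (f j) = w} = {j \<in> U'. r (h j) = w}"
        using U'(1) ri0 by (auto simp: f_def)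
      then show ?thesis using eqcount_sym[OF eqcount_bij[OF bij[OF True]]] \<open>N w = cl w\<close> by simp
    qed
  qed
  moreover have "f j \<in> A" for j
    using h UA ri0 by (auto simp: f_def dest: bij_betwE)
  ultimately show ?thesis unfolding cl_def by blast
qed

text \<open>A set of \<open>n \<le> t\<close> elements of \<open>S\<close> meets every class in at
  most \<open>t\<close> elements, so each part can be copied into \<open>S'\<close> separately, and
  parts with different values stay disjoint.\<close>

lemma at_least_union_classes:
  assumes le: "\<And>v. eqcount t {i \<in> S. c i = v} {j \<in> S'. c' j = v}"
    and n: "n \<le> t" "at_least n S"
  shows "at_least n S'"
proof -
  obtain X where X: "X \<subseteq> S" "finite X" "card X = n" using n(2) by (auto simp: at_least_iff_subset)
  have "\<exists>Y\<subseteq>{j \<in> S'. c' j = v}. finite Y \<and> card Y = card {i \<in> X. c i = v}" for v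
  proof -
    have "card {i \<in> X. c i = v} \<le> t" using card_mono[OF X(2), of "{i \<in> X. c i = v}"] X(3) n(1) by auto
    moreover have "at_least (card {i \<in> X. c i = v}) {i \<in> S. c i = v}"
      unfolding at_least_iff_subset using X by (intro exI[of _ "{i \<in> X. c i = v}"]) auto
    ultimately show ?thesis using le[of v] unfolding eqcount_def at_least_iff_subset by blast
  qed
  then obtain Y where Y: "\<And>v. Y v \<subseteq> {j \<in> S'. c' j = v}" "\<And>v. finite (Y v)"
    "\<And>v. card (Y v) = card {i \<in> X. c i = v}" by metis
  have Yc: "c' j = v" if "j \<in> Y v" for j v using subsetD[OF Y(1) that] by simp
  have "card (\<Union>v\<in>c ` X. Y v) = (\<Sum>v\<in>c ` X. card (Y v))"
  proof (rule card_UN_disjoint)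
    show "\<forall>v\<in>c ` X. \<forall>w\<in>c ` X. v \<noteq> w \<longrightarrow> Y v \<inter> Y w = {}"
    proof (intro ballI impI)
      fix v w assume "v \<in> c ` X" "w \<in> c ` X" "v \<noteq> w"
      then show "Y v \<inter> Y w = {}" by (metis Yc disjoint_iff)
    qed
  qed (use X Y(2) in auto)
  also have "\<dots> = (\<Sum>v\<in>c ` X. card {i \<in> X. c i = v})" using Y(3) by simp
  also have "\<dots> = card (\<Union>v\<in>c ` X. {i \<in> X. c i = v})"
    by (rule card_UN_disjoint[symmetric]) (use X in auto)
  also have "(\<Union>v\<in>c ` X. {i \<in> X. c i = v}) = X" by auto
  finally show ?thesis unfolding at_least_iff_subset using X Y(1,2)
    by (intro exI[of _ "\<Union>v\<in>c ` X. Y v"]) auto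
qed

text \<open>Used with \<open>c\<close> a type of rank \<open>q + 1\<close> and \<open>r\<close> a
  type of rank \<open>q\<close>, possibly after a move. The map \<open>f\<close> selects for each
  piece of the second structure the piece of the first that it imitates. It is glued from the maps
  that \<open>eqcount_refine\<close> gives on the fibres of \<open>c\<close>.\<close>

lemma eqcount_matching:
  fixes r :: "'i \<Rightarrow> nat" and c :: "'i \<Rightarrow> 'v" and c' :: "'j \<Rightarrow> 'v"
  assumes eq: "\<And>v. eqcount (t * M) {i \<in> J. c i = v} {j \<in> J'. c' j = v}"
    and r: "\<And>i. i \<in> J \<Longrightarrow> r i < M" and t: "1 \<le> t" "1 \<le> M"
  obtains f where "\<And>j. j \<in> J' \<Longrightarrow> f j \<in> J \<and> c (f j) = c' j"
    "\<And>w. eqcount t {i \<in> J. r i = w} {j \<in> J'. r (f j) = w}"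
proof -
  define good where "good v f \<longleftrightarrow> (\<forall>j\<in>{j \<in> J'. c' j = v}. f j \<in> {i \<in> J. c i = v}) \<and>
    (\<forall>w. eqcount t {i \<in> {i \<in> J. c i = v}. r i = w} {j \<in> {j \<in> J'. c' j = v}. r (f j) = w})" for v f
  have "\<exists>f. good v f" for v
    unfolding good_def by (rule eqcount_refine[OF eq _ t]) (use r in simp)
  then obtain F where "\<And>v. good v (F v)" by metis
  then have F: "\<And>v j. j \<in> J' \<Longrightarrow> c' j = v \<Longrightarrow> F v j \<in> J \<and> c (F v j) = v"
    "\<And>v w. eqcount t {i \<in> {i \<in> J. c i = v}. r i = w} {j \<in> {j \<in> J'. c' j = v}. r (F v j) = w}"
    unfolding good_def by blast+
  define f where "f j = F (c' j) j" for j
  have cl: "eqcount t {i \<in> {i \<in> J. r i = w}. c i = v} {j \<in> {j \<in> J'. r (f j) = w}. c' j = v}" for v w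
  proof -
    have "{i \<in> {i \<in> J. r i = w}. c i = v} = {i \<in> {i \<in> J. c i = v}. r i = w}"
      "{j \<in> {j \<in> J'. r (f j) = w}. c' j = v} = {j \<in> {j \<in> J'. c' j = v}. r (F v j) = w}"
      by (auto simp: f_def)
    then show ?thesis using F(2)[of v w] by simp
  qed
  have "eqcount t {i \<in> J. r i = w} {j \<in> J'. r (f j) = w}" for w
    unfolding eqcount_def
    using at_least_union_classes[OF cl] at_least_union_classes[OF eqcount_sym[OF cl]] by blast
  then show thesis using F(1) by (intro that[of f]) (auto simp: f_def)
qed

section \<open>Types of guarded second-order logic\<close>

text \<open>First-order variables are represented by the relation variables \<open>Elem x\<close>, whose intended
  values are singletons. \<open>Param i\<close> names the \<open>i\<close>-th deleted vertex, and \<open>Spare\<close> is used to express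
  in one more move that a set is a singleton.\<close>

datatype rvar = Param nat | Elem nat | Spare | Relv nat nat

instance rvar :: countable by countable_datatype

primrec arity :: "rvar \<Rightarrow> nat" where
  "arity (Param i) = 1"
| "arity (Elem x) = 1"
| "arity Spare = 1"
| "arity (Relv i r) = r"

datatype atom = Meet rvar rvar | Minus rvar rvar | Adj rvar rvar | Tup rvar "rvar list"

instance atom :: countable by countable_datatype

text \<open>Every atom asserts the existence of a tuple. The tuple is a clique, so it lies in one
  piece of an amalgam, and an atom holds in the amalgam iff it holds in some piece.\<close>

primrec witness :: "('a \<times> 'a) set \<Rightarrow> (rvar \<Rightarrow> 'a list set) \<Rightarrow> atom \<Rightarrow> 'a list \<Rightarrow> bool" where
  "witness E \<rho> (Meet X Y) t \<longleftrightarrow> t \<in> \<rho> X \<and> t \<in> \<rho> Y"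
| "witness E \<rho> (Minus X Y) t \<longleftrightarrow> t \<in> \<rho> X \<and> t \<notin> \<rho> Y"
| "witness E \<rho> (Adj X Y) t \<longleftrightarrow> (\<exists>u v. t = [u, v] \<and> (u, v) \<in> E \<and> [u] \<in> \<rho> X \<and> [v] \<in> \<rho> Y)"
| "witness E \<rho> (Tup Z Xs) t \<longleftrightarrow> t \<in> \<rho> Z \<and> list_all2 (\<lambda>u X. [u] \<in> \<rho> X) t Xs"

definition holds :: "('a \<times> 'a) set \<Rightarrow> 'a set \<Rightarrow> (rvar \<Rightarrow> 'a list set) \<Rightarrow> atom \<Rightarrow> bool" where
  "holds E W \<rho> a \<longleftrightarrow> (\<exists>t. set t \<subseteq> W \<and> witness E \<rho> a t)"

text \<open>A value for \<open>X\<close> is guarded and lives on \<open>W\<close> iff it is a subset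
  of this set, so a move of the game is the choice of a subset.\<close>

definition locals :: "('a \<times> 'a) set \<Rightarrow> rvar \<Rightarrow> 'a set \<Rightarrow> 'a list set" where
  "locals E X W = {t. length t = arity X \<and> set t \<subseteq> W \<and> clique_tuple E t}"

definition valid :: "('a \<times> 'a) set \<Rightarrow> (rvar \<Rightarrow> 'a list set) \<Rightarrow> bool" where
  "valid E \<rho> \<longleftrightarrow> (\<forall>X. \<rho> X \<subseteq> locals E X UNIV)"

definition params :: "(rvar \<Rightarrow> 'a list set) \<Rightarrow> 'a list \<Rightarrow> bool" where
  "params \<rho> as \<longleftrightarrow> (\<forall>i. \<rho> (Param i) = (if i < length as then {[as ! i]} else {}))"

lemma valid_upd: "valid E \<rho> \<Longrightarrow> R \<subseteq> locals E X W \<Longrightarrow> valid E (\<rho>(X := R))"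
  unfolding valid_def locals_def by auto

lemma params_upd: "params \<rho> as \<Longrightarrow> (\<And>i. X \<noteq> Param i) \<Longrightarrow> params (\<rho>(X := R)) as"
  unfolding params_def by (metis fun_upd_other)

lemma witness_clique:
  assumes "sym E" "valid E \<rho>" "witness E \<rho> a t"
  shows "clique_tuple E t"
proof -
  have "t \<in> \<rho> X \<Longrightarrow> clique_tuple E t" for X using assms(2) by (auto simp: valid_def locals_def)
  then show ?thesis using assms(1,3) by (cases a) (auto simp: clique_tuple_def dest: symD)
qed

lemma list_all2_params:
  assumes "params \<rho> as" "set ns \<subseteq> {..<length as}"
  shows "list_all2 (\<lambda>u X. [u] \<in> \<rho> X) t (map Param ns) \<longleftrightarrow> t = map (nth as) ns"
  using assms(2)
proof (induction ns arbitrary: t)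
  case (Cons i ns)
  then show ?case using assms(1) by (cases t) (auto simp: params_def)
qed simp

section \<open>Types of bounded rank over a finite vocabulary\<close>

locale type_vocabulary =
  fixes d :: nat and Mv :: "rvar set"
  assumes finite_Mv: "finite Mv" and Spare: "Spare \<in> Mv" and no_Param: "Param i \<notin> Mv"
begin

text \<open>The variables in \<open>Mv\<close> may be reassigned by moves; the \<open>d\<close>
  parameters stay fixed throughout a game.\<close>

definition Voc :: "rvar set" where
  "Voc = Param ` {..<d} \<union> Mv"

text \<open>Parameters occur only in places where giving them the empty value makes the atom false:
  in \<open>Meet\<close>, in \<open>Adj\<close> and among the arguments of \<open>Tup\<close>. This
  makes it easy to forget a parameter.\<close>

definition Atoms :: "atom set" where
  "Atoms = (\<lambda>(X, Y). Meet X Y) ` (Voc \<times> Voc) \<union> (\<lambda>(X, Y). Minus X Y) ` (Mv \<times> Mv) \<union>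
     (\<lambda>(X, Y). Adj X Y) ` (Voc \<times> Voc) \<union>
     (\<Union>Z\<in>Mv. Tup Z ` {Xs. set Xs \<subseteq> Voc \<and> length Xs = arity Z})"

lemma finite_Atoms: "finite Atoms"
proof -
  have "finite Voc" unfolding Voc_def using finite_Mv by simp
  then show ?thesis unfolding Atoms_def using finite_Mv by (auto intro!: finite_lists_length_eq)
qed

text \<open>The back-and-forth type of rank \<open>q\<close> of the structure on \<open>W\<close>,
  where a move assigns a guarded relation on \<open>W\<close> to a variable in \<open>Mv\<close>.
  Coding types as natural numbers makes types of different structures comparable and lets them index
  finite disjunctions. The type of rank \<open>q\<close> is stored in the one of rank
  \<open>Suc q\<close>, so higher types determine lower ones.\<close>

primrec tp :: "nat \<Rightarrow> ('a \<times> 'a) set \<Rightarrow> 'a set \<Rightarrow> (rvar \<Rightarrow> 'a list set) \<Rightarrow> nat" where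
  "tp 0 E W \<rho> = set_encode (to_nat ` {a \<in> Atoms. holds E W \<rho> a})"
| "tp (Suc q) E W \<rho> = prod_encode (tp q E W \<rho>,
     set_encode {prod_encode (to_nat X, tp q E W (\<rho>(X := R))) | X R. X \<in> Mv \<and> R \<subseteq> locals E X W})"

lemma tp_moves_subset:
  assumes "\<And>E W \<rho>. tp q (E :: ('a \<times> 'a) set) W \<rho> < M"
  shows "{prod_encode (to_nat X, tp q (E :: ('a \<times> 'a) set) W (\<rho>(X := R))) | X R.
    X \<in> Mv \<and> R \<subseteq> locals E X W} \<subseteq> prod_encode ` (to_nat ` Mv \<times> {..<M})"
  using assms by auto

text \<open>The bound depends on the vocabulary and on \<open>q\<close>, not on the structure. It
  also shows that the sets given to \<open>set_encode\<close> are finite, without which the coding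
  would not be injective.\<close>

lemma tp_bounded: "\<exists>M\<ge>1. \<forall>E W \<rho>. tp q (E :: ('a \<times> 'a) set) W \<rho> < M"
proof (induction q)
  case 0
  have "finite (set_encode ` Pow (to_nat ` Atoms))" using finite_Atoms by simp
  then obtain M where M: "\<forall>x\<in>set_encode ` Pow (to_nat ` Atoms). x < M"
    using finite_nat_set_iff_bounded by blast
  have "tp 0 (E :: ('a \<times> 'a) set) W \<rho> < M" for E W \<rho> using M by auto
  then show ?case by (intro exI[of _ "Suc M"]) (auto intro: less_SucI)
next
  case (Suc q)
  then obtain M where M: "\<And>E W \<rho>. tp q (E :: ('a \<times> 'a) set) W \<rho> < M" by blast
  have "finite (prod_encode ` ({..<M} \<times> set_encode ` Pow (prod_encode ` (to_nat ` Mv \<times> {..<M}))))"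
    using finite_Mv by simp
  then obtain N where N: "\<forall>x\<in>prod_encode `
      ({..<M} \<times> set_encode ` Pow (prod_encode ` (to_nat ` Mv \<times> {..<M}))). x < N"
    using finite_nat_set_iff_bounded by blast
  have "tp (Suc q) (E :: ('a \<times> 'a) set) W \<rho> < N" for E W \<rho>
    using N M tp_moves_subset[OF M, of E W \<rho>] by auto
  then show ?case by (intro exI[of _ "Suc N"]) (auto intro: less_SucI)
qed

lemma tp_0_eq_iff:
  "tp 0 E W \<rho> = tp 0 E' W' \<rho>' \<longleftrightarrow> (\<forall>a\<in>Atoms. holds E W \<rho> a \<longleftrightarrow> holds E' W' \<rho>' a)"
proof -
  have "tp 0 E W \<rho> = tp 0 E' W' \<rho>' \<longleftrightarrow>
    to_nat ` {a \<in> Atoms. holds E W \<rho> a} = to_nat ` {a \<in> Atoms. holds E' W' \<rho>' a}"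
    using finite_Atoms by (simp add: set_encode_eq)
  then show ?thesis by (auto simp: inj_image_eq_iff)
qed

lemma tp_Suc_eq_iff:
  fixes E :: "('a \<times> 'a) set" and E' :: "('a \<times> 'a) set"
  shows "tp (Suc q) E W \<rho> = tp (Suc q) E' W' \<rho>' \<longleftrightarrow> tp q E W \<rho> = tp q E' W' \<rho>' \<and>
    (\<forall>X\<in>Mv. (\<forall>R\<subseteq>locals E X W. \<exists>R'\<subseteq>locals E' X W'. tp q E W (\<rho>(X := R)) = tp q E' W' (\<rho>'(X := R'))) \<and>
      (\<forall>R'\<subseteq>locals E' X W'. \<exists>R\<subseteq>locals E X W. tp q E W (\<rho>(X := R)) = tp q E' W' (\<rho>'(X := R'))))"
proof -
  obtain M where M: "\<And>E W \<rho>. tp q (E :: ('a \<times> 'a) set) W \<rho> < M" using tp_bounded by blast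
  define mv where "mv E W \<rho> = {prod_encode (to_nat X, tp q E W (\<rho>(X := R))) | X R.
    X \<in> Mv \<and> R \<subseteq> locals E X W}" for E :: "('a \<times> 'a) set" and W \<rho>
  have fin: "finite (mv E W \<rho>)" for E W \<rho>
    using finite_subset[OF tp_moves_subset[OF M]] finite_Mv unfolding mv_def by blast
  have eq: "tp (Suc q) E W \<rho> = tp (Suc q) E' W' \<rho>' \<longleftrightarrow>
      tp q E W \<rho> = tp q E' W' \<rho>' \<and> mv E W \<rho> \<subseteq> mv E' W' \<rho>' \<and> mv E' W' \<rho>' \<subseteq> mv E W \<rho>"
    using set_encode_eq[OF fin fin] unfolding tp.simps mv_def[symmetric] by (simp add: set_eq_subset)
  have mem: "prod_encode (to_nat X, n) \<in> mv E W \<rho> \<longleftrightarrow> (\<exists>R\<subseteq>locals E X W. n = tp q E W (\<rho>(X := R)))"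
    if "X \<in> Mv" for X n and E :: "('a \<times> 'a) set" and W \<rho>
    using that by (auto simp: mv_def)
  have sub: "mv E W \<rho> \<subseteq> S \<longleftrightarrow>
      (\<forall>X\<in>Mv. \<forall>R\<subseteq>locals E X W. prod_encode (to_nat X, tp q E W (\<rho>(X := R))) \<in> S)"
    for S and E :: "('a \<times> 'a) set" and W \<rho>
    by (auto simp: mv_def)
  have "mv E W \<rho> \<subseteq> mv E' W' \<rho>' \<longleftrightarrow> (\<forall>X\<in>Mv. \<forall>R\<subseteq>locals E X W.
      \<exists>R'\<subseteq>locals E' X W'. tp q E W (\<rho>(X := R)) = tp q E' W' (\<rho>'(X := R')))"
    for E E' :: "('a \<times> 'a) set" and W W' \<rho> \<rho>'
    unfolding sub by (rule ball_cong[OF refl]) (simp only: mem)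
  then show ?thesis
    unfolding eq by (simp only: ball_conj_distrib eq_commute[of "tp q E' W' _"])
qed

lemma tp_Suc_eqD: "tp (Suc q) E W \<rho> = tp (Suc q) E' W' \<rho>' \<Longrightarrow> tp q E W \<rho> = tp q E' W' \<rho>'"
  by simp

lemma tp_eq_holds:
  "tp q E W \<rho> = tp q E' W' \<rho>' \<Longrightarrow> a \<in> Atoms \<Longrightarrow> holds E W \<rho> a \<longleftrightarrow> holds E' W' \<rho>' a"
proof (induction q)
  case 0
  then show ?case using tp_0_eq_iff by blast
next
  case (Suc q)
  then show ?case using tp_Suc_eqD by blast
qed

lemma tp_le_eqD: "tp q E W \<rho> = tp q E' W' \<rho>' \<Longrightarrow> n \<le> q \<Longrightarrow> tp n E W \<rho> = tp n E' W' \<rho>'"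
proof (induction q)
  case (Suc q)
  then show ?case using tp_Suc_eqD le_Suc_eq by metis
qed simp

text \<open>Atoms ask for witnesses in \<open>W\<close> and moves stay in \<open>W\<close>, so an
  isomorphism of the restrictions suffices. With the identity this yields
  \<open>tp_cong\<close>.\<close>

lemma tp_isomorphic:
  fixes E :: "('a \<times> 'a) set" and E' :: "('a \<times> 'a) set"
  assumes h: "inj_on h W" "W' = h ` W"
    and E: "\<And>u v. u \<in> W \<Longrightarrow> v \<in> W \<Longrightarrow> (u, v) \<in> E \<longleftrightarrow> (h u, h v) \<in> E'"
  shows "(\<And>X t. set t \<subseteq> W \<Longrightarrow> t \<in> \<rho> X \<longleftrightarrow> map h t \<in> \<rho>' X) \<Longrightarrow> tp q E W \<rho> = tp q E' W' \<rho>'"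
proof (induction q arbitrary: \<rho> \<rho>')
  case 0
  have lift: "\<exists>t. set t \<subseteq> W \<and> t' = map h t" if "set t' \<subseteq> W'" for t'
    using that h(2)
    by (intro exI[of _ "map (inv_into W h) t'"])
      (auto simp: f_inv_into_f subset_iff intro!: map_idI[symmetric] inv_into_into)
  have single: "[u] \<in> \<rho> X \<longleftrightarrow> [h u] \<in> \<rho>' X" if "u \<in> W" for u X using 0[of "[u]" X] that by simp
  have wit: "witness E \<rho> a t \<longleftrightarrow> witness E' \<rho>' a (map h t)" if "set t \<subseteq> W" for a t
  proof (cases a)
    case (Adj X Y)
    show ?thesis
    proof (cases "\<exists>u v. t = [u, v]")
      case True
      with that show ?thesis unfolding Adj using E single by fastforce
    next
      case False
      then have "\<not> (\<exists>u v. map h t = [u, v])" by (auto simp: map_eq_Cons_conv)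
      with False show ?thesis unfolding Adj by auto
    qed
  next
    case (Tup Z Xs)
    have "list_all2 (\<lambda>u X. [u] \<in> \<rho> X) t Xs \<longleftrightarrow> list_all2 (\<lambda>u X. [h u] \<in> \<rho>' X) t Xs"
      using that single by (auto intro!: list.rel_cong_simp simp: list_all2_conv_all_nth subset_iff)
    then show ?thesis unfolding Tup using 0[OF that] by (simp add: list_all2_map1)
  qed (use 0[OF that] in auto)
  have "holds E W \<rho> a \<longleftrightarrow> holds E' W' \<rho>' a" for a
  proof
    assume "holds E W \<rho> a"
    then obtain t where "set t \<subseteq> W" "witness E \<rho> a t" by (auto simp: holds_def)
    then show "holds E' W' \<rho>' a"
      unfolding holds_def using wit h(2) by (intro exI[of _ "map h t"]) auto
  next
    assume "holds E' W' \<rho>' a"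
    then obtain t' where "set t' \<subseteq> W'" "witness E' \<rho>' a t'" by (auto simp: holds_def)
    then show "holds E W \<rho> a" using lift wit unfolding holds_def by blast
  qed
  then show ?case by (simp only: tp_0_eq_iff) simp
next
  case (Suc q)
  have inj: "inj_on (map h) {t. set t \<subseteq> W}" 
  proof (rule inj_onI)
    fix s t assume st: "s \<in> {t. set t \<subseteq> W}" "t \<in> {t. set t \<subseteq> W}" "map h s = map h t"
    have "inj_on h (set s \<union> set t)" by (rule inj_on_subset[OF h(1)]) (use st in auto)
    with st(3) show "s = t" by (rule map_inj_on)
  qed
  have cl: "clique_tuple E t \<longleftrightarrow> clique_tuple E' (map h t)" if "set t \<subseteq> W" for t
    using that E h(1) unfolding clique_tuple_def by (auto simp: subset_iff inj_on_eq_iff)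
  have step: "tp q E W (\<rho>(X := R)) = tp q E' W' (\<rho>'(X := R'))"
    if "\<And>t. set t \<subseteq> W \<Longrightarrow> t \<in> R \<longleftrightarrow> map h t \<in> R'" for X R R'
    by (rule Suc.IH) (use that Suc.prems in auto)
  show ?case unfolding tp_Suc_eq_iff
  proof (intro conjI ballI allI impI)
    show "tp q E W \<rho> = tp q E' W' \<rho>'" by (rule Suc.IH) (rule Suc.prems)
  next
    fix X R assume R: "R \<subseteq> locals E X W"
    have "map h t \<in> locals E' X W'" if "t \<in> R" for t
    proof -
      have t: "length t = arity X" "set t \<subseteq> W" "clique_tuple E t"
        using R that by (auto simp: locals_def)
      then show ?thesis using cl[OF t(2)] by (simp add: locals_def h(2) image_mono)
    qed
    then have "map h ` R \<subseteq> locals E' X W'" by blast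
    moreover have "R \<subseteq> {t. set t \<subseteq> W}" using R by (auto simp: locals_def)
    then have "tp q E W (\<rho>(X := R)) = tp q E' W' (\<rho>'(X := map h ` R))"
      by (intro step) (simp add: inj_on_image_mem_iff[OF inj])
    ultimately show "\<exists>R'\<subseteq>locals E' X W'. tp q E W (\<rho>(X := R)) = tp q E' W' (\<rho>'(X := R'))"
      by blast
  next
    fix X R' assume R': "R' \<subseteq> locals E' X W'"
    let ?R = "{t. set t \<subseteq> W \<and> map h t \<in> R'}"
    have "?R \<subseteq> locals E X W" using R' cl by (auto simp: locals_def)
    moreover have "tp q E W (\<rho>(X := ?R)) = tp q E' W' (\<rho>'(X := R'))" by (rule step) simp
    ultimately show "\<exists>R\<subseteq>locals E X W. tp q E W (\<rho>(X := R)) = tp q E' W' (\<rho>'(X := R'))" by blast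
  qed
qed

lemma tp_cong:
  assumes "\<And>X t. set t \<subseteq> W \<Longrightarrow> t \<in> \<rho> X \<longleftrightarrow> t \<in> \<rho>' X"
  shows "tp q E W \<rho> = tp q E W \<rho>'"
  by (rule tp_isomorphic[of id]) (use assms in auto)

text \<open>Emptying a parameter commutes with all moves, because parameters are never reassigned,
  and it falsifies the atoms that mention the parameter while keeping the others. It serves to
  return from the list with the last deleted vertex to the shorter list.\<close>

lemma tp_forget_param:
  fixes E E' :: "('a \<times> 'a) set"
  shows "tp q E W \<rho> = tp q E' W' \<rho>' \<Longrightarrow>
    tp q E W (\<rho>(Param k := {})) = tp q E' W' (\<rho>'(Param k := {}))"
proof (induction q arbitrary: \<rho> \<rho>')
  case 0
  have at: "holds E W (\<rho>(Param k := {})) a \<longleftrightarrow> holds E W \<rho> a \<and>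
      (case a of Meet X Y \<Rightarrow> X \<noteq> Param k \<and> Y \<noteq> Param k | Minus X Y \<Rightarrow> True
       | Adj X Y \<Rightarrow> X \<noteq> Param k \<and> Y \<noteq> Param k | Tup Z Xs \<Rightarrow> Param k \<notin> set Xs)"
    if "a \<in> Atoms" for a and E :: "('a \<times> 'a) set" and W and \<rho> :: "rvar \<Rightarrow> 'a list set"
  proof (cases a)
    case (Tup Z Xs)
    have "Z \<noteq> Param k" using that no_Param unfolding Tup Atoms_def by auto
    moreover have "list_all2 (\<lambda>u X. [u] \<in> (\<rho>(Param k := {})) X) t Xs \<longleftrightarrow>
        list_all2 (\<lambda>u X. [u] \<in> \<rho> X) t Xs \<and> Param k \<notin> set Xs" for t
      by (auto simp: list_all2_conv_all_nth in_set_conv_nth)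
    ultimately show ?thesis unfolding Tup holds_def by auto
  next
    case (Minus X Y)
    then have "X \<noteq> Param k" "Y \<noteq> Param k" using that no_Param unfolding Atoms_def by auto
    then show ?thesis unfolding Minus holds_def by auto
  qed (auto simp: holds_def)
  show ?case using 0 unfolding tp_0_eq_iff using at by simp
next
  case (Suc q)
  have X: "\<rho>(Param k := {}, X := R) = \<rho>(X := R, Param k := {})" if "X \<in> Mv" for X R
    and \<rho> :: "rvar \<Rightarrow> 'a list set"
    using that no_Param by (metis fun_upd_twist)
  have IH: "tp q E W (\<rho>(Param k := {}, X := R)) = tp q E' W' (\<rho>'(Param k := {}, X := R'))"
    if "X \<in> Mv" "tp q E W (\<rho>(X := R)) = tp q E' W' (\<rho>'(X := R'))" for X R R'
    using Suc.IH[OF that(2)] by (simp only: X[OF that(1)])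
  show ?case unfolding tp_Suc_eq_iff
  proof (intro conjI ballI allI impI)
    show "tp q E W (\<rho>(Param k := {})) = tp q E' W' (\<rho>'(Param k := {}))"
      by (rule Suc.IH[OF tp_Suc_eqD[OF Suc.prems]])
  next
    fix Y R assume "Y \<in> Mv" "R \<subseteq> locals E Y W"
    then show "\<exists>R'\<subseteq>locals E' Y W'.
        tp q E W (\<rho>(Param k := {}, Y := R)) = tp q E' W' (\<rho>'(Param k := {}, Y := R'))"
      using Suc.prems IH unfolding tp_Suc_eq_iff by meson
  next
    fix Y R' assume "Y \<in> Mv" "R' \<subseteq> locals E' Y W'"
    then show "\<exists>R\<subseteq>locals E Y W.
        tp q E W (\<rho>(Param k := {}, Y := R)) = tp q E' W' (\<rho>'(Param k := {}, Y := R'))"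
      using Suc.prems IH unfolding tp_Suc_eq_iff by meson
  qed
qed

section \<open>Amalgamation of pieces that overlap in the parameters\<close>

definition pieces :: "('a \<times> 'a) set \<Rightarrow> 'a set \<Rightarrow> 'a set set \<Rightarrow> bool" where
  "pieces E A J \<longleftrightarrow> J \<noteq> {} \<and> (\<forall>C\<in>J. C \<inter> A = {}) \<and>
     (\<forall>C\<in>J. \<forall>D\<in>J. C \<noteq> D \<longrightarrow> C \<inter> D = {} \<and> (\<forall>u\<in>C. \<forall>v\<in>D. (u, v) \<notin> E))"

text \<open>Entries in two different pieces would have to be adjacent, but no edge joins different
  pieces. Here guardedness enters the composition.\<close>

lemma clique_in_piece:
  assumes J: "pieces E A J" and t: "clique_tuple E t" "set t \<subseteq> \<Union>J \<union> A"
  shows "\<exists>C\<in>J. set t \<subseteq> C \<union> A"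
proof (cases "set t \<subseteq> A")
  case True
  obtain C where "C \<in> J" using J by (auto simp: pieces_def)
  with True show ?thesis by (intro bexI[of _ C]) auto
next
  case False
  then obtain u C where u: "u \<in> set t" "u \<notin> A" "C \<in> J" "u \<in> C" using t(2) by blast
  have "v \<in> C \<union> A" if v: "v \<in> set t" for v
  proof (rule ccontr)
    assume v': "v \<notin> C \<union> A"
    then obtain D where D: "D \<in> J" "v \<in> D" using v t(2) by auto
    have "D \<noteq> C" "v \<noteq> u" using v' D(2) u(4) by auto
    then have "(u, v) \<in> E" "(u, v) \<notin> E"
      using t(1) u v D J unfolding clique_tuple_def pieces_def by metis+
    then show False by simp
  qed
  then show ?thesis using u by blast
qed

text \<open>A composition property in the style of Feferman and Vaught. The \<open>itself\<close>
  argument fixes the vertex type, which a definition cannot quantify over.\<close>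

definition amalgamable :: "'a itself \<Rightarrow> nat \<Rightarrow> nat \<Rightarrow> bool" where
  "amalgamable T q t \<longleftrightarrow> (\<forall>(E :: ('a \<times> 'a) set) (E' :: ('a \<times> 'a) set) as as' J J' \<rho> \<rho>'.
     sym E \<and> sym E' \<and> length as = length as' \<and> length as \<le> d \<and>
     pieces E (set as) J \<and> pieces E' (set as') J' \<and> params \<rho> as \<and> params \<rho>' as' \<and>
     valid E \<rho> \<and> valid E' \<rho>' \<and>
     (\<forall>c. eqcount t {C \<in> J. tp q E (C \<union> set as) \<rho> = c} {C \<in> J'. tp q E' (C \<union> set as') \<rho>' = c}) \<longrightarrow>
     tp q E (\<Union>J \<union> set as) \<rho> = tp q E' (\<Union>J' \<union> set as') \<rho>')"

lemma amalgamableD: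
  fixes E :: "('a \<times> 'a) set" and E' :: "('a \<times> 'a) set"
  assumes "amalgamable TYPE('a) q t" "sym E" "sym E'" "length as = length as'" "length as \<le> d"
    "pieces E (set as) J" "pieces E' (set as') J'" "params \<rho> as" "params \<rho>' as'"
    "valid E \<rho>" "valid E' \<rho>'"
    "\<And>c. eqcount t {C \<in> J. tp q E (C \<union> set as) \<rho> = c} {C \<in> J'. tp q E' (C \<union> set as') \<rho>' = c}"
  shows "tp q E (\<Union>J \<union> set as) \<rho> = tp q E' (\<Union>J' \<union> set as') \<rho>'"
  using assms unfolding amalgamable_def by blast

text \<open>Threshold 1 suffices: an atom holds in the union iff it holds in some piece, so only the
  set of types that occur matters.\<close>

lemma amalgamable_0: "amalgamable TYPE('a) 0 1"
  unfolding amalgamable_def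
proof (intro allI impI, elim conjE)
  fix E E' :: "('a \<times> 'a) set" and as as' J J' \<rho> \<rho>'
  assume sym: "sym E" "sym E'" and J: "pieces E (set as) J" "pieces E' (set as') J'"
    and valid: "valid E \<rho>" "valid E' \<rho>'"
    and cnt: "\<forall>c. eqcount 1 {C \<in> J. tp 0 E (C \<union> set as) \<rho> = c} {C \<in> J'. tp 0 E' (C \<union> set as') \<rho>' = c}"
  have or: "holds E (\<Union>J \<union> A) \<rho> a \<longleftrightarrow> (\<exists>C\<in>J. holds E (C \<union> A) \<rho> a)"
    if J: "sym E" "pieces E A J" "valid E \<rho>" for E :: "('a \<times> 'a) set" and A J \<rho> a
  proof
    assume "holds E (\<Union>J \<union> A) \<rho> a"
    then obtain t where t: "set t \<subseteq> \<Union>J \<union> A" "witness E \<rho> a t" by (auto simp: holds_def)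
    obtain C where "C \<in> J" "set t \<subseteq> C \<union> A"
      using clique_in_piece[OF J(2) witness_clique[OF J(1,3) t(2)] t(1)] by blast
    with t(2) show "\<exists>C\<in>J. holds E (C \<union> A) \<rho> a" unfolding holds_def by (intro bexI[of _ C] exI[of _ t]) auto
  next
    assume "\<exists>C\<in>J. holds E (C \<union> A) \<rho> a"
    then obtain C t where "C \<in> J" "set t \<subseteq> C \<union> A" "witness E \<rho> a t" by (auto simp: holds_def)
    then show "holds E (\<Union>J \<union> A) \<rho> a" unfolding holds_def by (intro exI[of _ t]) auto
  qed
  have ne: "{C \<in> J. tp 0 E (C \<union> set as) \<rho> = c} \<noteq> {} \<longleftrightarrow> {C \<in> J'. tp 0 E' (C \<union> set as') \<rho>' = c} \<noteq> {}" for c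
  proof -
    have al: "at_least 1 S \<longleftrightarrow> S \<noteq> {}" for S :: "'a set set"
      unfolding at_least_def by (metis One_nat_def Suc_leI card_0_eq card_gt_0_iff finite.emptyI not_one_le_zero)
    show ?thesis using cnt[rule_format, of c] unfolding eqcount_def al[symmetric] by blast
  qed
  have "(\<exists>C\<in>J. holds E (C \<union> set as) \<rho> a) \<longleftrightarrow> (\<exists>C\<in>J'. holds E' (C \<union> set as') \<rho>' a)"
    if a: "a \<in> Atoms" for a
  proof
    assume "\<exists>C\<in>J. holds E (C \<union> set as) \<rho> a"
    then obtain C where C: "C \<in> J" "holds E (C \<union> set as) \<rho> a" by blast
    then obtain C' where "C' \<in> J'" "tp 0 E' (C' \<union> set as') \<rho>' = tp 0 E (C \<union> set as) \<rho>"
      using ne[of "tp 0 E (C \<union> set as) \<rho>"] by blast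
    with C show "\<exists>C\<in>J'. holds E' (C \<union> set as') \<rho>' a" using tp_eq_holds[OF _ a] by blast
  next
    assume "\<exists>C\<in>J'. holds E' (C \<union> set as') \<rho>' a"
    then obtain C where C: "C \<in> J'" "holds E' (C \<union> set as') \<rho>' a" by blast
    then obtain C' where "C' \<in> J" "tp 0 E (C' \<union> set as) \<rho> = tp 0 E' (C \<union> set as') \<rho>'"
      using ne[of "tp 0 E' (C \<union> set as') \<rho>'"] by blast
    with C show "\<exists>C\<in>J. holds E (C \<union> set as) \<rho> a" using tp_eq_holds[OF _ a] by blast
  qed
  then show "tp 0 E (\<Union>J \<union> set as) \<rho> = tp 0 E' (\<Union>J' \<union> set as') \<rho>'"
    unfolding tp_0_eq_iff or[OF sym(1) J(1) valid(1)] or[OF sym(2) J(2) valid(2)] by (rule ballI)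
qed

text \<open>The answers chosen in the pieces of the second structure agree on the parameters, since the
  type of a piece determines which tuples of parameters belong to a relation.\<close>

lemma amalgam_move:
  fixes E :: "('a \<times> 'a) set" and E' :: "('a \<times> 'a) set"
  assumes am: "amalgamable TYPE('a) q t"
    and M: "\<And>E W \<rho>. tp q (E :: ('a \<times> 'a) set) W \<rho> < M" "1 \<le> M" and t: "1 \<le> t"
    and sym: "sym E" "sym E'" and len: "length as = length as'" "length as \<le> d"
    and J: "pieces E (set as) J" "pieces E' (set as') J'"
    and par: "params \<rho> as" "params \<rho>' as'" and val: "valid E \<rho>" "valid E' \<rho>'"
    and cnt: "\<And>c. eqcount (t * M) {C \<in> J. tp (Suc q) E (C \<union> set as) \<rho> = c}
      {C \<in> J'. tp (Suc q) E' (C \<union> set as') \<rho>' = c}"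
    and X: "X \<in> Mv" and R: "R \<subseteq> locals E X (\<Union>J \<union> set as)"
  shows "\<exists>R'\<subseteq>locals E' X (\<Union>J' \<union> set as').
    tp q E (\<Union>J \<union> set as) (\<rho>(X := R)) = tp q E' (\<Union>J' \<union> set as') (\<rho>'(X := R'))"
proof -
  let ?A = "set as" and ?A' = "set as'"
  have XP: "X \<noteq> Param i" for i using X no_Param by blast
  define loc where "loc C = {u \<in> R. set u \<subseteq> C \<union> ?A}" for C
  have loc_tp: "tp q E (C \<union> ?A) (\<rho>(X := R)) = tp q E (C \<union> ?A) (\<rho>(X := loc C))" for C
    by (rule tp_cong) (auto simp: loc_def)
  \<comment> \<open>The piece \<open>f C\<close> has the same type as \<open>C\<close>, so what the
    move does in \<open>f C\<close> can be answered in \<open>C\<close>. The choice of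
    \<open>f\<close> keeps the counts of the resulting types equal up to \<open>t\<close>.\<close>
  obtain f where f: "\<And>C. C \<in> J' \<Longrightarrow> f C \<in> J \<and> tp (Suc q) E (f C \<union> ?A) \<rho> = tp (Suc q) E' (C \<union> ?A') \<rho>'"
    "\<And>w. eqcount t {C \<in> J. tp q E (C \<union> ?A) (\<rho>(X := R)) = w}
      {C \<in> J'. tp q E (f C \<union> ?A) (\<rho>(X := R)) = w}"
    by (rule eqcount_matching[OF cnt, of "\<lambda>C. tp q E (C \<union> ?A) (\<rho>(X := R))"]) (use M t in auto)
  have "\<exists>R'\<subseteq>locals E' X (C \<union> ?A'). tp q E (f C \<union> ?A) (\<rho>(X := loc (f C))) =
      tp q E' (C \<union> ?A') (\<rho>'(X := R'))" if "C \<in> J'" for C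
  proof -
    have "loc (f C) \<subseteq> locals E X (f C \<union> ?A)" using R by (auto simp: loc_def locals_def)
    then show ?thesis using f(1)[OF that] X unfolding tp_Suc_eq_iff by blast
  qed
  then obtain RR where RR: "\<And>C. C \<in> J' \<Longrightarrow> RR C \<subseteq> locals E' X (C \<union> ?A')"
    "\<And>C. C \<in> J' \<Longrightarrow> tp q E (f C \<union> ?A) (\<rho>(X := loc (f C))) = tp q E' (C \<union> ?A') (\<rho>'(X := RR C))"
    by metis
  have compat: "u \<in> RR D" if C: "C \<in> J'" "D \<in> J'" "u \<in> RR C" "set u \<subseteq> D \<union> ?A'" for C D u
  proof (cases "C = D")
    case False
    have uL: "u \<in> locals E' X (C \<union> ?A')" using RR(1)[OF C(1)] C(3) by blast
    then have "set u \<subseteq> C \<union> ?A'" by (simp add: locals_def)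
    moreover have "C \<inter> D = {}" using J(2) C False by (simp add: pieces_def)
    ultimately have uA: "set u \<subseteq> ?A'" using C(4) by blast
    then have "\<forall>v\<in>set u. \<exists>i<length as'. v = as' ! i" by (metis in_set_conv_nth subset_iff)
    then obtain g where g: "\<And>v. v \<in> set u \<Longrightarrow> g v < length as' \<and> v = as' ! g v" by metis
    define ns where "ns = map g u"
    have u: "u = map (nth as') ns" unfolding ns_def using g by (auto intro!: map_idI[symmetric])
    have ns': "set ns \<subseteq> {..<length as'}" and ns: "set ns \<subseteq> {..<length as}"
      unfolding ns_def using g len(1) by auto
    \<comment> \<open>This atom says that one particular tuple of parameters lies in the relation.
      The bound \<open>length as \<le> d\<close> puts the names of these parameters into the
      vocabulary.\<close>
    have at: "Tup X (map Param ns) \<in> Atoms"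
    proof -
      have "length ns = arity X" using uL by (simp add: ns_def locals_def)
      moreover have "set (map Param ns) \<subseteq> Voc" using ns len(2) by (auto simp: Voc_def)
      ultimately show ?thesis using X unfolding Atoms_def
        by (intro UnI2 UN_I[of X] imageI CollectI conjI) auto
    qed
    note p = params_upd[OF par(1), of X] and p' = params_upd[OF par(2), of X]
    have H: "holds E W (\<rho>(X := S)) (Tup X (map Param ns)) \<longleftrightarrow>
      set (map (nth as) ns) \<subseteq> W \<and> map (nth as) ns \<in> S" for S W
      unfolding holds_def using list_all2_params[OF p ns] XP by auto
    have H': "holds E' W (\<rho>'(X := S)) (Tup X (map Param ns)) \<longleftrightarrow>
      set (map (nth as') ns) \<subseteq> W \<and> map (nth as') ns \<in> S" for S W
      unfolding holds_def using list_all2_params[OF p' ns'] XP by auto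
    have "holds E' (C \<union> ?A') (\<rho>'(X := RR C)) (Tup X (map Param ns))"
      unfolding H' using C(3) uA u by auto
    then have "holds E (f C \<union> ?A) (\<rho>(X := loc (f C))) (Tup X (map Param ns))"
      using tp_eq_holds[OF RR(2)[OF C(1)] at] by blast
    then have "map (nth as) ns \<in> R" unfolding H by (simp add: loc_def)
    moreover have "set (map (nth as) ns) \<subseteq> ?A" using ns by auto
    ultimately have "holds E (f D \<union> ?A) (\<rho>(X := loc (f D))) (Tup X (map Param ns))"
      unfolding H by (auto simp: loc_def)
    then have "holds E' (D \<union> ?A') (\<rho>'(X := RR D)) (Tup X (map Param ns))"
      using tp_eq_holds[OF RR(2)[OF C(2)] at] by blast
    then show ?thesis unfolding H' u by blast
  qed (use C in simp)
  define R' where "R' = (\<Union>C\<in>J'. RR C)"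
  have R': "R' \<subseteq> locals E' X (\<Union>J' \<union> ?A')"
    unfolding R'_def using RR(1) by (fastforce simp: locals_def)
  have tp': "tp q E' (C \<union> ?A') (\<rho>'(X := R')) = tp q E (f C \<union> ?A) (\<rho>(X := R))" if "C \<in> J'" for C
  proof -
    have "u \<in> R' \<longleftrightarrow> u \<in> RR C" if "set u \<subseteq> C \<union> ?A'" for u
      unfolding R'_def using compat[OF _ \<open>C \<in> J'\<close> _ that] \<open>C \<in> J'\<close> by blast
    then have "tp q E' (C \<union> ?A') (\<rho>'(X := R')) = tp q E' (C \<union> ?A') (\<rho>'(X := RR C))"
      by (intro tp_cong) simp
    then show ?thesis using RR(2)[OF that] loc_tp by simp
  qed
  have "tp q E (\<Union>J \<union> ?A) (\<rho>(X := R)) = tp q E' (\<Union>J' \<union> ?A') (\<rho>'(X := R'))"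
  proof (rule amalgamableD[OF am sym len J params_upd[OF par(1) XP] params_upd[OF par(2) XP]
        valid_upd[OF val(1) R] valid_upd[OF val(2) R']])
    fix c
    have "{C \<in> J'. tp q E' (C \<union> ?A') (\<rho>'(X := R')) = c} =
        {C \<in> J'. tp q E (f C \<union> ?A) (\<rho>(X := R)) = c}" using tp' by auto
    then show "eqcount t {C \<in> J. tp q E (C \<union> ?A) (\<rho>(X := R)) = c}
        {C \<in> J'. tp q E' (C \<union> ?A') (\<rho>'(X := R')) = c}" using f(2)[of c] by simp
  qed
  then show ?thesis using R' by blast
qed

lemma amalgamable: "\<exists>t\<ge>1. amalgamable TYPE('a) q t"
proof (induction q)
  case 0
  then show ?case using amalgamable_0 by blast
next
  case (Suc q)
  then obtain t where t: "1 \<le> t" "amalgamable TYPE('a) q t" by blast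
  obtain M where M: "1 \<le> M" "\<And>E W \<rho>. tp q (E :: ('a \<times> 'a) set) W \<rho> < M" using tp_bounded by blast
  have "amalgamable TYPE('a) (Suc q) (t * M)"
    unfolding amalgamable_def
  proof (intro allI impI, elim conjE)
    fix E E' :: "('a \<times> 'a) set" and as as' J J' \<rho> \<rho>'
    assume sym: "sym E" "sym E'" and len: "length as = length as'" "length as \<le> d"
      and J: "pieces E (set as) J" "pieces E' (set as') J'"
      and par: "params \<rho> as" "params \<rho>' as'" and val: "valid E \<rho>" "valid E' \<rho>'"
      and cnt: "\<forall>c. eqcount (t * M) {C \<in> J. tp (Suc q) E (C \<union> set as) \<rho> = c}
        {C \<in> J'. tp (Suc q) E' (C \<union> set as') \<rho>' = c}"
    let ?A = "set as" and ?A' = "set as'"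
    note move = amalgam_move[OF t(2) M(2,1) t(1) sym len J par val cnt[rule_format]]
    \<comment> \<open>Exchanging the two structures gives the other half of the back-and-forth
      condition.\<close>
    note move' = amalgam_move[OF t(2) M(2,1) t(1) sym(2,1) len(1)[symmetric] _ J(2,1) par(2,1) val(2,1)
        eqcount_sym[OF cnt[rule_format]]]
    obtain f where f: "\<And>C. C \<in> J' \<Longrightarrow> f C \<in> J \<and> tp (Suc q) E (f C \<union> ?A) \<rho> = tp (Suc q) E' (C \<union> ?A') \<rho>'"
      "\<And>w. eqcount t {C \<in> J. tp q E (C \<union> ?A) \<rho> = w} {C \<in> J'. tp q E (f C \<union> ?A) \<rho> = w}"
      by (rule eqcount_matching[OF cnt[rule_format], of "\<lambda>C. tp q E (C \<union> ?A) \<rho>"]) (use M t in auto)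
    have "tp q E (\<Union>J \<union> ?A) \<rho> = tp q E' (\<Union>J' \<union> ?A') \<rho>'"
    proof (rule amalgamableD[OF t(2) sym len J par val])
      fix c
      have "tp q E (f C \<union> ?A) \<rho> = tp q E' (C \<union> ?A') \<rho>'" if "C \<in> J'" for C
        using f(1)[OF that] tp_Suc_eqD by blast
      then have "{C \<in> J'. tp q E (f C \<union> ?A) \<rho> = c} = {C \<in> J'. tp q E' (C \<union> ?A') \<rho>' = c}"
        by auto
      then show "eqcount t {C \<in> J. tp q E (C \<union> ?A) \<rho> = c} {C \<in> J'. tp q E' (C \<union> ?A') \<rho>' = c}"
        using f(2)[of c] by simp
    qed
    then show "tp (Suc q) E (\<Union>J \<union> ?A) \<rho> = tp (Suc q) E' (\<Union>J' \<union> ?A') \<rho>'"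
      unfolding tp_Suc_eq_iff using move move' len by (metis (no_types, lifting))
  qed
  then show ?case using t M by (metis mult_le_mono nat_mult_1)
qed

end

section \<open>Satisfaction is determined by a type of bounded rank\<close>

primrec vocabulary :: "so_formula \<Rightarrow> rvar set" where
  "vocabulary (Equal x y) = {Elem x, Elem y}"
| "vocabulary (Edge x y) = {Elem x, Elem y}"
| "vocabulary (Rel i xs) = insert (Relv i (length xs)) (Elem ` set xs)"
| "vocabulary (Neg \<phi>) = vocabulary \<phi>"
| "vocabulary (Conj \<phi> \<psi>) = vocabulary \<phi> \<union> vocabulary \<psi>"
| "vocabulary (Ex x \<phi>) = insert (Elem x) (vocabulary \<phi>)"
| "vocabulary (ExRel i r \<phi>) = insert (Relv i r) (vocabulary \<phi>)"

lemma finite_vocabulary: "finite (vocabulary \<phi>)"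
  by (induction \<phi>) auto

lemma Param_vocabulary: "Param i \<notin> vocabulary \<phi>"
  by (induction \<phi>) auto

definition encodes :: "'a set \<Rightarrow> (rvar \<Rightarrow> 'a list set) \<Rightarrow> (nat \<Rightarrow> 'a) \<Rightarrow> (nat \<times> nat \<Rightarrow> 'a list set) \<Rightarrow>
    so_formula \<Rightarrow> bool" where
  "encodes V \<alpha> \<sigma> \<rho> \<phi> \<longleftrightarrow> (\<forall>x\<in>free_vars \<phi>. \<sigma> x \<in> V \<and> \<alpha> (Elem x) = {[\<sigma> x]}) \<and>
     (\<forall>i r. (i, r) \<in> free_rel_vars \<phi> \<longrightarrow> \<alpha> (Relv i r) = \<rho> (i, r))"

lemma encodes_Ex:
  "encodes V \<alpha> \<sigma> \<rho> (Ex x \<phi>) \<Longrightarrow> v \<in> V \<Longrightarrow> encodes V (\<alpha>(Elem x := {[v]})) (\<sigma>(x := v)) \<rho> \<phi>"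
  unfolding encodes_def by auto

lemma encodes_ExRel:
  "encodes V \<alpha> \<sigma> \<rho> (ExRel i r \<phi>) \<Longrightarrow> encodes V (\<alpha>(Relv i r := R)) \<sigma> (\<rho>((i, r) := R)) \<phi>"
  unfolding encodes_def by auto

lemma guarded_iff_locals:
  assumes "undirected_graph G"
  shows "R \<subseteq> tuples r (pverts G) \<and> guarded G R \<longleftrightarrow> R \<subseteq> locals (parcs G) (Relv i r) (pverts G)"
proof -
  have "R \<subseteq> locals (parcs G) (Relv i r) (pverts G) \<longleftrightarrow>
      R \<subseteq> tuples r (pverts G) \<and> (\<forall>t\<in>R. clique_tuple (parcs G) t)"
    by (auto simp: locals_def tuples_def)
  then show ?thesis using guarded_iff[OF assms] by blast
qed

context type_vocabulary begin

lemma tp_Suc_moveD: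
  fixes E E' :: "('a \<times> 'a) set"
  assumes "tp (Suc q) E W \<rho> = tp (Suc q) E' W' \<rho>'" "X \<in> Mv" "R \<subseteq> locals E X W"
  obtains R' where "R' \<subseteq> locals E' X W'" "tp q E W (\<rho>(X := R)) = tp q E' W' (\<rho>'(X := R'))"
  using assms unfolding tp_Suc_eq_iff by meson

text \<open>One move of \<open>Spare\<close> tests for a second element: if
  \<open>\<alpha>' X\<close> had two, setting \<open>Spare\<close> to one of them would make both
  \<open>Meet Spare X\<close> and \<open>Minus X Spare\<close> true, and no value of
  \<open>Spare\<close> does this when \<open>X\<close> denotes a singleton. The test costs one
  rank.\<close>

lemma singleton_transfer:
  fixes E E' :: "('a \<times> 'a) set"
  assumes eq: "tp (Suc n) E W \<alpha> = tp (Suc n) E' W' \<alpha>'"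
    and X: "X \<in> Mv" "X \<noteq> Spare" "arity X = 1"
    and v: "\<alpha> X = {[v]}" "v \<in> W" and R': "\<alpha>' X \<subseteq> locals E' X W'"
  shows "\<exists>v'\<in>W'. \<alpha>' X = {[v']}"
proof -
  have atoms: "Meet X X \<in> Atoms" "Meet Spare X \<in> Atoms" "Minus X Spare \<in> Atoms"
    using X Spare by (auto simp: Atoms_def Voc_def)
  have len: "\<exists>u\<in>W'. t = [u]" if "t \<in> \<alpha>' X" for t
    using R' that X(3) by (auto simp: locals_def length_Suc_conv)
  have "holds E W \<alpha> (Meet X X)" using v by (auto simp: holds_def)
  then have "holds E' W' \<alpha>' (Meet X X)" using tp_eq_holds[OF eq atoms(1)] by simp
  then obtain t where "t \<in> \<alpha>' X" by (auto simp: holds_def)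
  then obtain v' where v': "[v'] \<in> \<alpha>' X" "v' \<in> W'" using len by metis
  have "w = v'" if w: "[w] \<in> \<alpha>' X" for w
  proof (rule ccontr)
    assume ne: "w \<noteq> v'"
    have wW: "w \<in> W'" using len[OF w] by auto
    have "{[w]} \<subseteq> locals E' Spare W'" using wW by (auto simp: locals_def clique_tuple_def)
    from tp_Suc_moveD[OF eq[symmetric] Spare this] obtain S
      where S: "tp n E W (\<alpha>(Spare := S)) = tp n E' W' (\<alpha>'(Spare := {[w]}))" by metis
    have "holds E' W' (\<alpha>'(Spare := {[w]})) (Meet Spare X)"
      unfolding holds_def using w wW X(2) by (intro exI[of _ "[w]"]) auto
    then have "holds E W (\<alpha>(Spare := S)) (Meet Spare X)" using tp_eq_holds[OF S atoms(2)] by simp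
    then have vS: "[v] \<in> S" using v(1) X(2) by (auto simp: holds_def)
    have "holds E' W' (\<alpha>'(Spare := {[w]})) (Minus X Spare)"
      unfolding holds_def using v' ne X(2) by (intro exI[of _ "[v']"]) auto
    then have "holds E W (\<alpha>(Spare := S)) (Minus X Spare)" using tp_eq_holds[OF S atoms(3)] by simp
    then show False using v(1) vS X(2) by (auto simp: holds_def)
  qed
  then have "\<alpha>' X = {[v']}" using v'(1) len by blast
  with v'(2) show ?thesis by blast
qed

text \<open>One implication is enough, as the other conditions are symmetric in the two
  structures.\<close>

definition determines :: "'a itself \<Rightarrow> nat \<Rightarrow> so_formula \<Rightarrow> bool" where
  "determines T q \<phi> \<longleftrightarrow> (\<forall>(G :: 'a pair_pre_digraph) (G' :: 'a pair_pre_digraph) \<alpha> \<alpha>' \<sigma> \<sigma>' \<rho> \<rho>'.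
     undirected_graph G \<and> undirected_graph G' \<and>
     encodes (pverts G) \<alpha> \<sigma> \<rho> \<phi> \<and> encodes (pverts G') \<alpha>' \<sigma>' \<rho>' \<phi> \<and>
     tp q (parcs G) (pverts G) \<alpha> = tp q (parcs G') (pverts G') \<alpha>' \<and>
     sat (guarded G) G \<sigma> \<rho> \<phi> \<longrightarrow> sat (guarded G') G' \<sigma>' \<rho>' \<phi>)"

lemma determinesD:
  fixes G G' :: "'a pair_pre_digraph"
  assumes "determines TYPE('a) q \<phi>" "undirected_graph G" "undirected_graph G'"
    "encodes (pverts G) \<alpha> \<sigma> \<rho> \<phi>" "encodes (pverts G') \<alpha>' \<sigma>' \<rho>' \<phi>"
    "tp q (parcs G) (pverts G) \<alpha> = tp q (parcs G') (pverts G') \<alpha>'"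
    "sat (guarded G) G \<sigma> \<rho> \<phi>"
  shows "sat (guarded G') G' \<sigma>' \<rho>' \<phi>"
  using assms unfolding determines_def by blast

lemma determinesI:
  assumes "\<And>G G' \<alpha> \<alpha>' \<sigma> \<sigma>' \<rho> \<rho>'. undirected_graph (G :: 'a pair_pre_digraph) \<Longrightarrow>
     undirected_graph (G' :: 'a pair_pre_digraph) \<Longrightarrow>
     encodes (pverts G) \<alpha> \<sigma> \<rho> \<phi> \<Longrightarrow> encodes (pverts G') \<alpha>' \<sigma>' \<rho>' \<phi> \<Longrightarrow>
     tp q (parcs G) (pverts G) \<alpha> = tp q (parcs G') (pverts G') \<alpha>' \<Longrightarrow>
     sat (guarded G) G \<sigma> \<rho> \<phi> \<Longrightarrow> sat (guarded G') G' \<sigma>' \<rho>' \<phi>"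
  shows "determines TYPE('a) q \<phi>"
  unfolding determines_def by (intro allI impI, elim conjE, rule assms)

lemma determines_mono: "determines TYPE('a) q \<phi> \<Longrightarrow> q \<le> q' \<Longrightarrow> determines TYPE('a) q' \<phi>"
  by (rule determinesI) (erule (4) determinesD[where q = q], rule tp_le_eqD, auto)

lemma determines_atom:
  assumes a: "a \<in> Atoms"
    and iff: "\<And>(G :: 'a pair_pre_digraph) \<alpha> \<sigma> \<rho>. encodes (pverts G) \<alpha> \<sigma> \<rho> \<phi> \<Longrightarrow>
      sat (guarded G) G \<sigma> \<rho> \<phi> \<longleftrightarrow> holds (parcs G) (pverts G) \<alpha> a"
  shows "determines TYPE('a) 0 \<phi>"
proof (rule determinesI)
  fix G G' :: "'a pair_pre_digraph" and \<alpha> \<alpha>' \<sigma> \<sigma>' \<rho> \<rho>'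
  assume enc: "encodes (pverts G) \<alpha> \<sigma> \<rho> \<phi>" "encodes (pverts G') \<alpha>' \<sigma>' \<rho>' \<phi>"
    and eq: "tp 0 (parcs G) (pverts G) \<alpha> = tp 0 (parcs G') (pverts G') \<alpha>'"
    and "sat (guarded G) G \<sigma> \<rho> \<phi>"
  then show "sat (guarded G') G' \<sigma>' \<rho>' \<phi>"
    unfolding iff[OF enc(1)] iff[OF enc(2)] tp_eq_holds[OF eq a] by simp
qed

lemma determines_exists: "vocabulary \<phi> \<subseteq> Mv \<Longrightarrow> \<exists>q. determines TYPE('a) q \<phi>"
proof (induction \<phi>)
  case (Equal x y)
  have "determines TYPE('a) 0 (Equal x y)"
    by (rule determines_atom[of "Meet (Elem x) (Elem y)"])
      (use Equal in \<open>auto simp: Atoms_def Voc_def encodes_def holds_def\<close>)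
  then show ?case ..
next
  case (Edge x y)
  have "determines TYPE('a) 0 (Edge x y)"
    by (rule determines_atom[of "Adj (Elem x) (Elem y)"])
      (use Edge in \<open>auto simp: Atoms_def Voc_def encodes_def holds_def\<close>)
  then show ?case ..
next
  case (Rel i xs)
  have "determines TYPE('a) 0 (Rel i xs)"
  proof (rule determines_atom[of "Tup (Relv i (length xs)) (map Elem xs)"])
    show "Tup (Relv i (length xs)) (map Elem xs) \<in> Atoms"
      using Rel unfolding Atoms_def Voc_def
      by (intro UnI2 UN_I[of "Relv i (length xs)"] imageI CollectI conjI) auto
  next
    fix G :: "'a pair_pre_digraph" and \<alpha> \<sigma> \<rho> assume enc: "encodes (pverts G) \<alpha> \<sigma> \<rho> (Rel i xs)"
    have "list_all2 (\<lambda>u X. [u] \<in> \<alpha> X) t (map Elem ys) \<longleftrightarrow> t = map \<sigma> ys" if "set ys \<subseteq> set xs" for t ys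
      using that
    proof (induction ys arbitrary: t)
      case (Cons y ys)
      then show ?case using enc by (cases t) (auto simp: encodes_def)
    qed simp
    then show "sat (guarded G) G \<sigma> \<rho> (Rel i xs) \<longleftrightarrow>
        holds (parcs G) (pverts G) \<alpha> (Tup (Relv i (length xs)) (map Elem xs))"
      using enc by (auto simp: holds_def encodes_def)
  qed
  then show ?case ..
next
  case (Neg \<phi>)
  then obtain q where q: "determines TYPE('a) q \<phi>" by auto
  have "determines TYPE('a) q (Neg \<phi>)"
  proof (rule determinesI)
    fix G G' :: "'a pair_pre_digraph" and \<alpha> \<alpha>' \<sigma> \<sigma>' \<rho> \<rho>'
    assume A: "undirected_graph G" "undirected_graph G'"
      "encodes (pverts G) \<alpha> \<sigma> \<rho> (Neg \<phi>)" "encodes (pverts G') \<alpha>' \<sigma>' \<rho>' (Neg \<phi>)"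
      "tp q (parcs G) (pverts G) \<alpha> = tp q (parcs G') (pverts G') \<alpha>'" "sat (guarded G) G \<sigma> \<rho> (Neg \<phi>)"
    then show "sat (guarded G') G' \<sigma>' \<rho>' (Neg \<phi>)"
      using determinesD[OF q A(2,1), of \<alpha>' \<sigma>' \<rho>' \<alpha> \<sigma> \<rho>] by (auto simp: encodes_def)
  qed
  then show ?case ..
next
  case (Conj \<phi> \<psi>)
  then obtain q1 q2 where "determines TYPE('a) q1 \<phi>" "determines TYPE('a) q2 \<psi>" by auto
  then have q: "determines TYPE('a) (max q1 q2) \<phi>" "determines TYPE('a) (max q1 q2) \<psi>"
    by (auto intro: determines_mono)
  have "determines TYPE('a) (max q1 q2) (Conj \<phi> \<psi>)"
  proof (rule determinesI)
    fix G G' :: "'a pair_pre_digraph" and \<alpha> \<alpha>' \<sigma> \<sigma>' \<rho> \<rho>'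
    assume A: "undirected_graph G" "undirected_graph G'"
      "encodes (pverts G) \<alpha> \<sigma> \<rho> (Conj \<phi> \<psi>)" "encodes (pverts G') \<alpha>' \<sigma>' \<rho>' (Conj \<phi> \<psi>)"
      "tp (max q1 q2) (parcs G) (pverts G) \<alpha> = tp (max q1 q2) (parcs G') (pverts G') \<alpha>'"
      "sat (guarded G) G \<sigma> \<rho> (Conj \<phi> \<psi>)"
    then show "sat (guarded G') G' \<sigma>' \<rho>' (Conj \<phi> \<psi>)"
      using determinesD[OF q(1) A(1,2) _ _ A(5), of \<sigma> \<rho> \<sigma>' \<rho>']
        determinesD[OF q(2) A(1,2) _ _ A(5), of \<sigma> \<rho> \<sigma>' \<rho>']
      by (auto simp: encodes_def)
  qed
  then show ?case ..
next
  case (Ex x \<phi>)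
  then obtain q where q: "determines TYPE('a) q \<phi>" by auto
  have X: "Elem x \<in> Mv" using Ex.prems by simp
  \<comment> \<open>One rank pays for the move that chooses the value of \<open>x\<close>, the other
    for the test that the answer is a singleton and so denotes a vertex.\<close>
  have "determines TYPE('a) (Suc (Suc q)) (Ex x \<phi>)"
  proof (rule determinesI)
    fix G G' :: "'a pair_pre_digraph" and \<alpha> \<alpha>' \<sigma> \<sigma>' \<rho> \<rho>'
    assume G: "undirected_graph G" "undirected_graph G'"
      and enc: "encodes (pverts G) \<alpha> \<sigma> \<rho> (Ex x \<phi>)" "encodes (pverts G') \<alpha>' \<sigma>' \<rho>' (Ex x \<phi>)"
      and eq: "tp (Suc (Suc q)) (parcs G) (pverts G) \<alpha> = tp (Suc (Suc q)) (parcs G') (pverts G') \<alpha>'"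
      and "sat (guarded G) G \<sigma> \<rho> (Ex x \<phi>)"
    then obtain v where v: "v \<in> pverts G" "sat (guarded G) G (\<sigma>(x := v)) \<rho> \<phi>" by auto
    have "{[v]} \<subseteq> locals (parcs G) (Elem x) (pverts G)"
      using v(1) by (auto simp: locals_def clique_tuple_def)
    from tp_Suc_moveD[OF eq X this]
    obtain R' where R': "R' \<subseteq> locals (parcs G') (Elem x) (pverts G')"
      "tp (Suc q) (parcs G) (pverts G) (\<alpha>(Elem x := {[v]})) =
       tp (Suc q) (parcs G') (pverts G') (\<alpha>'(Elem x := R'))"
      .
    obtain v' where v': "v' \<in> pverts G'" "R' = {[v']}"
      using singleton_transfer[OF R'(2) X, of v] v(1) R'(1) by auto
    have "sat (guarded G') G' (\<sigma>'(x := v')) \<rho>' \<phi>"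
      by (rule determinesD[OF q G encodes_Ex[OF enc(1) v(1)] encodes_Ex[OF enc(2) v'(1)]
            tp_Suc_eqD[OF R'(2)[unfolded v'(2)]] v(2)])
    then show "sat (guarded G') G' \<sigma>' \<rho>' (Ex x \<phi>)" using v'(1) by auto
  qed
  then show ?case ..
next
  case (ExRel i r \<phi>)
  then obtain q where q: "determines TYPE('a) q \<phi>" by auto
  have X: "Relv i r \<in> Mv" using ExRel.prems by simp
  have "determines TYPE('a) (Suc q) (ExRel i r \<phi>)"
  proof (rule determinesI)
    fix G G' :: "'a pair_pre_digraph" and \<alpha> \<alpha>' \<sigma> \<sigma>' \<rho> \<rho>'
    assume G: "undirected_graph G" "undirected_graph G'"
      and enc: "encodes (pverts G) \<alpha> \<sigma> \<rho> (ExRel i r \<phi>)" "encodes (pverts G') \<alpha>' \<sigma>' \<rho>' (ExRel i r \<phi>)"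
      and eq: "tp (Suc q) (parcs G) (pverts G) \<alpha> = tp (Suc q) (parcs G') (pverts G') \<alpha>'"
      and "sat (guarded G) G \<sigma> \<rho> (ExRel i r \<phi>)"
    then obtain R where R: "R \<subseteq> locals (parcs G) (Relv i r) (pverts G)"
      "sat (guarded G) G \<sigma> (\<rho>((i, r) := R)) \<phi>" using guarded_iff_locals[OF G(1)] by auto
    from tp_Suc_moveD[OF eq X R(1)]
    obtain R' where R': "R' \<subseteq> locals (parcs G') (Relv i r) (pverts G')"
      "tp q (parcs G) (pverts G) (\<alpha>(Relv i r := R)) =
       tp q (parcs G') (pverts G') (\<alpha>'(Relv i r := R'))"
      .
    have "sat (guarded G') G' \<sigma>' (\<rho>'((i, r) := R')) \<phi>"
      by (rule determinesD[OF q G encodes_ExRel[OF enc(1)] encodes_ExRel[OF enc(2)] R'(2) R(2)])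
    then show "sat (guarded G') G' \<sigma>' \<rho>' (ExRel i r \<phi>)"
      using R'(1) guarded_iff_locals[OF G(2)] by auto
  qed
  then show ?case ..
qed

section \<open>Types of components\<close>

text \<open>The start of a game: the deleted vertices are named and all movable variables are
  empty.\<close>

definition param_relations :: "'a list \<Rightarrow> rvar \<Rightarrow> 'a list set" where
  "param_relations as X = (case X of Param i \<Rightarrow> if i < length as then {[as ! i]} else {} | _ \<Rightarrow> {})"

lemma params_param_relations: "params (param_relations as) as"
  by (simp add: params_def param_relations_def)

lemma valid_param_relations: "valid E (param_relations as)"
  by (auto simp: valid_def locals_def clique_tuple_def param_relations_def split: rvar.splits if_splits)

lemma param_relations_snoc:
  "(param_relations (as @ [w]))(Param (length as) := {}) = param_relations as"
  by (rule ext) (auto simp: param_relations_def nth_append split: rvar.splits)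

text \<open>Equalities and edges among the entries make the map from \<open>as ! i\<close> to
  \<open>as' ! i\<close> an isomorphism. This is the type of an empty piece.\<close>

lemma tp_params_only:
  fixes E E' :: "('a \<times> 'a) set"
  assumes len: "length as = length as'"
    and eq: "\<And>i j. i < length as \<Longrightarrow> j < length as \<Longrightarrow> as ! i = as ! j \<longleftrightarrow> as' ! i = as' ! j"
    and ed: "\<And>i j. i < length as \<Longrightarrow> j < length as \<Longrightarrow> (as ! i, as ! j) \<in> E \<longleftrightarrow> (as' ! i, as' ! j) \<in> E'"
  shows "tp q E (set as) (param_relations as) = tp q E' (set as') (param_relations as')"
proof -
  have "\<forall>u\<in>set as. \<exists>i<length as. as ! i = u" by (simp add: in_set_conv_nth)
  then obtain g where g: "\<And>u. u \<in> set as \<Longrightarrow> g u < length as \<and> as ! g u = u" by metis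
  define h where "h u = as' ! g u" for u
  have h: "h (as ! i) = as' ! i" if "i < length as" for i
    using g[of "as ! i"] eq[of "g (as ! i)" i] that by (simp add: h_def)
  have inj: "inj_on h (set as)"
    by (rule inj_onI) (metis eq g h)
  show ?thesis
  proof (rule tp_isomorphic[of h])
    show "inj_on h (set as)" by (rule inj)
    show "set as' = h ` set as"
    proof -
      have "as' = map h as" by (rule nth_equalityI) (use len h in auto)
      then show ?thesis by simp
    qed
    show "(u, v) \<in> E \<longleftrightarrow> (h u, h v) \<in> E'" if "u \<in> set as" "v \<in> set as" for u v
      using that ed h by (auto simp: in_set_conv_nth)
    fix X t assume t: "set t \<subseteq> set as"
    show "t \<in> param_relations as X \<longleftrightarrow> map h t \<in> param_relations as' X"
    proof (cases "\<exists>i. X = Param i \<and> i < length as")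
      case True
      then obtain i where i: "X = Param i" "i < length as" by blast
      have "map h t = [h (as ! i)] \<longleftrightarrow> t = [as ! i]"
        using inj t i(2) by (auto simp: map_eq_Cons_conv inj_on_eq_iff)
      then show ?thesis using i len h[OF i(2)] by (simp add: param_relations_def)
    next
      case False
      then show ?thesis using len by (auto simp: param_relations_def split: rvar.splits)
    qed
  qed
qed

end

lemma eqcount_insert:
  assumes "eqcount t S S'" "x \<notin> S" "y \<notin> S'"
  shows "eqcount t (insert x S) (insert y S')"
proof -
  have "at_least n (insert z A) \<longleftrightarrow> at_least (n - 1) A" if "z \<notin> A" for n z and A :: "'c set"
    using that by (auto simp: at_least_def)
  then show ?thesis using assms unfolding eqcount_def by (meson diff_le_self order_trans)
qed

context type_vocabulary begin

text \<open>The components inside \<open>U\<close>, together with an empty piece, are pieces over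
  the parameters. The empty piece keeps the family non-empty even if \<open>U\<close> is empty; by
  \<open>core\<close> its type is the same on both sides, so it changes both counts alike.\<close>

lemma tp_from_components:
  fixes E E' :: "('a \<times> 'a) set"
  assumes am: "amalgamable TYPE('a) q t" and sym: "sym E" "sym E'"
    and len: "length as = length as'" "length as \<le> d"
    and U: "U \<subseteq> V - set as" "\<And>u. u \<in> U \<Longrightarrow> component E (V - set as) u \<subseteq> U"
    and U': "U' \<subseteq> V' - set as'" "\<And>u. u \<in> U' \<Longrightarrow> component E' (V' - set as') u \<subseteq> U'"
    and core: "\<And>i j. i < length as \<Longrightarrow> j < length as \<Longrightarrow>
      (as ! i = as ! j \<longleftrightarrow> as' ! i = as' ! j) \<and> ((as ! i, as ! j) \<in> E \<longleftrightarrow> (as' ! i, as' ! j) \<in> E')"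
    and cnt: "\<And>c. eqcount t
      (component E (V - set as) ` {u \<in> U. tp q E (component E (V - set as) u \<union> set as) (param_relations as) = c})
      (component E' (V' - set as') ` {u \<in> U'. tp q E' (component E' (V' - set as') u \<union> set as') (param_relations as') = c})"
  shows "tp q E (U \<union> set as) (param_relations as) = tp q E' (U' \<union> set as') (param_relations as')"
proof -
  have ne: "component E W u \<noteq> {}" for E :: "('a \<times> 'a) set" and W u
    using component_self[of u E W] by blast
  have Un: "\<Union>(insert {} (component E (V - A) ` U)) = U"
    if "\<And>u. u \<in> U \<Longrightarrow> component E (V - A) u \<subseteq> U" for E :: "('a \<times> 'a) set" and V A U
  proof
    show "\<Union>(insert {} (component E (V - A) ` U)) \<subseteq> U" using that by auto
    show "U \<subseteq> \<Union>(insert {} (component E (V - A) ` U))" using component_self by auto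
  qed
  have pc: "pieces E A (insert {} (component E (V - A) ` U))"
    if "sym E" "U \<subseteq> V - A" for E :: "('a \<times> 'a) set" and V A U
    unfolding pieces_def
  proof (intro conjI ballI impI)
    fix C D assume C: "C \<in> insert {} (component E (V - A) ` U)"
      and D: "D \<in> insert {} (component E (V - A) ` U)" and CD: "C \<noteq> D"
    show dis: "C \<inter> D = {}" using C D CD component_disjoint[OF that(1)] by blast
    fix u v assume uv: "u \<in> C" "v \<in> D"
    from uv(1) C obtain a where a: "a \<in> U" "C = component E (V - A) a" by auto
    from uv(2) D obtain b where b: "b \<in> U" "D = component E (V - A) b" by auto
    have "u \<in> V - A" "v \<in> V - A"
      using component_in[of u E "V - A" a] component_in[of v E "V - A" b] uv a b that(2) by blast+
    then have "v \<in> C" if "(u, v) \<in> E" using component_step[OF uv(1)[unfolded a(2)] that] a(2) by blast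
    then show "(u, v) \<notin> E" using dis uv(2) by blast
  next
    fix C assume "C \<in> insert {} (component E (V - A) ` U)"
    then show "C \<inter> A = {}" using component_subset[of _ "V - A" E] that(2) by blast
  qed simp
  let ?J = "insert {} (component E (V - set as) ` U)" and ?J' = "insert {} (component E' (V' - set as') ` U')"
  have "tp q E (\<Union>?J \<union> set as) (param_relations as) = tp q E' (\<Union>?J' \<union> set as') (param_relations as')"
  proof (rule amalgamableD[OF am sym len pc[OF sym(1) U(1)] pc[OF sym(2) U'(1)]
        params_param_relations params_param_relations valid_param_relations valid_param_relations])
    fix c
    define S where "S = component E (V - set as) ` {u \<in> U. tp q E (component E (V - set as) u \<union> set as) (param_relations as) = c}"
    define S' where "S' = component E' (V' - set as') ` {u \<in> U'. tp q E' (component E' (V' - set as') u \<union> set as') (param_relations as') = c}"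
    have S: "{C \<in> ?J. tp q E (C \<union> set as) (param_relations as) = c} =
        (if tp q E (set as) (param_relations as) = c then insert {} S else S)"
      unfolding S_def by auto
    have S': "{C \<in> ?J'. tp q E' (C \<union> set as') (param_relations as') = c} =
        (if tp q E' (set as') (param_relations as') = c then insert {} S' else S')"
      unfolding S'_def by auto
    have "tp q E (set as) (param_relations as) = tp q E' (set as') (param_relations as')"
      by (rule tp_params_only) (use len core in auto)
    moreover have "{} \<notin> S" "{} \<notin> S'" unfolding S_def S'_def using ne by auto
    moreover have "eqcount t S S'" unfolding S_def S'_def by (rule cnt)
    ultimately show "eqcount t {C \<in> ?J. tp q E (C \<union> set as) (param_relations as) = c}
        {C \<in> ?J'. tp q E' (C \<union> set as') (param_relations as') = c}"
      unfolding S S' using eqcount_insert by auto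
  qed
  moreover have "\<Union>?J = U" "\<Union>?J' = U'"
    by (rule Un, rule U(2), assumption) (rule Un, rule U'(2), assumption)
  ultimately show ?thesis by (simp only:)
qed

end

section \<open>Defining component types in first-order logic\<close>

text \<open>One bound \<open>4 ^ d\<close> serves all subsets \<open>U\<close> of \<open>V\<close>,
  hence all choices of deleted vertices. For \<open>v\<close> outside \<open>U\<close> both sides
  mean \<open>u = v\<close>.\<close>

lemma component_iff_walk_within:
  assumes "sym E" "elim_depth E d V" "U \<subseteq> V"
  shows "u \<in> component E U v \<longleftrightarrow> walk_within E U (4 ^ d) v u"
proof
  assume u: "u \<in> component E U v"
  show "walk_within E U (4 ^ d) v u"
  proof (cases "v \<in> U")
    case True
    then show ?thesis using walk_within_bound[OF assms(1) elim_depth_mono[OF assms(2,3)] _ u] by blast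
  next
    case False
    have "component E U v \<subseteq> {v}" by (rule component_least) (use False in auto)
    with u have "walk_within E U 0 v u" by auto
    then show ?thesis by (rule walk_within_mono) auto
  qed
qed (rule walk_within_component)

lemma map_nth_upt: "k \<le> length as \<Longrightarrow> map (nth as) [0..<k] = take k as"
  by (rule nth_equalityI) auto

lemma map_nth_append: "set ns \<subseteq> {..<length as} \<Longrightarrow> map (nth (as @ us)) ns = map (nth as) ns"
  by (auto simp: nth_append)

lemma definable_nth_notin:
  assumes "i < n" "k \<le> n"
  shows "definable K n (\<lambda>G as. as ! i \<notin> set (take k as))"
proof -
  have "definable K n (\<lambda>G as. \<forall>j\<in>{..<k}. \<not> as ! j = as ! i)"
    using assms by (intro definable_Ball definable_Not definable_eq) auto
  then show ?thesis
    by (rule definable_cong) (use assms in \<open>auto simp: tuples_def in_set_conv_nth\<close>)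
qed

lemma definable_unary_subst:
  assumes "definable K (Suc k) (\<lambda>G as. T G (butlast as) (last as))" "length ns = k"
    "set ns \<subseteq> {..<m}" "i < m"
  shows "definable K m (\<lambda>G as. T G (map (nth as) ns) (as ! i))"
  using definable_subst[OF assms(1), of "ns @ [i]" m] assms(2-4) by simp

locale bounded_elim_class =
  fixes d :: nat and K :: "'a pair_pre_digraph set"
  assumes undirected: "G \<in> K \<Longrightarrow> undirected_graph G"
    and elim_depth: "G \<in> K \<Longrightarrow> elim_depth (parcs G) d (pverts G)"
begin

section \<open>Defining reachability, component counts and depth\<close>

lemma definable_walk_within:
  "definable K (Suc (Suc k)) (\<lambda>G as. walk_within (parcs G) (pverts G - set (take k as)) n (as ! k) (as ! Suc k))"
proof (induction n)
  case 0
  show ?case by (simp add: definable_eq)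
next
  case (Suc n)
  let ?m = "Suc (Suc k)"
  \<comment> \<open>Entries \<open>k\<close> and \<open>Suc k\<close> are the ends of the walk. The
    last intermediate vertex is bound at level \<open>?m\<close>, so the shorter walk to it arises
    by substituting \<open>?m\<close> for \<open>Suc k\<close>.\<close>
  have "definable K (Suc ?m) (\<lambda>G as. walk_within (parcs G)
      (pverts G - set (take k (map (nth as) ([0..<k] @ [k, ?m])))) n
      (map (nth as) ([0..<k] @ [k, ?m]) ! k) (map (nth as) ([0..<k] @ [k, ?m]) ! Suc k))"
    by (rule definable_subst[OF Suc]) auto
  then have walk: "definable K (Suc ?m) (\<lambda>G as.
      walk_within (parcs G) (pverts G - set (take k as)) n (as ! k) (as ! ?m))"
    by (rule definable_cong) (auto simp: tuples_def nth_append map_nth_upt)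
  have "definable K ?m (\<lambda>G as. as ! k = as ! Suc k \<or> (\<exists>x\<in>pverts G.
      (walk_within (parcs G) (pverts G - set (take k (as @ [x]))) n ((as @ [x]) ! k) ((as @ [x]) ! ?m) \<and>
       (as @ [x]) ! ?m \<notin> set (take k (as @ [x]))) \<and>
      (as @ [x]) ! Suc k \<notin> set (take k (as @ [x])) \<and> ((as @ [x]) ! ?m, (as @ [x]) ! Suc k) \<in> parcs G))"
    by (intro definable_disj definable_Ex definable_conj definable_eq definable_edge
        definable_nth_notin walk) auto
  then show ?case
    by (rule definable_cong) (auto simp: tuples_def nth_append subset_iff)
qed

lemma definable_component:
  assumes "set ns \<subseteq> {..<m}" "i < m" "j < m"
  shows "definable K m (\<lambda>G as.
    as ! j \<in> component (parcs G) (pverts G - set (map (nth as) ns)) (as ! i))"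
proof -
  let ?k = "length ns"
  have "definable K m (\<lambda>G as. walk_within (parcs G)
      (pverts G - set (take ?k (map (nth as) (ns @ [i, j])))) (4 ^ d)
      (map (nth as) (ns @ [i, j]) ! ?k) (map (nth as) (ns @ [i, j]) ! Suc ?k))"
    by (rule definable_subst[OF definable_walk_within]) (use assms in auto)
  then show ?thesis
  proof (rule definable_cong)
    fix G as assume G: "G \<in> K"
    show "walk_within (parcs G)
        (pverts G - set (take ?k (map (nth as) (ns @ [i, j])))) (4 ^ d)
        (map (nth as) (ns @ [i, j]) ! ?k) (map (nth as) (ns @ [i, j]) ! Suc ?k) \<longleftrightarrow>
      as ! j \<in> component (parcs G) (pverts G - set (map (nth as) ns)) (as ! i)"
      by (subst component_iff_walk_within[OF undirected_graphD(1)[OF undirected[OF G]] elim_depth[OF G]])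
        (auto simp: nth_append)
  qed
qed

text \<open>At least \<open>n\<close> components means \<open>n\<close> representatives none of
  which lies in the component of another. \<open>D\<close> may depend on the whole tuple,
  \<open>T\<close> only on the deleted vertices selected by \<open>ns\<close>.\<close>

lemma definable_count_components:
  assumes D: "definable K (Suc m) (\<lambda>G as. D G (butlast as) (last as))"
    and T: "definable K (Suc (length ns)) (\<lambda>G as. T G (butlast as) (last as))"
    and ns: "set ns \<subseteq> {..<m}"
  shows "definable K m (\<lambda>G as. at_least n (component (parcs G) (pverts G - set (map (nth as) ns)) `
    {u \<in> pverts G. D G as u \<and> T G (map (nth as) ns) u}))"
proof -
  have "definable K (m + n) (\<lambda>G bs.
      (\<forall>i\<in>{..<n}. D G (map (nth bs) [0..<m]) (bs ! (m + i)) \<and> T G (map (nth bs) ns) (bs ! (m + i))) \<and>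
      (\<forall>i\<in>{..<n}. \<forall>j\<in>{..<n} - {i}. \<not> bs ! (m + j) \<in> component (parcs G)
         (pverts G - set (map (nth bs) ns)) (bs ! (m + i))))"
    using ns by (intro definable_conj definable_Ball definable_Not definable_component
        definable_unary_subst[OF D] definable_unary_subst[OF T]) auto
  from definable_Ex_tuple[OF this] show ?thesis
  proof (rule definable_cong)
    fix G as assume G: "G \<in> K" and as: "as \<in> tuples m (pverts G)"
    let ?cp = "component (parcs G) (pverts G - set (map (nth as) ns))"
    let ?X = "{u \<in> pverts G. D G as u \<and> T G (map (nth as) ns) u}"
    have len: "length as = m" using as by (simp add: tuples_def)
    have s: "map (nth (as @ us)) ns = map (nth as) ns" "map (nth (as @ us)) [0..<m] = as"
      "(as @ us) ! (m + i) = us ! i" for us i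
      using map_nth_append[of ns as us] ns unfolding len[symmetric] by (simp_all add: map_nth_upt)
    have ne: "v \<notin> ?cp u \<longleftrightarrow> ?cp u \<noteq> ?cp v" for u v
      using component_eq[OF undirected_graphD(1)[OF undirected[OF G]], of v _ u] component_self by metis
    have "((\<forall>i\<in>{..<n}. D G as (us ! i) \<and> T G (map (nth as) ns) (us ! i)) \<and>
        (\<forall>i\<in>{..<n}. \<forall>j\<in>{..<n} - {i}. us ! j \<notin> ?cp (us ! i))) \<longleftrightarrow>
      set us \<subseteq> ?X \<and> distinct (map ?cp us)" if us: "us \<in> tuples n (pverts G)" for us
      using us unfolding ne distinct_conv_nth
      by (auto simp: tuples_def subset_iff in_set_conv_nth)
    then show "(\<exists>us\<in>tuples n (pverts G).
        (\<forall>i\<in>{..<n}. D G (map (nth (as @ us)) [0..<m]) ((as @ us) ! (m + i)) \<and>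
          T G (map (nth (as @ us)) ns) ((as @ us) ! (m + i))) \<and>
        (\<forall>i\<in>{..<n}. \<forall>j\<in>{..<n} - {i}. \<not> (as @ us) ! (m + j) \<in> component (parcs G)
          (pverts G - set (map (nth (as @ us)) ns)) ((as @ us) ! (m + i)))) \<longleftrightarrow>
      at_least n (?cp ` ?X)"
      unfolding s at_least_image_iff by (auto simp: tuples_def)
  qed
qed

definition good :: "nat \<Rightarrow> 'a pair_pre_digraph \<Rightarrow> 'a list \<Rightarrow> 'a \<Rightarrow> bool" where
  "good e G bs v \<longleftrightarrow> v \<notin> set bs \<and> elim_depth (parcs G) e (component (parcs G) (pverts G - set bs) v)"

lemma component_remove:
  assumes "v \<in> V - set bs" "u \<in> component E (V - set bs) v - {w}"
  shows "component E (component E (V - set bs) v - {w}) u = component E (V - set (bs @ [w])) u"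
proof -
  have "V - set bs - {w} = V - set (bs @ [w])" by auto
  then show ?thesis using component_component_diff[OF assms] by simp
qed

text \<open>By \<open>component_remove\<close>, what is left of one component without
  \<open>w\<close> splits into components of the whole graph without \<open>bs @ [w]\<close>. So the
  condition turns into one on single vertices and a longer list of deleted vertices.\<close>

lemma elim_depth_remove_iff:
  assumes "G \<in> K" "v \<in> pverts G - set bs"
  shows "elim_depth (parcs G) e (component (parcs G) (pverts G - set bs) v - {w}) \<longleftrightarrow>
    (\<forall>u\<in>pverts G. u \<in> component (parcs G) (pverts G - set bs) v \<and> u \<noteq> w \<longrightarrow> good e G (bs @ [w]) u)"
proof -
  let ?C = "component (parcs G) (pverts G - set bs) v"
  have sub: "?C \<subseteq> pverts G - set bs" by (rule component_subset) fact
  have "elim_depth (parcs G) e (?C - {w}) \<longleftrightarrow> (\<forall>u\<in>?C - {w}. elim_depth (parcs G) e (component (parcs G) (?C - {w}) u))"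
    by (rule elim_depth_components) (rule undirected_graphD(1)[OF undirected[OF assms(1)]])
  also have "\<dots> \<longleftrightarrow> (\<forall>u\<in>?C - {w}. good e G (bs @ [w]) u)"
  proof (rule ball_cong[OF refl])
    fix u assume u: "u \<in> ?C - {w}"
    with sub have "u \<notin> set (bs @ [w])" by auto
    then show "elim_depth (parcs G) e (component (parcs G) (?C - {w}) u) \<longleftrightarrow> good e G (bs @ [w]) u"
      unfolding good_def component_remove[OF assms(2) u] by blast
  qed
  also have "\<dots> \<longleftrightarrow> (\<forall>u\<in>pverts G. u \<in> ?C \<and> u \<noteq> w \<longrightarrow> good e G (bs @ [w]) u)" using sub by blast
  finally show ?thesis .
qed

text \<open>The component of \<open>v\<close> is connected, so the condition that
  \<open>elim_depth\<close> puts on each of its vertices is always the same one, and a single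
  existential quantifier remains.\<close>

lemma good_Suc_iff:
  assumes "G \<in> K" "v \<in> pverts G"
  shows "good (Suc e) G bs v \<longleftrightarrow> v \<notin> set bs \<and>
    (\<exists>w\<in>pverts G. w \<in> component (parcs G) (pverts G - set bs) v \<and>
      elim_depth (parcs G) e (component (parcs G) (pverts G - set bs) v - {w}))"
proof (cases "v \<in> set bs")
  case False
  let ?C = "component (parcs G) (pverts G - set bs) v"
  have v: "v \<in> pverts G - set bs" using assms(2) False by simp
  have "?C \<noteq> {}" using component_self by (metis empty_iff)
  have "component (parcs G) ?C u = ?C" if "u \<in> ?C" for u
    using component_component[OF v that] component_eq[OF undirected_graphD(1)[OF undirected[OF assms(1)]] that]
    by simp
  then have "elim_depth (parcs G) (Suc e) ?C \<longleftrightarrow> (\<exists>w\<in>?C. elim_depth (parcs G) e (?C - {w}))"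
    using \<open>?C \<noteq> {}\<close> by auto
  then show ?thesis using False component_subset[OF v, of "parcs G"] unfolding good_def by blast
qed (simp add: good_def)

lemma not_good_0: "\<not> good 0 G bs v"
  unfolding good_def by (metis component_self elim_depth.simps(1) empty_iff)

lemma definable_remove_good:
  assumes "definable K (Suc (Suc k)) (\<lambda>G as. good e G (butlast as) (last as))"
  shows "definable K (Suc (Suc k)) (\<lambda>G as. as ! k \<notin> set (take k as) \<and>
    as ! Suc k \<in> component (parcs G) (pverts G - set (take k as)) (as ! k) \<and>
    elim_depth (parcs G) e (component (parcs G) (pverts G - set (take k as)) (as ! k) - {as ! Suc k}))"
proof -
  let ?ns = "[0..<k]" and ?m = "Suc (Suc k)"
  have "definable K (Suc (Suc k)) (\<lambda>G as. as ! k \<notin> set (take k as) \<and>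
    as ! Suc k \<in> component (parcs G) (pverts G - set (map (nth as) ?ns)) (as ! k) \<and>
    (\<forall>u\<in>pverts G. ((as @ [u]) ! ?m \<in> component (parcs G) (pverts G - set (map (nth (as @ [u])) ?ns)) ((as @ [u]) ! k)
       \<and> \<not> (as @ [u]) ! ?m = (as @ [u]) ! Suc k) \<longrightarrow>
      good e G (map (nth (as @ [u])) (?ns @ [Suc k])) ((as @ [u]) ! ?m)))"
    by (intro definable_conj definable_nth_notin definable_component definable_All definable_imp
        definable_Not definable_eq definable_unary_subst[OF assms]) auto
  then show ?thesis
  proof (rule definable_cong)
    fix G as assume G: "G \<in> K" and as: "as \<in> tuples (Suc (Suc k)) (pverts G)"
    have len: "length as = Suc (Suc k)" "as ! k \<in> pverts G" using as by (auto simp: tuples_def)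
    have s: "map (nth as) ?ns = take k as" "map (nth (as @ [u])) ?ns = take k as"
      "(as @ [u]) ! ?m = u" "(as @ [u]) ! k = as ! k" "(as @ [u]) ! Suc k = as ! Suc k"
      "map (nth (as @ [u])) (?ns @ [Suc k]) = take k as @ [as ! Suc k]" for u
      using len(1) by (simp_all add: map_nth_upt nth_append)
    show "(as ! k \<notin> set (take k as) \<and>
      as ! Suc k \<in> component (parcs G) (pverts G - set (map (nth as) ?ns)) (as ! k) \<and>
      (\<forall>u\<in>pverts G. ((as @ [u]) ! ?m \<in> component (parcs G) (pverts G - set (map (nth (as @ [u])) ?ns)) ((as @ [u]) ! k)
         \<and> \<not> (as @ [u]) ! ?m = (as @ [u]) ! Suc k) \<longrightarrow>
        good e G (map (nth (as @ [u])) (?ns @ [Suc k])) ((as @ [u]) ! ?m))) \<longleftrightarrow>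
      (as ! k \<notin> set (take k as) \<and>
       as ! Suc k \<in> component (parcs G) (pverts G - set (take k as)) (as ! k) \<and>
       elim_depth (parcs G) e (component (parcs G) (pverts G - set (take k as)) (as ! k) - {as ! Suc k}))"
      unfolding s using elim_depth_remove_iff[OF G, of "as ! k" "take k as"] len(2) by blast
  qed
qed

lemma butlast_last_as_take: "length as = Suc k \<Longrightarrow> butlast as = take k as \<and> last as = as ! k"
  by (cases as rule: rev_cases) (auto simp: nth_append)

lemma definable_good: "definable K (Suc k) (\<lambda>G as. good e G (butlast as) (last as))"
proof (induction e arbitrary: k)
  case 0
  show ?case by (simp add: not_good_0 definable_False)
next
  case (Suc e)
  from definable_Ex[OF definable_remove_good[OF Suc]] show ?case
  proof (rule definable_cong)
    fix G as assume G: "G \<in> K" and as: "as \<in> tuples (Suc k) (pverts G)"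
    then have len: "length as = Suc k" "as ! k \<in> pverts G" by (auto simp: tuples_def)
    then show "(\<exists>w\<in>pverts G. (as @ [w]) ! k \<notin> set (take k (as @ [w])) \<and>
        (as @ [w]) ! Suc k \<in> component (parcs G) (pverts G - set (take k (as @ [w]))) ((as @ [w]) ! k) \<and>
        elim_depth (parcs G) e (component (parcs G) (pverts G - set (take k (as @ [w]))) ((as @ [w]) ! k) -
          {(as @ [w]) ! Suc k})) \<longleftrightarrow> good (Suc e) G (butlast as) (last as)"
      using butlast_last_as_take[OF len(1)] good_Suc_iff[OF G len(2), of e "take k as"]
      by (auto simp: nth_append)
  qed
qed

end

section \<open>Definability of component types and of the types of whole graphs\<close>

locale bounded_elim_types = type_vocabulary d Mv + bounded_elim_class d K
  for d Mv and K :: "'a pair_pre_digraph set"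
begin

definition component_type :: "nat \<Rightarrow> nat \<Rightarrow> nat \<Rightarrow> 'a pair_pre_digraph \<Rightarrow> 'a list \<Rightarrow> 'a \<Rightarrow> bool" where
  "component_type q e c G bs v \<longleftrightarrow> good e G bs v \<and>
     tp q (parcs G) (component (parcs G) (pverts G - set bs) v \<union> set bs) (param_relations bs) = c"

text \<open>No type is \<open>M\<close> or larger, so the counts required for the composition, one
  for each number \<open>c\<close>, reduce to finitely many.\<close>

lemma eqcount_component_types:
  assumes M: "\<And>E W \<rho>. tp q (E :: ('a \<times> 'a) set) W \<rho> < M"
    and U: "U \<subseteq> pverts G" "\<And>u. u \<in> U \<Longrightarrow> good e G bs u"
    and U': "U' \<subseteq> pverts G'" "\<And>u. u \<in> U' \<Longrightarrow> good e G' bs' u"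
    and cnt: "\<And>n c. n \<le> t \<Longrightarrow> c < M \<Longrightarrow>
      at_least n (component (parcs G) (pverts G - set bs) ` {u \<in> pverts G. u \<in> U \<and> component_type q e c G bs u}) \<longleftrightarrow>
      at_least n (component (parcs G') (pverts G' - set bs') ` {u \<in> pverts G'. u \<in> U' \<and> component_type q e c G' bs' u})"
  shows "eqcount t
    (component (parcs G) (pverts G - set bs) ` {u \<in> U. tp q (parcs G)
      (component (parcs G) (pverts G - set bs) u \<union> set bs) (param_relations bs) = c})
    (component (parcs G') (pverts G' - set bs') ` {u \<in> U'. tp q (parcs G')
      (component (parcs G') (pverts G' - set bs') u \<union> set bs') (param_relations bs') = c})"
proof (cases "c < M")
  case True
  have "{u \<in> U. tp q (parcs G) (component (parcs G) (pverts G - set bs) u \<union> set bs) (param_relations bs) = c} =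
      {u \<in> pverts G. u \<in> U \<and> component_type q e c G bs u}"
    using U by (auto simp: component_type_def)
  moreover have "{u \<in> U'. tp q (parcs G') (component (parcs G') (pverts G' - set bs') u \<union> set bs') (param_relations bs') = c} =
      {u \<in> pverts G'. u \<in> U' \<and> component_type q e c G' bs' u}"
    using U' by (auto simp: component_type_def)
  ultimately show ?thesis using cnt[OF _ True] unfolding eqcount_def by simp
next
  case False
  then have "tp q E W \<rho> \<noteq> c" for E :: "('a \<times> 'a) set" and W \<rho> using M by metis
  then show ?thesis by (simp add: eqcount_def)
qed

text \<open>Induction on the remaining depth \<open>e\<close> while the number \<open>k\<close> of
  deleted vertices grows; \<open>k + e \<le> d\<close> keeps their names within the vocabulary. The
  rank \<open>q\<close> is the same at every level. For a fixed vertex \<open>w\<close> to delete,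
  the claim is determined by whether \<open>w\<close> is admissible, by the equalities and edges
  among the entries of the tuple, and by the truncated counts of the types of the components that
  remain.\<close>

lemma definable_component_type:
  "k + e \<le> d \<Longrightarrow> definable K (Suc k) (\<lambda>G as. component_type q e c G (butlast as) (last as))"
proof (induction e arbitrary: k c)
  case 0
  show ?case by (simp add: component_type_def not_good_0 definable_False)
next
  case (Suc e)
  let ?m = "Suc (Suc k)"
  obtain t where t: "1 \<le> t" "amalgamable TYPE('a) q t" using amalgamable by blast
  obtain M where M: "\<And>E W \<rho>. tp q (E :: ('a \<times> 'a) set) W \<rho> < M" using tp_bounded by blast
  define C where "C G as = component (parcs G) (pverts G - set (take k as)) (as ! k)"
    for G :: "'a pair_pre_digraph" and as
  \<comment> \<open>The list of deleted vertices one level deeper. Entry \<open>k\<close> is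
    skipped: it is the vertex whose component is described, while entry \<open>Suc k\<close> is the
    next vertex to delete.\<close>
  define bs where "bs as = take k as @ [as ! Suc k]" for as :: "'a list"
  define B0 where "B0 G as \<longleftrightarrow> as ! k \<notin> set (take k as) \<and> as ! Suc k \<in> C G as \<and>
    elim_depth (parcs G) e (C G as - {as ! Suc k})" for G :: "'a pair_pre_digraph" and as
  define Beq where "Beq i j G as \<longleftrightarrow> as ! i = as ! j" for i j and G :: "'a pair_pre_digraph" and as :: "'a list"
  define Bed where "Bed i j G as \<longleftrightarrow> (as ! i, as ! j) \<in> parcs G" for i j and G :: "'a pair_pre_digraph" and as
  define Bcnt where "Bcnt n c G as \<longleftrightarrow> at_least n (component (parcs G) (pverts G - set (bs as)) `
    {u \<in> pverts G. u \<in> C G as - {as ! Suc k} \<and> component_type q e c G (bs as) u})"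
    for n c and G :: "'a pair_pre_digraph" and as
  define Bs where "Bs = insert B0 ((\<lambda>(i, j). Beq i j) ` ({..<?m} \<times> {..<?m}) \<union>
    (\<lambda>(i, j). Bed i j) ` ({..<?m} \<times> {..<?m}) \<union> (\<lambda>(n, c). Bcnt n c) ` ({..t} \<times> {..<M}))"
  have B0: "definable K ?m B0"
    using definable_remove_good[OF definable_good, of k e] unfolding B0_def C_def .
  have Bcnt: "definable K ?m (Bcnt n c)" for n c
  proof -
    have D: "definable K (Suc ?m) (\<lambda>G as. last as \<in> C G (butlast as) - {butlast as ! Suc k})"
    proof -
      have "definable K (Suc ?m) (\<lambda>G as. as ! ?m \<in> component (parcs G) (pverts G - set (map (nth as) [0..<k])) (as ! k) \<and>
          \<not> as ! ?m = as ! Suc k)"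
        by (intro definable_conj definable_component definable_Not definable_eq) auto
      then show ?thesis
      proof (rule definable_cong)
        fix G :: "'a pair_pre_digraph" and as assume "as \<in> tuples (Suc ?m) (pverts G)"
        then have len: "length as = Suc ?m" by (simp add: tuples_def)
        then show "(as ! ?m \<in> component (parcs G) (pverts G - set (map (nth as) [0..<k])) (as ! k) \<and>
          \<not> as ! ?m = as ! Suc k) \<longleftrightarrow> last as \<in> C G (butlast as) - {butlast as ! Suc k}"
          using butlast_last_as_take[OF len] by (simp add: C_def map_nth_upt)
      qed
    qed
    have T: "definable K (Suc (length ([0..<k] @ [Suc k]))) (\<lambda>G as. component_type q e c G (butlast as) (last as))"
      using Suc.IH[of "Suc k"] Suc.prems by simp
    have "definable K ?m (\<lambda>G as. at_least n (component (parcs G) (pverts G - set (map (nth as) ([0..<k] @ [Suc k]))) `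
      {u \<in> pverts G. u \<in> C G as - {as ! Suc k} \<and> component_type q e c G (map (nth as) ([0..<k] @ [Suc k])) u}))"
      by (rule definable_count_components[OF D T]) auto
    then show ?thesis
    proof (rule definable_cong)
      fix G :: "'a pair_pre_digraph" and as assume "as \<in> tuples ?m (pverts G)"
      then have "map (nth as) ([0..<k] @ [Suc k]) = bs as" by (simp add: tuples_def bs_def map_nth_upt)
      then show "at_least n (component (parcs G) (pverts G - set (map (nth as) ([0..<k] @ [Suc k]))) `
          {u \<in> pverts G. u \<in> C G as - {as ! Suc k} \<and> component_type q e c G (map (nth as) ([0..<k] @ [Suc k])) u}) \<longleftrightarrow>
        Bcnt n c G as" unfolding Bcnt_def by (simp only:)
    qed
  qed
  have "definable K ?m (\<lambda>G as. B0 G as \<and> tp q (parcs G) (C G as \<union> set (take k as)) (param_relations (take k as)) = c)"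
  proof (rule definable_determined[where I = Bs and B = "\<lambda>B. B"])
    show "finite Bs" unfolding Bs_def by simp
    show "definable K ?m B" if "B \<in> Bs" for B
      using that B0 Bcnt unfolding Bs_def Beq_def Bed_def by (auto intro: definable_eq definable_edge)
  next
    fix G as G' as'
    assume G: "G \<in> K" "as \<in> tuples ?m (pverts G)" and G': "G' \<in> K" "as' \<in> tuples ?m (pverts G')"
      and same: "\<And>B. B \<in> Bs \<Longrightarrow> B G as \<longleftrightarrow> B G' as'"
      and P: "B0 G as \<and> tp q (parcs G) (C G as \<union> set (take k as)) (param_relations (take k as)) = c"
    have "B0 G' as'" using P same[of B0] by (simp add: Bs_def)
    have core: "(as ! i = as ! j \<longleftrightarrow> as' ! i = as' ! j) \<and>
        ((as ! i, as ! j) \<in> parcs G \<longleftrightarrow> (as' ! i, as' ! j) \<in> parcs G')" if "i < ?m" "j < ?m" for i j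
      using same[of "Beq i j"] same[of "Bed i j"] that unfolding Bs_def by (auto simp: Beq_def Bed_def)
    have facts: "take k as @ [as ! Suc k] = bs as" "length (bs as) = Suc k" "length (take k as) = k"
      "as ! k \<in> pverts G - set (take k as)"
      "C G as \<subseteq> pverts G - set (take k as)"
      "C G as - {as ! Suc k} \<subseteq> pverts G - set (bs as)"
      "\<And>u. u \<in> C G as - {as ! Suc k} \<Longrightarrow>
        component (parcs G) (pverts G - set (bs as)) u \<subseteq> C G as - {as ! Suc k}"
      "\<And>u. u \<in> C G as - {as ! Suc k} \<Longrightarrow> good e G (bs as) u"
      "C G as - {as ! Suc k} \<union> set (bs as) = C G as \<union> set (take k as)"
      "\<And>i. i < Suc k \<Longrightarrow> bs as ! i = as ! (if i < k then i else Suc k)"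
      if G: "G \<in> K" "as \<in> tuples ?m (pverts G)" and B0: "B0 G as" for G as
    proof -
      have len: "length as = ?m" "as ! k \<in> pverts G" using G(2) by (auto simp: tuples_def)
      show bs: "take k as @ [as ! Suc k] = bs as" by (simp add: bs_def)
      show "length (bs as) = Suc k" "length (take k as) = k" using len by (auto simp: bs_def)
      show v: "as ! k \<in> pverts G - set (take k as)" using B0 len by (simp add: B0_def)
      show CV: "C G as \<subseteq> pverts G - set (take k as)" unfolding C_def by (rule component_subset[OF v])
      then show "C G as - {as ! Suc k} \<subseteq> pverts G - set (bs as)" by (auto simp: bs_def)
      show "C G as - {as ! Suc k} \<union> set (bs as) = C G as \<union> set (take k as)"
        using B0 by (auto simp: B0_def bs_def)
      show "bs as ! i = as ! (if i < k then i else Suc k)" if "i < Suc k" for i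
        using that len by (auto simp: bs_def nth_append)
      fix u assume u: "u \<in> C G as - {as ! Suc k}"
      show "component (parcs G) (pverts G - set (bs as)) u \<subseteq> C G as - {as ! Suc k}"
        using component_subset[OF u, of "parcs G"] component_remove[OF v u[unfolded C_def]]
        unfolding C_def bs by simp
      show "good e G (bs as) u"
        using B0 elim_depth_remove_iff[OF G(1) v, of e "as ! Suc k"] u CV
        unfolding B0_def C_def bs by blast
    qed
    note f = facts[OF G conjunct1[OF P]] and f' = facts[OF G' \<open>B0 G' as'\<close>]
    note sym = undirected_graphD(1)[OF undirected]
    have "tp q (parcs G) (C G as - {as ! Suc k} \<union> set (bs as)) (param_relations (bs as)) =
        tp q (parcs G') (C G' as' - {as' ! Suc k} \<union> set (bs as')) (param_relations (bs as'))"
    proof (rule tp_from_components[OF t(2) sym[OF G(1)] sym[OF G'(1)] _ _ f(6,7) f'(6,7)])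
      show "length (bs as) = length (bs as')" "length (bs as) \<le> d" using f(2) f'(2) Suc.prems by auto
      show "(bs as ! i = bs as ! j \<longleftrightarrow> bs as' ! i = bs as' ! j) \<and>
          ((bs as ! i, bs as ! j) \<in> parcs G \<longleftrightarrow> (bs as' ! i, bs as' ! j) \<in> parcs G')"
        if "i < length (bs as)" "j < length (bs as)" for i j
        using that core f(2) by (simp add: f(10) f'(10))
    next
      fix c
      have "Bcnt n c \<in> Bs" if "n \<le> t" "c < M" for n c using that by (auto simp: Bs_def)
      from same[OF this, unfolded Bcnt_def] show "eqcount t
        (component (parcs G) (pverts G - set (bs as)) ` {u \<in> C G as - {as ! Suc k}. tp q (parcs G)
          (component (parcs G) (pverts G - set (bs as)) u \<union> set (bs as)) (param_relations (bs as)) = c})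
        (component (parcs G') (pverts G' - set (bs as')) ` {u \<in> C G' as' - {as' ! Suc k}. tp q (parcs G')
          (component (parcs G') (pverts G' - set (bs as')) u \<union> set (bs as')) (param_relations (bs as')) = c})"
        by (intro eqcount_component_types[OF M, of _ _ e]) (use f(6,8) f'(6,8) in blast)+
    qed
    then have "tp q (parcs G) (C G as \<union> set (take k as)) (param_relations (bs as)) =
        tp q (parcs G') (C G' as' \<union> set (take k as')) (param_relations (bs as'))"
      unfolding f(9) f'(9) .
    \<comment> \<open>The last deleted vertex has index \<open>k\<close> in the list. Without its
      name it is an ordinary vertex of the component again.\<close>
    from tp_forget_param[OF this, of k]
    have "tp q (parcs G) (C G as \<union> set (take k as)) (param_relations (take k as)) =
        tp q (parcs G') (C G' as' \<union> set (take k as')) (param_relations (take k as'))"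
      using param_relations_snoc[of "take k as" "as ! Suc k"] param_relations_snoc[of "take k as'" "as' ! Suc k"]
      unfolding f(1,3) f'(1,3) by simp
    with P \<open>B0 G' as'\<close>
    show "B0 G' as' \<and> tp q (parcs G') (C G' as' \<union> set (take k as')) (param_relations (take k as')) = c"
      by simp
  qed
  \<comment> \<open>The type in this predicate does not depend on the deleted vertex
    \<open>w\<close>; the quantifier only asserts that an admissible one exists.\<close>
  from definable_Ex[OF this] show ?case
  proof (rule definable_cong)
    fix G as assume G: "G \<in> K" and as: "as \<in> tuples (Suc k) (pverts G)"
    then have len: "length as = Suc k" "as ! k \<in> pverts G" by (auto simp: tuples_def)
    have s: "take k (as @ [w]) = butlast as" "(as @ [w]) ! k = last as" "(as @ [w]) ! Suc k = w" for w
      using butlast_last_as_take[OF len(1)] len(1) by (auto simp: nth_append)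
    have "last as \<in> pverts G" using butlast_last_as_take[OF len(1)] len(2) by simp
    then show "(\<exists>w\<in>pverts G. B0 G (as @ [w]) \<and> tp q (parcs G) (C G (as @ [w]) \<union> set (take k (as @ [w])))
        (param_relations (take k (as @ [w]))) = c) \<longleftrightarrow>
      component_type q (Suc e) c G (butlast as) (last as)"
      unfolding B0_def C_def s component_type_def using good_Suc_iff[OF G, of "last as" e "butlast as"] by blast
  qed
qed

text \<open>The composition is applied once more, with no parameters and all vertices in the place
  of \<open>U\<close>; the full depth \<open>d\<close> is available for every component.\<close>

lemma definable_type: "definable K 0 (\<lambda>G as. tp q (parcs G) (pverts G) (param_relations []) = c)"
proof -
  obtain t where t: "1 \<le> t" "amalgamable TYPE('a) q t" using amalgamable by blast
  obtain M where M: "\<And>E W \<rho>. tp q (E :: ('a \<times> 'a) set) W \<rho> < M" using tp_bounded by blast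
  define B where "B = (\<lambda>(n, c) G (as :: 'a list). at_least n (component (parcs G) (pverts G - set []) `
    {u \<in> pverts G. u \<in> pverts G \<and> component_type q d c G [] u}))"
  have defB: "definable K 0 (\<lambda>G as. at_least n (component (parcs G) (pverts G - set (map (nth as) [])) `
    {u \<in> pverts G. u \<in> pverts G \<and> component_type q d c G (map (nth as) []) u}))" for n c
  proof (rule definable_count_components)
    have "definable K (Suc 0) (\<lambda>G as. True)" by (rule definable_True)
    then show "definable K (Suc 0) (\<lambda>G as. last as \<in> pverts G)"
      by (rule definable_cong) (auto simp: tuples_def length_Suc_conv)
    show "definable K (Suc (length [])) (\<lambda>G as. component_type q d c G (butlast as) (last as))"
      using definable_component_type[of 0 d] by simp
  qed simp
  show ?thesis
  proof (rule definable_determined[where I = "{..t} \<times> {..<M}" and B = B])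
    show "definable K 0 (B i)" for i using defB by (cases i) (simp add: B_def)
    fix G as G' as'
    assume G: "G \<in> K" and G': "G' \<in> K"
      and same: "\<And>i. i \<in> {..t} \<times> {..<M} \<Longrightarrow> B i G as \<longleftrightarrow> B i G' as'"
      and c: "tp q (parcs G) (pverts G) (param_relations []) = c"
    note sym = undirected_graphD(1)[OF undirected]
    have sub: "component (parcs G) (pverts G - set []) u \<subseteq> pverts G" if "u \<in> pverts G"
      for G :: "'a pair_pre_digraph" and u
      using component_subset[of u "pverts G - set []" "parcs G"] that by simp
    have gd: "good d G [] u" if "G \<in> K" "u \<in> pverts G" for G u
      unfolding good_def using elim_depth_mono[OF elim_depth[OF that(1)] sub[OF that(2)]] by simp
    have "tp q (parcs G) (pverts G \<union> set []) (param_relations []) =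
        tp q (parcs G') (pverts G' \<union> set []) (param_relations [])"
    proof (rule tp_from_components[OF t(2) sym[OF G] sym[OF G']])
      fix c
      have "at_least n (component (parcs G) (pverts G - set []) `
          {u \<in> pverts G. u \<in> pverts G \<and> component_type q d c G [] u}) \<longleftrightarrow>
        at_least n (component (parcs G') (pverts G' - set []) `
          {u \<in> pverts G'. u \<in> pverts G' \<and> component_type q d c G' [] u})" if "n \<le> t" "c < M" for n c
        using same[of "(n, c)"] that by (simp add: B_def)
      then show "eqcount t
        (component (parcs G) (pverts G - set []) ` {u \<in> pverts G. tp q (parcs G)
          (component (parcs G) (pverts G - set []) u \<union> set []) (param_relations []) = c})
        (component (parcs G') (pverts G' - set []) ` {u \<in> pverts G'. tp q (parcs G')
          (component (parcs G') (pverts G' - set []) u \<union> set []) (param_relations []) = c})"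
        using gd[OF G] gd[OF G'] by (intro eqcount_component_types[OF M, of _ _ d]) auto
    qed (use sub in auto)
    with c show "tp q (parcs G') (pverts G') (param_relations []) = c" by simp
  qed simp
qed

text \<open>Satisfaction depends only on the type of rank \<open>q\<close>, which takes fewer than
  \<open>M + 1\<close> values, and having a given type is definable.\<close>

lemma definable_sentence:
  assumes \<phi>: "sentence \<phi>" "vocabulary \<phi> \<subseteq> Mv"
  shows "definable K 0 (\<lambda>G as. sat_sentence (guarded G) G \<phi>)"
proof -
  obtain q where q: "determines TYPE('a) q \<phi>" using determines_exists[OF \<phi>(2)] by blast
  obtain M where M: "\<And>E W \<rho>. tp q (E :: ('a \<times> 'a) set) W \<rho> < M" using tp_bounded by blast
  show ?thesis
  proof (rule definable_determined[where I = "{..<M}" and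
        B = "\<lambda>c G as. tp q (parcs G) (pverts G) (param_relations []) = c"])
    fix G as G' as'
    assume G: "G \<in> K" "G' \<in> K"
      and same: "\<And>c. c \<in> {..<M} \<Longrightarrow> tp q (parcs G) (pverts G) (param_relations []) = c \<longleftrightarrow>
        tp q (parcs G') (pverts G') (param_relations []) = c"
      and sat: "sat_sentence (guarded G) G \<phi>"
    have enc: "encodes V \<alpha> \<sigma> \<rho> \<phi>" for V \<alpha> \<sigma> \<rho>
      using \<phi>(1) by (simp add: encodes_def sentence_def)
    have "tp q (parcs G) (pverts G) (param_relations []) = tp q (parcs G') (pverts G') (param_relations [])"
      using same M by blast
    from determinesD[OF q undirected[OF G(1)] undirected[OF G(2)] enc enc this]
    show "sat_sentence (guarded G') G' \<phi>" using sat unfolding sat_sentence_def .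
  qed (auto intro: definable_type)
qed

end

section \<open>Conclusion of the equivalence\<close>

lemma GSO_FO_if_bounded_tree_depth:
  fixes C :: "'a pair_pre_digraph set"
  assumes C: "graph_class C" and bd: "bounded_tree_depth C"
  shows "at_most_as_expressive C GSO FO"
  unfolding at_most_as_expressive_def
proof
  fix \<phi> assume "\<phi> \<in> sentences (GSO :: 'a logic)"
  then have \<phi>: "sentence \<phi>" by (simp add: GSO_def)
  obtain d :: nat where d: "\<And>G. G \<in> C \<Longrightarrow> td (with_proj G) \<le> enat d"
    using bd unfolding bounded_tree_depth_def by blast
  have U: "undirected_graph G" if "G \<in> C" for G using C that by (simp add: graph_class_def)
  interpret bounded_elim_types d "insert Spare (vocabulary \<phi>)" C
  proof
    fix G assume G: "G \<in> C"
    show "undirected_graph G" by (rule U) fact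
    note D = undirected_graphD[OF U[OF G]]
    have "with_proj G \<restriction> pverts G = with_proj G" using restrict_verts[OF D(3)] by simp
    then show "elim_depth (parcs G) d (pverts G)"
      using elim_depth_if_td[OF D(1), of "pverts G" d] d[OF G] by simp
  qed (auto simp: finite_vocabulary Param_vocabulary)
  have "definable C 0 (\<lambda>G as. sat_sentence (guarded G) G \<phi>)"
    by (rule definable_sentence[OF \<phi>]) blast
  then obtain \<psi> where "first_order \<psi>" "free_vars \<psi> \<subseteq> {..<0}"
    and sat: "\<forall>G\<in>C. \<forall>as\<in>tuples 0 (pverts G). \<forall>adm \<sigma> \<rho>. (\<forall>i<0. \<sigma> i = as ! i) \<longrightarrow>
      (sat_sentence (guarded G) G \<phi> \<longleftrightarrow> sat adm G \<sigma> \<rho> \<psi>)"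
    using definable_imp_formula by blast
  moreover have "free_rel_vars \<chi> = {}" if "first_order \<chi>" for \<chi> using that by (induction \<chi>) auto
  ultimately have "\<psi> \<in> sentences (FO :: 'a logic)" by (simp add: FO_def sentence_def)
  moreover have "models GSO G \<phi> \<longleftrightarrow> models FO G \<psi>" if "G \<in> C" for G
    using sat that by (simp add: GSO_def FO_def sat_sentence_def tuples_def)
  ultimately show "\<exists>\<psi>\<in>sentences (FO :: 'a logic). \<forall>G\<in>C. models GSO G \<phi> \<longleftrightarrow> models FO G \<psi>" by blast
qed

theorem theorem2:
  fixes C :: "'a pair_pre_digraph set"
  assumes "graph_class C" and "closed_under_subgraphs C"
  shows "(same_expressive_power C FO MSO \<longleftrightarrow> same_expressive_power C FO GSO)
       \<and> (same_expressive_power C FO GSO \<longleftrightarrow> bounded_tree_depth C)"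
  unfolding same_expressive_power_def
  \<comment> \<open>The translation of MSO gives bounded tree depth, this gives the translation of
    GSO, and that one gives back the translation of MSO; FO is contained in both logics on every
    class.\<close>
  using at_most_FO_MSO at_most_FO_GSO at_most_MSO_if_GSO[OF assms(1)]
    bounded_tree_depth_if_MSO_FO[OF assms] GSO_FO_if_bounded_tree_depth[OF assms(1)]
  by blast

end
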